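(* Let $m=2$, $n=6$. Then $\mathcal{R}_2^6=\hat{\mathcal{I}}_2^6$; that is, a rational function on $X_2^6$ is the restriction to $X_2^6$ of an absolute classical invariant of binary sextics if and only if it is of the form $Q\mapsto\mathcal{I}(\mathbf{Q})$, where $\mathcal{I}$ is an absolute classical invariant of binary forms of degree $m(n-2)=8$ and $\mathbf{Q}$ is a form associated to $Q\in X_2^6$.
   Context: For integers $m\ge2$, $d\ge 2$, let $\mathcal{Q}^d_{\mathbb{C}^m}$ be the space of forms (homogeneous polynomials) of degree $d$ on $\mathbb{C}^m$, with $\mathrm{GL}(m,\mathbb{C})$ acting by $Q_C(z):=Q(C^{-1}z)$. A (relative classical) invariant is a polynomial $I:\mathcal{Q}^d_{\mathbb{C}^m}\to\mathbb{C}$ for which there is a non-negative integer $k$ (the weight) with $I(Q)=(\det C)^kI(Q_C)$ for all $Q$ and all $C\in\mathrm{GL}(m,\mathbb{C})$. An absolute (classical) invariant is a rational function $I/\tilde I$, where $I,\tilde I$ are relative invariants of equal weight and $\tilde I\not\equiv0$. Let $X_m^n$ be the set of $Q\in\mathcal{Q}^n_{\mathbb{C}^m}$ with non-zero discriminant; for $m=2$ it is the set of non-zero square-free binary forms of degree $n$ (i.e. products of $n$ pairwise non-proportional non-zero linear forms). Associated forms. Let $n\ge3$ and $Q\in X_m^n$. Let $\mathcal{O}_m$ be the algebra of holomorphic function germs at $0\in\mathbb{C}^m$, $\mathcal{J}(Q)$ the ideal generated by all first-order partial derivatives of $Q$, and $\mathcal{A}:=\mathcal{O}_m/\mathcal{J}(Q)$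 (this is the moduli algebra of the germ of $\{Q=0\}$ at $0$). It is a finite-dimensional local Gorenstein algebra; its maximal ideal $\mathfrak{m}$ satisfies $\dim_{\mathbb{C}}\mathfrak{m}/\mathfrak{m}^2=m$, $\mathfrak{m}^{\nu}\neq0=\mathfrak{m}^{\nu+1}$ with $\nu=m(n-2)$, and $\mathrm{Ann}(\mathfrak{m})=\mathfrak{m}^\nu$ is one-dimensional. For any linear form $\omega:\mathfrak{m}\to\mathbb{C}$ not vanishing on $\mathrm{Ann}(\mathfrak{m})$, the nil-polynomial $P=\omega\circ\left(\sum_{s\ge2}\frac{1}{s!}u^s\right)\big|_{\ker\omega}$ has degree $\nu$, and its highest-order component induces the form $\hat P^{[\nu]}(u\bmod\mathfrak{m}^2)=\frac{1}{\nu!}\omega(u^\nu)$ on $\mathfrak{m}/\mathfrak{m}^2$. Using the coordinates $w_1,\dots,w_m$ on $\mathfrak{m}/\mathfrak{m}^2$ with respect to the basis given by the images of the coordinate functions $z_1,\dots,z_m$, this is a form of degree $m(n-2)$ in $w_1,\dots,w_m$, namely $\frac{1}{\nu!}\omega\big((w_1\bar z_1+\dots+w_m\bar z_m)^\nu\big)$, where $\bar z_j$ is the class of $z_j$ in $\mathcal{A}$. Any of the (mutually proportional) forms arising in this way is said to be associated to $Q$ and is denoted $\mathbf{Q}$. For an absolute classical invariant $\mathcal{I}$ of forms of degree $m(n-2)$ in $w_1,\dots,w_m$, the value $\mathcal{I}(\mathbf{Q})$ does not depend on the choice of $\mathbf{Q}$ and, as a function of $Q\in X_m^n$, is rational (one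 considers those $\mathcal{I}$ for which it is defined for generic $Q$). $\mathcal{R}_m^n$ denotes the collection of all invariant rational functions on $X_m^n$ obtained in this way. $\hat{\mathcal{I}}_m^n$ denotes the algebra of the restrictions to $X_m^n$ of all absolute invariants of forms of degree $n$ on $\mathbb{C}^m$. *)

theory Defs
  imports "HOL-Analysis.Analysis" "HOL-Algebra.QuotRing"
begin

definition forms :: "nat \<Rightarrow> (complex^'m::finite \<Rightarrow> complex) set" where
  "forms d = {Q. \<exists>c :: ('m \<Rightarrow> nat) \<Rightarrow> complex.
     \<forall>z. Q z = (\<Sum>\<alpha> | sum \<alpha> UNIV = d. c \<alpha> * (\<Prod>i\<in>UNIV. (z $ i) ^ \<alpha> i))}"

text \<open>Polynomials on a complex vector space \<open>V\<close> of functions: the algebra generated by the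
  linear functionals on \<open>V\<close>. The values outside \<open>V\<close> are unconstrained and never used.\<close>

inductive_set polynomials_on :: "('a \<Rightarrow> complex) set \<Rightarrow> (('a \<Rightarrow> complex) \<Rightarrow> complex) set"
  for V :: "('a \<Rightarrow> complex) set" where
  const: "(\<lambda>_. c) \<in> polynomials_on V"
| linear: "(\<And>f g a b. f \<in> V \<Longrightarrow> g \<in> V \<Longrightarrow> L (\<lambda>z. a * f z + b * g z) = a * L f + b * L g)
    \<Longrightarrow> L \<in> polynomials_on V"
| add: "p \<in> polynomials_on V \<Longrightarrow> q \<in> polynomials_on V \<Longrightarrow> (\<lambda>f. p f + q f) \<in> polynomials_on V"
| mult: "p \<in> polynomials_on V \<Longrightarrow> q \<in> polynomials_on V \<Longrightarrow> (\<lambda>f. p f * q f) \<in> polynomials_on V"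

definition form_action :: "complex^'m^'m \<Rightarrow> (complex^'m \<Rightarrow> complex) \<Rightarrow> (complex^'m::finite \<Rightarrow> complex)"
  where "form_action C Q = (\<lambda>z. Q (matrix_inv C *v z))"

definition relative_invariant :: "nat \<Rightarrow> nat \<Rightarrow> ((complex^'m::finite \<Rightarrow> complex) \<Rightarrow> complex) \<Rightarrow> bool"
  where "relative_invariant d k I \<longleftrightarrow> I \<in> polynomials_on (forms d) \<and>
    (\<forall>Q\<in>forms d. \<forall>C. invertible C \<longrightarrow> I Q = det C ^ k * I (form_action C Q))"

text \<open>The absolute invariant is the fraction \<open>I / I'\<close>.\<close>

definition absolute_invariant ::
    "nat \<Rightarrow> ((complex^'m::finite \<Rightarrow> complex) \<Rightarrow> complex) \<Rightarrow> ((complex^'m \<Rightarrow> complex) \<Rightarrow> complex) \<Rightarrow> bool"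
  where "absolute_invariant d I I' \<longleftrightarrow>
    (\<exists>k. relative_invariant d k I \<and> relative_invariant d k I') \<and> (\<exists>Q\<in>forms d. I' Q \<noteq> 0)"

text \<open>Here \<open>X\<close> is meant to be a non-empty Zariski open subset of the vector space \<open>V\<close>. The rational
  function \<open>p / q\<close> on \<open>X\<close> is the class of all fractions of polynomials that are equal to it.\<close>

definition rational_function ::
    "('a \<Rightarrow> complex) set \<Rightarrow> ('a \<Rightarrow> complex) set \<Rightarrow>
     (('a \<Rightarrow> complex) \<Rightarrow> complex) \<Rightarrow> (('a \<Rightarrow> complex) \<Rightarrow> complex) \<Rightarrow>
     ((('a \<Rightarrow> complex) \<Rightarrow> complex) \<times> (('a \<Rightarrow> complex) \<Rightarrow> complex)) set"
  where "rational_function V X p q =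
    {(p', q'). p' \<in> polynomials_on V \<and> q' \<in> polynomials_on V \<and> (\<exists>Q\<in>X. q' Q \<noteq> 0) \<and>
       (\<forall>Q\<in>X. p Q * q' Q = p' Q * q Q)}"

definition generically ::
    "('a \<Rightarrow> complex) set \<Rightarrow> ('a \<Rightarrow> complex) set \<Rightarrow> (('a \<Rightarrow> complex) \<Rightarrow> bool) \<Rightarrow> bool"
  where "generically V X P \<longleftrightarrow>
    (\<exists>g\<in>polynomials_on V. (\<exists>Q\<in>X. g Q \<noteq> 0) \<and> (\<forall>Q\<in>X. g Q \<noteq> 0 \<longrightarrow> P Q))"

definition holomorphic_near_0 :: "(complex^'m::finite \<Rightarrow> complex) \<Rightarrow> bool" where
  "holomorphic_near_0 f \<longleftrightarrow>
    (\<forall>\<^sub>F z in nhds 0. \<exists>D. (f has_derivative D) (at z) \<and> (\<forall>c v. D (c *s v) = c * D v))"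

definition germ :: "(complex^'m::finite \<Rightarrow> complex) \<Rightarrow> (complex^'m \<Rightarrow> complex) set" where
  "germ f = {g. \<forall>\<^sub>F z in nhds 0. g z = f z}"

text \<open>Sums and products do not depend on the representatives, so each union below is a single germ.\<close>

definition germ_ring :: "(complex^'m::finite \<Rightarrow> complex) set ring" where
  "germ_ring =
    \<lparr>carrier = germ ` {f. holomorphic_near_0 f},
     mult = (\<lambda>a b. \<Union>f\<in>a. \<Union>g\<in>b. germ (\<lambda>z. f z * g z)),
     one = germ (\<lambda>_. 1),
     zero = germ (\<lambda>_. 0),
     add = (\<lambda>a b. \<Union>f\<in>a. \<Union>g\<in>b. germ (\<lambda>z. f z + g z))\<rparr>"

definition partial_derivative ::
    "'m \<Rightarrow> (complex^'m::finite \<Rightarrow> complex) \<Rightarrow> (complex^'m \<Rightarrow> complex)"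
  where "partial_derivative i Q = (\<lambda>z. deriv (\<lambda>t. Q (z + t *s axis i 1)) 0)"

definition jacobian_ideal :: "(complex^'m::finite \<Rightarrow> complex) \<Rightarrow> (complex^'m \<Rightarrow> complex) set set"
  where "jacobian_ideal Q = Idl\<^bsub>germ_ring\<^esub> (range (\<lambda>i. germ (partial_derivative i Q)))"

definition moduli_algebra ::
    "(complex^'m::finite \<Rightarrow> complex) \<Rightarrow> (complex^'m \<Rightarrow> complex) set set ring"
  where "moduli_algebra Q = germ_ring Quot (jacobian_ideal Q)"

definition class_in_algebra ::
    "(complex^'m::finite \<Rightarrow> complex) \<Rightarrow> (complex^'m \<Rightarrow> complex) \<Rightarrow> (complex^'m \<Rightarrow> complex) set set"
  where "class_in_algebra Q f = jacobian_ideal Q +>\<^bsub>germ_ring\<^esub> germ f"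

definition scale_algebra ::
    "(complex^'m::finite \<Rightarrow> complex) \<Rightarrow> complex \<Rightarrow> (complex^'m \<Rightarrow> complex) set set
      \<Rightarrow> (complex^'m \<Rightarrow> complex) set set"
  where "scale_algebra Q c a = class_in_algebra Q (\<lambda>_. c) \<otimes>\<^bsub>moduli_algebra Q\<^esub> a"

definition linear_form_on ::
    "(complex^'m::finite \<Rightarrow> complex) \<Rightarrow> (complex^'m \<Rightarrow> complex) set set set
      \<Rightarrow> ((complex^'m \<Rightarrow> complex) set set \<Rightarrow> complex) \<Rightarrow> bool"
  where "linear_form_on Q M \<omega> \<longleftrightarrow>
    (\<forall>a\<in>M. \<forall>b\<in>M. \<omega> (a \<oplus>\<^bsub>moduli_algebra Q\<^esub> b) = \<omega> a + \<omega> b) \<and>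
    (\<forall>c. \<forall>a\<in>M. \<omega> (scale_algebra Q c a) = c * \<omega> a)"

definition annihilator_in ::
    "(complex^'m::finite \<Rightarrow> complex) \<Rightarrow> (complex^'m \<Rightarrow> complex) set set set
      \<Rightarrow> (complex^'m \<Rightarrow> complex) set set set"
  where "annihilator_in Q M = {a \<in> carrier (moduli_algebra Q).
    \<forall>b\<in>M. a \<otimes>\<^bsub>moduli_algebra Q\<^esub> b = \<zero>\<^bsub>moduli_algebra Q\<^esub>}"

text \<open>For \<open>Q\<close> of degree \<open>n \<ge> 3\<close> with non-zero discriminant the moduli algebra is local with
  nilpotent maximal ideal \<open>M\<close>, and the annihilator of \<open>M\<close> is \<open>M ^ \<nu>\<close> for \<open>\<nu> = CARD('m) * (n - 2)\<close>.
  The coordinate form of the top component of the nil-polynomial of \<open>\<omega>\<close>, with respect to the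
  images of the coordinate functions, is \<open>w \<mapsto> \<omega> ((w\<^sub>1 z\<^sub>1 + \<dots> + w\<^sub>m z\<^sub>m) ^ \<nu>) / \<nu>!\<close>.\<close>

definition associated_forms ::
    "nat \<Rightarrow> (complex^'m::finite \<Rightarrow> complex) \<Rightarrow> (complex^'m \<Rightarrow> complex) set"
  where "associated_forms n Q =
    {B. \<exists>M \<omega>. maximalideal M (moduli_algebra Q) \<and> linear_form_on Q M \<omega> \<and>
       (\<exists>a\<in>annihilator_in Q M. \<omega> a \<noteq> 0) \<and>
       B = (\<lambda>w. \<omega> ((\<Oplus>\<^bsub>moduli_algebra Q\<^esub>i\<in>UNIV.
                     scale_algebra Q (w $ i) (class_in_algebra Q (\<lambda>z. z $ i)))
                   [^]\<^bsub>moduli_algebra Q\<^esub> (CARD('m) * (n - 2)))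
               / fact (CARD('m) * (n - 2)))}"

text \<open>The binary forms of degree \<open>n\<close> with non-zero discriminant: products of \<open>n\<close> pairwise
  non-proportional non-zero linear forms.\<close>

definition squarefree_forms :: "nat \<Rightarrow> (complex^2 \<Rightarrow> complex) set" where
  "squarefree_forms n = {Q. \<exists>l :: nat \<Rightarrow> complex^2 \<Rightarrow> complex.
     (\<forall>i<n. l i \<in> forms 1 \<and> l i \<noteq> (\<lambda>_. 0)) \<and>
     (\<forall>i<n. \<forall>j<n. i \<noteq> j \<longrightarrow> \<not> (\<exists>c. l i = (\<lambda>z. c * l j z))) \<and>
     Q = (\<lambda>z. \<Prod>i<n. l i z)}"

definition restricted_absolute_invariants ::
    "nat \<Rightarrow> (((complex^2 \<Rightarrow> complex) \<Rightarrow> complex) \<times> ((complex^2 \<Rightarrow> complex) \<Rightarrow> complex)) set set"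
  where "restricted_absolute_invariants n =
    {rational_function (forms n) (squarefree_forms n) I I' | I I'. absolute_invariant n I I'}"

text \<open>The rational functions on the set of forms \<open>Q\<close> with non-zero discriminant that are of the form
  \<open>Q \<mapsto> I(B) / I'(B)\<close>, with \<open>B\<close> associated to \<open>Q\<close> and \<open>I / I'\<close> an absolute invariant of forms of the
  degree of \<open>B\<close> that is defined at \<open>B\<close> for generic \<open>Q\<close>.\<close>

definition associated_form_invariants ::
    "nat \<Rightarrow> (((complex^2 \<Rightarrow> complex) \<Rightarrow> complex) \<times> ((complex^2 \<Rightarrow> complex) \<Rightarrow> complex)) set set"
  where "associated_form_invariants n =
    {rational_function (forms n) (squarefree_forms n) p q | p q.
       p \<in> polynomials_on (forms n) \<and> q \<in> polynomials_on (forms n) \<and>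
       (\<exists>Q\<in>squarefree_forms n. q Q \<noteq> 0) \<and>
       (\<exists>I I'. absolute_invariant (2 * (n - 2)) I I' \<and>
          generically (forms n) (squarefree_forms n)
            (\<lambda>Q. q Q \<noteq> 0 \<and> (\<forall>B\<in>associated_forms n Q. I' B \<noteq> 0 \<and> p Q / q Q = I B / I' B)))}"

end

theory Submission
  imports Defs "HOL-Complex_Analysis.Complex_Analysis"
    "HOL-Computational_Algebra.Fundamental_Theorem_Algebra" "Jordan_Normal_Form.Determinant"
begin

text \<open>Both inclusions come from a pair of covariant polynomial maps, one in each direction, between
  sextics \<open>Q\<close> and octics \<open>B\<close>.

  Read an octic \<open>B\<close> as the linear functional on octics that sends \<open>(w \<cdot> z)^8\<close> to \<open>B(w)\<close> (the apolar
  pairing). If \<open>B\<close> is associated to \<open>Q\<close>, this functional is, up to a factor, the given functional on the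
  moduli algebra, restricted to degree 8. It vanishes on the part of degree 8 of the Jacobian ideal,
  which is a hyperplane, and it is not zero, since the annihilator of the maximal ideal is spanned by
  classes of octics (\<open>socle_is_top_degree\<close>). So \<open>B\<close> is determined by \<open>Q\<close> up to a factor. By Euler's relation
  the hyperplane is spanned by the octics \<open>n Q\<close> with \<open>n\<close> quadratic and the Poisson brackets \<open>{m, Q}\<close> with \<open>m\<close>
  quartic. The equations \<open>B(n Q) = 0\<close> and \<open>B({m, Q}) = 0\<close> are linear in \<open>Q\<close> and in \<open>B\<close>, and equivariant
  under linear substitutions. Each of \<open>Q\<close> and \<open>B\<close> can therefore be computed from the other by minors.

  From \<open>Q\<close> to \<open>B\<close>: these are eight equations for the nine coefficients of \<open>B\<close>, and their maximal minors are
  the coefficients of an octic \<open>dual_form Q\<close> that depends polynomially and covariantly on \<open>Q\<close>. Hence a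
  relative invariant of octics, evaluated at \<open>dual_form Q\<close>, is a relative invariant of sextics
  (\<open>relative_invariant_dual_form\<close>). Quotients of invariants of equal weight do not see the factor between
  \<open>B\<close> and \<open>dual_form Q\<close>, and this gives the inclusion of the invariants of associated forms in the
  restricted absolute invariants.

  From \<open>B\<close> to \<open>Q\<close>: for a point \<open>t\<close> of the plane, the quartics \<open>m = (t \<cdot> z)^2 n'\<close> and all quadratic \<open>n\<close> give
  six equations for the seven coefficients of \<open>Q\<close>, and their maximal minors define a sextic
  \<open>reconstruct B t\<close>. If \<open>B\<close> belongs to \<open>Q\<close>, then \<open>reconstruct B t = M(t) Q\<close> with a factor \<open>M(t)\<close> that is a form
  of degree 6 in \<open>t\<close> (\<open>reconstruct_factor\<close>). A relative invariant \<open>p\<close> of sextics is homogeneous of some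
  degree \<open>d\<close>, so \<open>p(reconstruct B t) = M(t)^d p(Q)\<close>. The invariant pairing of binary forms of degree \<open>6 d\<close>
  removes the point \<open>t\<close>: for \<open>p\<close> and \<open>q\<close> of equal weight, \<open>polarized d p q\<close> is a relative invariant of octics
  with value \<open>p(Q) q(Q) \<langle>M^d, M^d\<rangle>\<close> at \<open>B\<close>, and \<open>p / q\<close> is the quotient of \<open>polarized d p q\<close> by
  \<open>polarized d q q\<close>. This needs \<open>\<langle>M^d, M^d\<rangle> \<noteq> 0\<close> for generic \<open>Q\<close>. It suffices to find one such \<open>Q\<close>, and the
  octahedral sextic \<open>x y (x^4 - y^4)\<close> is one: there \<open>M\<close> is a multiple of the sextic itself, and the pairing
  is a sum of squares of real numbers (\<open>skew_octa\<close>).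

  Statements about generic \<open>Q\<close> are proved where finitely many explicit determinants do not vanish, and
  extended by the Zariski density of the square-free forms.\<close>

section \<open>Algebras of functions\<close>

text \<open>Polynomial dependence on a parameter enters only through closure under the ring operations. The
  same closure lemmas for determinants, pairings and composites then apply to polynomials on a space
  of forms, to polynomials in a point of the plane and to polynomials on a line.\<close>

definition function_algebra :: "('x \<Rightarrow> complex) set \<Rightarrow> bool" where
  "function_algebra S \<longleftrightarrow> (\<forall>c. (\<lambda>_. c) \<in> S) \<and>
    (\<forall>f\<in>S. \<forall>g\<in>S. (\<lambda>x. f x + g x) \<in> S \<and> (\<lambda>x. f x * g x) \<in> S)"

lemma function_algebraD:
  assumes "function_algebra S"
  shows "(\<lambda>_. c) \<in> S" "f \<in> S \<Longrightarrow> g \<in> S \<Longrightarrow> (\<lambda>x. f x + g x) \<in> S"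
    "f \<in> S \<Longrightarrow> g \<in> S \<Longrightarrow> (\<lambda>x. f x * g x) \<in> S"
  using assms unfolding function_algebra_def by auto

lemma function_algebra_sum:
  assumes S: "function_algebra S" and "\<And>i. i \<in> A \<Longrightarrow> (\<lambda>x. f x i) \<in> S"
  shows "(\<lambda>x. \<Sum>i\<in>A. f x i) \<in> S"
  using assms(2)
  by (induction A rule: infinite_finite_induct) (auto intro: function_algebraD[OF S])

lemma function_algebra_prod:
  assumes S: "function_algebra S" and "\<And>i. i \<in> A \<Longrightarrow> (\<lambda>x. f x i) \<in> S"
  shows "(\<lambda>x. \<Prod>i\<in>A. f x i) \<in> S"
  using assms(2)
  by (induction A rule: infinite_finite_induct) (auto intro: function_algebraD[OF S])

lemma function_algebra_power:
  assumes S: "function_algebra S" and "f \<in> S"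
  shows "(\<lambda>x. f x ^ n) \<in> S"
  using assms(2) by (induction n) (auto intro: function_algebraD[OF S])

lemma function_algebra_diff:
  assumes S: "function_algebra S" and "f \<in> S" "g \<in> S"
  shows "(\<lambda>x. f x - g x) \<in> S"
proof -
  have "(\<lambda>x. f x + (-1) * g x) \<in> S"
    using assms by (intro function_algebraD[OF S])
  then show ?thesis by simp
qed

section \<open>Determinants of matrices indexed by natural numbers\<close>

text \<open>Indices are natural numbers, so that a matrix can be put together from rows of different origin and
  from blocks whose sizes are computed.\<close>

definition ndet :: "nat \<Rightarrow> (nat \<Rightarrow> nat \<Rightarrow> complex) \<Rightarrow> complex" where
  "ndet n M = Determinant.det (Matrix.mat n n (\<lambda>(i, j). M i j))"

lemma ndet_cong:
  assumes "\<And>i j. i < n \<Longrightarrow> j < n \<Longrightarrow> M i j = N i j"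
  shows "ndet n M = ndet n N"
  unfolding ndet_def by (rule arg_cong[of _ _ Determinant.det], rule eq_matI) (auto simp: assms)

lemma ndet_mult:
  "ndet n (\<lambda>i j. \<Sum>k<n. X i k * Y k j) = ndet n X * ndet n Y"
proof -
  have "Matrix.mat n n (\<lambda>(i, j). \<Sum>k<n. X i k * Y k j)
      = Matrix.mat n n (\<lambda>(i, j). X i j) * Matrix.mat n n (\<lambda>(i, j). Y i j)"
    by (rule eq_matI) (auto simp: scalar_prod_def atLeast0LessThan intro!: sum.cong)
  then show ?thesis unfolding ndet_def by (simp add: Determinant.det_mult[of _ n])
qed

lemma ndet_transpose: "ndet n (\<lambda>i j. M j i) = ndet n M"
proof -
  have "Matrix.mat n n (\<lambda>(i, j). M j i) = transpose_mat (Matrix.mat n n (\<lambda>(i, j). M i j))"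
    by (rule eq_matI) auto
  then show ?thesis unfolding ndet_def by (simp add: Determinant.det_transpose[of _ n])
qed

lemma ndet_lower_triangular:
  assumes "\<And>i j. i < j \<Longrightarrow> j < n \<Longrightarrow> M i j = 0"
  shows "ndet n M = (\<Prod>i<n. M i i)"
proof -
  have "ndet n M = prod_list (diag_mat (Matrix.mat n n (\<lambda>(i, j). M i j)))"
    unfolding ndet_def by (rule det_lower_triangular[of n]) (auto simp: assms)
  also have "\<dots> = (\<Prod>i<n. M i i)"
    unfolding diag_mat_def
    by (simp add: interv_sum_list_conv_sum_set_nat prod.distinct_set_conv_list[symmetric]
        atLeast0LessThan)
  finally show ?thesis .
qed

lemma ndet_upper_triangular:
  assumes "\<And>i j. j < i \<Longrightarrow> i < n \<Longrightarrow> M i j = 0"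
  shows "ndet n M = (\<Prod>i<n. M i i)"
  using ndet_lower_triangular[of n "\<lambda>i j. M j i"] assms ndet_transpose[of n M] by simp

lemma ndet_block_diagonal:
  "ndet (a + b) (\<lambda>i j. if i < a \<and> j < a then X i j
      else if a \<le> i \<and> a \<le> j then Y (i - a) (j - a) else 0) = ndet a X * ndet b Y"
proof -
  let ?X = "Matrix.mat a a (\<lambda>(i, j). X i j)" and ?Y = "Matrix.mat b b (\<lambda>(i, j). Y i j)"
  have "Matrix.mat (a + b) (a + b) (\<lambda>(i, j). if i < a \<and> j < a then X i j
      else if a \<le> i \<and> a \<le> j then Y (i - a) (j - a) else 0)
    = four_block_mat ?X (0\<^sub>m a b) (0\<^sub>m b a) ?Y"
    by (rule eq_matI) auto
  then show ?thesis
    unfolding ndet_def by (simp add: det_four_block_mat_lower_left_zero[of _ a _ b])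
qed

text \<open>The matrix of a linear system with \<open>n\<close> equations and \<open>n + 1\<close> unknowns, completed by a last row.\<close>

definition bordered :: "nat \<Rightarrow> (nat \<Rightarrow> nat \<Rightarrow> complex) \<Rightarrow> (nat \<Rightarrow> complex) \<Rightarrow> nat \<Rightarrow> nat \<Rightarrow> complex" where
  "bordered n M v i j = (if i < n then M i j else v j)"

text \<open>The cofactors along the last row are the signed maximal minors of the system.\<close>

definition border_cofactor :: "nat \<Rightarrow> (nat \<Rightarrow> nat \<Rightarrow> complex) \<Rightarrow> nat \<Rightarrow> complex" where
  "border_cofactor n M j =
    Determinant.cofactor (Matrix.mat (Suc n) (Suc n) (\<lambda>(i, k). M i k)) n j"

lemma border_cofactor_cong:
  assumes "\<And>i k. i < n \<Longrightarrow> k < Suc n \<Longrightarrow> M i k = N i k" "j < Suc n"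
  shows "border_cofactor n M j = border_cofactor n N j"
proof -
  have "mat_delete (Matrix.mat (Suc n) (Suc n) (\<lambda>(i, k). M i k)) n j
      = mat_delete (Matrix.mat (Suc n) (Suc n) (\<lambda>(i, k). N i k)) n j"
    using assms by (intro eq_matI) (auto simp: mat_delete_def)
  then show ?thesis unfolding border_cofactor_def Determinant.cofactor_def by simp
qed

lemma ndet_bordered:
  "ndet (Suc n) (bordered n M v) = (\<Sum>j<Suc n. v j * border_cofactor n M j)"
proof -
  let ?A = "Matrix.mat (Suc n) (Suc n) (\<lambda>(i, j). bordered n M v i j)"
  have "ndet (Suc n) (bordered n M v) = (\<Sum>j<Suc n. ?A $$ (n, j) * Determinant.cofactor ?A n j)"
    unfolding ndet_def by (rule laplace_expansion_row) auto
  also have "\<dots> = (\<Sum>j<Suc n. v j * border_cofactor n (bordered n M v) j)"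
    unfolding border_cofactor_def
    by (intro sum.cong refl arg_cong2[of _ _ _ _ "(*)"]) (auto simp: bordered_def)
  also have "\<dots> = (\<Sum>j<Suc n. v j * border_cofactor n M j)"
    by (intro sum.cong refl arg_cong2[of _ _ _ _ "(*)"] border_cofactor_cong)
      (auto simp: bordered_def)
  finally show ?thesis .
qed

text \<open>Cramer's rule for a system with one more unknown than equations: replacing column \<open>j\<close> by the
  combination of all columns with weights \<open>x\<close> multiplies the determinant by \<open>x j\<close> and clears that column
  except for its last entry. As a function of the last row, the determinant is thus proportional to
  evaluation at the solution \<open>x\<close>.\<close>

lemma bordered_cramer:
  assumes x: "\<And>i. i < n \<Longrightarrow> (\<Sum>k<Suc n. M i k * x k) = 0" and j: "j < Suc n"
  shows "x j * ndet (Suc n) (bordered n M v) = (\<Sum>k<Suc n. v k * x k) * border_cofactor n M j"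
proof -
  let ?A = "Matrix.mat (Suc n) (Suc n) (\<lambda>(i, j). bordered n M v i j)"
  let ?x = "Matrix.vec (Suc n) x"
  let ?s = "\<Sum>k<Suc n. v k * x k"
  let ?N = "\<lambda>i k. if k = j then (if i = n then ?s else 0) else bordered n M v i k"
  have Ax: "Matrix.vec_index (?A *\<^sub>v ?x) i = (if i = n then ?s else 0)" if "i < Suc n" for i
    using that x[of i] by (auto simp: scalar_prod_def bordered_def atLeast0LessThan)
  have "x j * ndet (Suc n) (bordered n M v) = Determinant.det (replace_col ?A (?A *\<^sub>v ?x) j)"
    using cramer_lemma_mat[of ?A "Suc n" ?x j] j by (simp add: ndet_def)
  also have "replace_col ?A (?A *\<^sub>v ?x) j = Matrix.mat (Suc n) (Suc n) (\<lambda>(i, k). ?N i k)"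
    using Ax by (intro eq_matI) (auto simp: replace_col_def)
  also have "Determinant.det \<dots> = (\<Sum>i<Suc n. Matrix.mat (Suc n) (Suc n) (\<lambda>(i, k). ?N i k) $$ (i, j)
      * Determinant.cofactor (Matrix.mat (Suc n) (Suc n) (\<lambda>(i, k). ?N i k)) i j)"
    by (rule laplace_expansion_column) (use j in auto)
  also have "\<dots> = (\<Sum>i<Suc n. if i = n then ?s * border_cofactor n ?N j else 0)"
    unfolding border_cofactor_def using j by (intro sum.cong) auto
  also have "\<dots> = ?s * border_cofactor n ?N j" by simp
  also have "border_cofactor n ?N j = border_cofactor n M j"
  proof -
    have "mat_delete (Matrix.mat (Suc n) (Suc n) (\<lambda>(i, k). ?N i k)) n j
        = mat_delete (Matrix.mat (Suc n) (Suc n) (\<lambda>(i, k). M i k)) n j"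
      using j by (intro eq_matI) (auto simp: mat_delete_def bordered_def)
    then show ?thesis unfolding border_cofactor_def Determinant.cofactor_def by simp
  qed
  finally show ?thesis .
qed

lemma ndet_nonzeroI:
  assumes "\<And>x. (\<And>i. i < n \<Longrightarrow> (\<Sum>j<n. M i j * x j) = 0) \<Longrightarrow> \<forall>j<n. x j = 0"
  shows "ndet n M \<noteq> 0"
proof
  let ?A = "Matrix.mat n n (\<lambda>(i, j). M i j)"
  assume "ndet n M = 0"
  then obtain v where v: "v \<in> carrier_vec n" "v \<noteq> 0\<^sub>v n" "?A *\<^sub>v v = 0\<^sub>v n"
    unfolding ndet_def using det_0_iff_vec_prod_zero_field[of ?A n] by auto
  have "(\<Sum>j<n. M i j * Matrix.vec_index v j) = 0" if "i < n" for i
    using arg_cong[OF v(3), of "\<lambda>u. Matrix.vec_index u i"] that v(1)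
    by (simp add: scalar_prod_def atLeast0LessThan)
  then have "\<forall>j<n. Matrix.vec_index v j = 0" by (rule assms)
  then have "v = 0\<^sub>v n" using v(1) by (intro eq_vecI) auto
  with v(2) show False by simp
qed

lemma ndet_nonzeroD:
  assumes "ndet n M \<noteq> 0" "\<And>i. i < n \<Longrightarrow> (\<Sum>j<n. M i j * x j) = 0" "j < n"
  shows "x j = 0"
proof -
  let ?A = "Matrix.mat n n (\<lambda>(i, j). M i j)" and ?x = "Matrix.vec n x"
  have "?A *\<^sub>v ?x = 0\<^sub>v n"
    using assms(2) by (intro eq_vecI) (auto simp: scalar_prod_def atLeast0LessThan)
  moreover have "\<not> (\<exists>v. v \<in> carrier_vec n \<and> v \<noteq> 0\<^sub>v n \<and> ?A *\<^sub>v v = 0\<^sub>v n)"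
    using assms(1) det_0_iff_vec_prod_zero_field[of ?A n] unfolding ndet_def by auto
  ultimately have "?x = 0\<^sub>v n" by (metis vec_carrier)
  then have "Matrix.vec_index ?x j = Matrix.vec_index (0\<^sub>v n) j" by (rule arg_cong)
  then show ?thesis using assms(3) by simp
qed

lemma ndet_nonzero_rows_independent:
  assumes "ndet n M \<noteq> 0" "\<And>j. j < n \<Longrightarrow> (\<Sum>i<n. x i * M i j) = 0" "i < n"
  shows "x i = 0"
  using ndet_nonzeroD[of n "\<lambda>i j. M j i" x i] assms ndet_transpose[of n M]
  by (simp add: mult.commute)

lemma ndet_nonzero_rows_span:
  assumes "ndet n M \<noteq> 0"
  obtains x where "\<And>j. j < n \<Longrightarrow> (\<Sum>i<n. x i * M i j) = u j"
proof -
  let ?A = "Matrix.mat n n (\<lambda>(i, j). M i j)"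
  let ?B = "adj_mat ?A"
  have B: "?B \<in> carrier_mat n n" "?B * ?A = ndet n M \<cdot>\<^sub>m 1\<^sub>m n"
    using adj_mat[of ?A n] by (auto simp: ndet_def)
  define x where "x i = (\<Sum>k<n. u k * ?B $$ (k, i)) / ndet n M" for i
  have BA: "(\<Sum>i<n. ?B $$ (k, i) * M i j) = (if k = j then ndet n M else 0)" if "k < n" "j < n" for k j
    using arg_cong[OF B(2), of "\<lambda>A. A $$ (k, j)"] that B(1)
    by (simp add: scalar_prod_def atLeast0LessThan)
  have "(\<Sum>i<n. x i * M i j) = u j" if j: "j < n" for j
  proof -
    have "(\<Sum>i<n. x i * M i j) = (\<Sum>i<n. \<Sum>k<n. u k * ?B $$ (k, i) * M i j) / ndet n M"
      by (simp add: x_def sum_divide_distrib sum_distrib_right)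
    also have "(\<Sum>i<n. \<Sum>k<n. u k * ?B $$ (k, i) * M i j)
        = (\<Sum>k<n. u k * (\<Sum>i<n. ?B $$ (k, i) * M i j))"
      by (subst sum.swap) (simp add: sum_distrib_left mult.assoc)
    also have "\<dots> = (\<Sum>k<n. if k = j then u k * ndet n M else 0)"
      using j by (intro sum.cong) (auto simp: BA)
    also have "\<dots> = u j * ndet n M" using j by simp
    finally show ?thesis using assms by simp
  qed
  then show thesis by (rule that)
qed

lemma function_algebra_ndet:
  assumes S: "function_algebra S"
    and M: "\<And>i j. i < n \<Longrightarrow> j < n \<Longrightarrow> (\<lambda>x. M x i j) \<in> S"
  shows "(\<lambda>x. ndet n (M x)) \<in> S"
proof -
  have "(\<lambda>x. ndet n (M x)) = (\<lambda>x. \<Sum>p\<in>{p. p permutes {0..<n}}. signof p * (\<Prod>i\<in>{0..<n}. M x i (p i)))"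
    unfolding ndet_def by (subst Determinant.det_def'[of _ n]) (auto intro!: sum.cong prod.cong ext)
  also have "\<dots> \<in> S"
    by (intro function_algebra_sum[OF S] function_algebra_prod[OF S] function_algebraD[OF S] M)
      (auto simp: permutes_in_image[of _ "{0..<n}", simplified])
  finally show ?thesis .
qed

no_notation Matrix.vec_index (infixl \<open>$\<close> 100)
section \<open>Binary forms in coordinates\<close>

hide_const (open) Determinant.det Matrix.mat
no_notation fps_nth (infixl \<open>$\<close> 75)

type_synonym cfun = "complex^2 \<Rightarrow> complex"

definition mk2 :: "complex \<Rightarrow> complex \<Rightarrow> complex^2" where
  "mk2 a b = (\<chi> i. if i = 1 then a else b)"

lemma mk2_nth [simp]: "mk2 a b $ 1 = a" "mk2 a b $ 2 = b"
  by (simp_all add: mk2_def)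

lemma mk2_eta [simp]: "mk2 (z $ 1) (z $ 2) = z"
  by (simp add: Finite_Cartesian_Product.vec_eq_iff forall_2)

lemma mk2_0: "mk2 0 0 = 0"
  by (simp add: Finite_Cartesian_Product.vec_eq_iff forall_2)

text \<open>The monomials of degree \<open>d\<close> are indexed by the exponent of the first coordinate.\<close>

definition bmono :: "nat \<Rightarrow> nat \<Rightarrow> cfun" where
  "bmono d k z = (z $ 1) ^ k * (z $ 2) ^ (d - k)"

lemma bmono_mult:
  assumes "i \<le> d" "j \<le> e"
  shows "bmono d i z * bmono e j z = bmono (d + e) (i + j) z"
proof -
  have "d + e - (i + j) = (d - i) + (e - j)" using assms by simp
  then show ?thesis by (simp add: bmono_def power_add)
qed

lemma forms_iff: "(Q :: cfun) \<in> forms d \<longleftrightarrow> (\<exists>c. \<forall>z. Q z = (\<Sum>k\<le>d. c k * bmono d k z))"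
proof -
  define h :: "nat \<Rightarrow> 2 \<Rightarrow> nat" where "h k i = (if i = 1 then k else d - k)" for k i
  \<comment> \<open>A multi-index of total degree \<open>d\<close> in two variables is determined by its first entry.\<close>
  have bij: "bij_betw h {..d} {\<alpha>. sum \<alpha> UNIV = d}"
  proof (rule bij_betwI[where g = "\<lambda>\<alpha>. \<alpha> 1"])
    show "h \<in> {..d} \<rightarrow> {\<alpha>. sum \<alpha> UNIV = d}" by (auto simp: h_def sum_2)
    show "h (\<alpha> 1) = \<alpha>" if "\<alpha> \<in> {\<alpha>. sum \<alpha> UNIV = d}" for \<alpha>
      using that by (auto simp: h_def sum_2 fun_eq_iff forall_2)
  qed (auto simp: h_def sum_2)
  have key: "(\<Sum>\<alpha> | sum \<alpha> UNIV = d. c \<alpha> * (\<Prod>i\<in>UNIV. (z $ i) ^ \<alpha> i)) = (\<Sum>k\<le>d. c (h k) * bmono d k z)"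
    for c and z :: "complex^2"
    by (subst sum.reindex_bij_betw[OF bij, symmetric])
      (auto simp: bmono_def h_def UNIV_2 intro!: sum.cong)
  show ?thesis
  proof
    assume "Q \<in> forms d"
    then obtain c where "\<forall>z. Q z = (\<Sum>\<alpha> | sum \<alpha> UNIV = d. c \<alpha> * (\<Prod>i\<in>UNIV. (z $ i) ^ \<alpha> i))"
      unfolding forms_def by blast
    then show "\<exists>c. \<forall>z. Q z = (\<Sum>k\<le>d. c k * bmono d k z)" unfolding key by metis
  next
    assume "\<exists>c. \<forall>z. Q z = (\<Sum>k\<le>d. c k * bmono d k z)"
    then obtain c where c: "\<And>z. Q z = (\<Sum>k\<le>d. c k * bmono d k z)" by blast
    have h1: "h k 1 = k" for k by (simp add: h_def)
    show "Q \<in> forms d" unfolding forms_def mem_Collect_eq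
      by (rule exI[of _ "\<lambda>\<alpha>. c (\<alpha> 1)"], unfold key) (simp add: c h1)
  qed
qed

subsection \<open>Coefficients by discrete Fourier inversion\<close>

text \<open>The coefficient of \<open>bmono d k\<close>, obtained from the values at the points \<open>(\<zeta>, 1)\<close> for the roots of unity \<open>\<zeta>\<close>
  of order \<open>d + 1\<close>. Being a finite combination of values, it is linear on all functions and inherits
  polynomial dependence on parameters from the values.\<close>

definition cf :: "nat \<Rightarrow> cfun \<Rightarrow> nat \<Rightarrow> complex" where
  "cf d Q k = (\<Sum>j\<le>d. cis (- (2 * pi * real j * real k / real (Suc d)))
      * Q (mk2 (cis (2 * pi * real j / real (Suc d))) 1)) / of_nat (Suc d)"

lemma cf_add: "cf d (\<lambda>z. f z + g z) k = cf d f k + cf d g k"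
  by (simp add: cf_def sum.distrib distrib_left add_divide_distrib)

lemma cf_scale: "cf d (\<lambda>z. c * f z) k = c * cf d f k"
  by (simp add: cf_def sum_distrib_left mult.left_commute)

lemma cf_zero [simp]: "cf d (\<lambda>z. 0) k = 0"
  by (simp add: cf_def)

lemma cf_sum: "cf d (\<lambda>z. \<Sum>i\<in>A. f i z) k = (\<Sum>i\<in>A. cf d (f i) k)"
  by (induction A rule: infinite_finite_induct) (simp_all add: cf_add)

text \<open>Orthogonality of the characters of the cyclic group of order \<open>d + 1\<close>.\<close>

lemma cf_mono:
  assumes "l \<le> d" "k \<le> d"
  shows "cf d (bmono d l) k = (if l = k then 1 else 0)"
proof -
  define w where "w = cis (2 * pi * (real l - real k) / real (Suc d))"
  have "cis (- (2 * pi * real j * real k / real (Suc d))) * cis (2 * pi * real j / real (Suc d)) ^ l = w ^ j"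
    for j
  proof -
    have "- (2 * pi * real j * real k / real (Suc d)) + real l * (2 * pi * real j / real (Suc d))
      = real j * (2 * pi * (real l - real k) / real (Suc d))"
      by (simp add: diff_divide_distrib right_diff_distrib mult_ac)
    then show ?thesis unfolding w_def Complex.DeMoivre cis_mult by simp
  qed
  then have eq: "cf d (bmono d l) k = (\<Sum>j\<le>d. w ^ j) / of_nat (Suc d)"
    by (simp add: cf_def bmono_def)
  show ?thesis
  proof (cases "l = k")
    case True
    then have "w = 1" by (simp add: w_def)
    then show ?thesis unfolding eq using True by (simp del: of_nat_Suc)
  next
    case False
    have "w ^ Suc d = cis (2 * pi * (real l - real k))"
      unfolding w_def Complex.DeMoivre by (simp del: of_nat_Suc)
    also have "\<dots> = 1"
    proof -
      have "cis (2 * pi * (real l - real k)) = cis (2 * pi * of_int (int l - int k))" by simp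
      also have "\<dots> = 1" by (rule cis_multiple_2pi) simp
      finally show ?thesis .
    qed
    finally have w1: "w ^ Suc d = 1" .
    have "w \<noteq> 1"
    proof
      assume "w = 1"
      then have "cos (2 * pi * (real l - real k) / real (Suc d)) = 1"
        unfolding w_def by (simp add: complex_eq_iff)
      then obtain n :: int where "2 * pi * (real l - real k) / real (Suc d) = of_int n * 2 * pi"
        using cos_one_2pi_int by metis
      then have "2 * pi * (real l - real k) = 2 * pi * (of_int n * real (Suc d))"
        by (simp add: divide_eq_eq mult_ac del: of_nat_Suc)
      then have "real l - real k = of_int n * real (Suc d)" by simp
      then have "real_of_int (int l - int k) = real_of_int (n * int (Suc d))" by simp
      then have n: "int l - int k = n * int (Suc d)" by (simp only: of_int_eq_iff)
      have "n \<noteq> 0" using n False by auto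
      then have "int (Suc d) \<le> \<bar>n\<bar> * int (Suc d)" by (simp add: mult_le_cancel_right1 del: of_nat_Suc)
      then have "int (Suc d) \<le> \<bar>int l - int k\<bar>" unfolding n abs_mult by simp
      then show False using assms by linarith
    qed
    moreover have "(w - 1) * (\<Sum>j\<le>d. w ^ j) = w ^ Suc d - 1"
      by (simp add: lessThan_Suc_atMost[symmetric] power_diff_1_eq del: power_Suc)
    ultimately have "(\<Sum>j\<le>d. w ^ j) = 0" using w1 by simp
    then show ?thesis using False by (simp add: eq)
  qed
qed

lemma cf_mono_sum:
  assumes "k \<le> d"
  shows "cf d (\<lambda>z. \<Sum>l\<le>d. c l * bmono d l z) k = c k"
proof -
  have "cf d (\<lambda>z. \<Sum>l\<le>d. c l * bmono d l z) k = (\<Sum>l\<le>d. c l * cf d (bmono d l) k)"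
    by (simp add: cf_sum cf_scale)
  also have "\<dots> = (\<Sum>l\<le>d. if l = k then c k else 0)"
    using assms by (intro sum.cong) (auto simp: cf_mono)
  finally show ?thesis using assms by simp
qed

lemma form_expand:
  assumes "Q \<in> forms d"
  shows "Q z = (\<Sum>k\<le>d. cf d Q k * bmono d k z)"
proof -
  obtain c where c: "\<And>z. Q z = (\<Sum>k\<le>d. c k * bmono d k z)" using assms forms_iff by blast
  then have "Q = (\<lambda>z. \<Sum>k\<le>d. c k * bmono d k z)" by auto
  then have "cf d Q k = c k" if "k \<le> d" for k using cf_mono_sum[OF that, of c] by simp
  then show ?thesis using c by simp
qed

lemma form_eqI:
  assumes "Q \<in> forms d" "R \<in> forms d" "\<And>k. k \<le> d \<Longrightarrow> cf d Q k = cf d R k"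
  shows "Q = R"
  using form_expand[OF assms(1)] form_expand[OF assms(2)] assms(3) by (auto simp: fun_eq_iff)

lemma forms_sum_mono [intro]: "(\<lambda>z. \<Sum>k\<le>d. c k * bmono d k z) \<in> forms d"
  using forms_iff by blast

lemma forms_add [intro]:
  assumes "f \<in> forms d" "g \<in> forms d" shows "(\<lambda>z::complex^2. f z + g z) \<in> forms d"
  unfolding forms_iff
  by (rule exI[of _ "\<lambda>k. cf d f k + cf d g k"])
    (simp add: distrib_right sum.distrib form_expand[OF assms(1), symmetric] form_expand[OF assms(2), symmetric])

lemma forms_scale [intro]:
  assumes "f \<in> forms d" shows "(\<lambda>z::complex^2. c * f z) \<in> forms d"
  unfolding forms_iff
  by (rule exI[of _ "\<lambda>k. c * cf d f k"])
    (simp add: mult.assoc sum_distrib_left[symmetric] form_expand[OF assms(1), symmetric])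

lemma forms_diff [intro]:
  assumes "f \<in> forms d" "g \<in> forms d" shows "(\<lambda>z::complex^2. f z - g z) \<in> forms d"
  using forms_add[OF assms(1) forms_scale[OF assms(2), of "-1"]] by simp

lemma forms_zero [intro, simp]: "(\<lambda>z::complex^2. 0) \<in> forms d"
  unfolding forms_iff by (rule exI[of _ "\<lambda>k. 0"]) simp

lemma forms_sum [intro]:
  assumes "\<And>i. i \<in> A \<Longrightarrow> f i \<in> forms d" shows "(\<lambda>z::complex^2. \<Sum>i\<in>A. f i z) \<in> forms d"
  using assms by (induction A rule: infinite_finite_induct) auto

lemma forms_mono [intro, simp]:
  assumes "k \<le> d" shows "bmono d k \<in> forms d"
  unfolding forms_iff
proof (rule exI[of _ "\<lambda>i. if i = k then 1 else 0"], rule allI)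
  fix z
  have "(\<Sum>i\<le>d. (if i = k then 1 else 0) * bmono d i z) = (\<Sum>i\<le>d. if i = k then bmono d i z else 0)"
    by (rule sum.cong) auto
  then show "bmono d k z = (\<Sum>i\<le>d. (if i = k then 1 else 0) * bmono d i z)" using assms by simp
qed

lemma forms_mult:
  assumes "f \<in> forms d" "g \<in> forms e" shows "(\<lambda>z::complex^2. f z * g z) \<in> forms (d + e)"
proof -
  have "(\<lambda>z. f z * g z) = (\<lambda>z. \<Sum>i\<le>d. \<Sum>j\<le>e. (cf d f i * cf e g j) * bmono (d + e) (i + j) z)"
    by (rule ext, subst form_expand[OF assms(1)], subst form_expand[OF assms(2)])
      (simp add: sum_product bmono_mult[symmetric] algebra_simps)
  also have "\<dots> \<in> forms (d + e)" by (intro forms_sum forms_scale forms_mono) auto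
  finally show ?thesis .
qed

lemma forms_multI [intro]:
  assumes "f \<in> forms d" "g \<in> forms e" "n = d + e" shows "(\<lambda>z::complex^2. f z * g z) \<in> forms n"
  using forms_mult assms by blast

lemma forms_const [intro, simp]: "(\<lambda>z::complex^2. c) \<in> forms 0"
  unfolding forms_iff by (rule exI[of _ "\<lambda>_. c"]) (simp add: bmono_def)

lemma forms_linear [intro]: "(\<lambda>z::complex^2. a * z $ 1 + b * z $ 2) \<in> forms 1"
  unfolding forms_iff by (rule exI[of _ "\<lambda>k. if k = 0 then b else a"]) (simp add: bmono_def)

lemma forms_coord [intro, simp]: "(\<lambda>z::complex^2. z $ i) \<in> forms 1"
  using forms_linear[of 1 0] forms_linear[of 0 1] exhaust_2[of i] by auto

lemma forms_power:
  assumes "f \<in> forms d" shows "(\<lambda>z::complex^2. f z ^ n) \<in> forms (n * d)"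
proof (induction n)
  case 0
  then show ?case using forms_const[of 1] by simp
next
  case (Suc n)
  then show ?case using forms_mult[OF assms Suc] by simp
qed

lemma matrix_vector_2: "(A *v z) $ i = A $ i $ 1 * z $ 1 + A $ i $ (2::2) * (z::complex^2) $ 2"
  by (simp add: matrix_vector_mult_def sum_2)

lemma forms_comp [intro]:
  assumes "f \<in> forms d" shows "(\<lambda>z. f ((A::complex^2^2) *v z)) \<in> forms d"
proof -
  have "(\<lambda>z. f (A *v z)) = (\<lambda>z. \<Sum>k\<le>d. cf d f k * (((A *v z) $ 1) ^ k * ((A *v z) $ 2) ^ (d - k)))"
    by (rule ext, subst form_expand[OF assms]) (simp add: bmono_def)
  also have "\<dots> \<in> forms d"
  proof (intro forms_sum forms_scale)
    fix k assume "k \<in> {..d}"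
    then have k: "d = k * 1 + (d - k) * 1" by simp
    show "(\<lambda>z. ((A *v z) $ 1) ^ k * ((A *v z) $ 2) ^ (d - k)) \<in> forms d"
      by (rule forms_multI[OF _ _ k]; rule forms_power) (simp_all add: matrix_vector_2 forms_linear[simplified])
  qed
  finally show ?thesis .
qed

lemma form_scale_arg:
  assumes "f \<in> forms d" shows "f (c *s (z::complex^2)) = c ^ d * f z"
proof -
  have "bmono d k (c *s z) = c ^ d * bmono d k z" if "k \<le> d" for k
  proof -
    have "c ^ d = c ^ k * c ^ (d - k)" using that by (simp flip: power_add)
    then show ?thesis by (simp add: bmono_def power_mult_distrib)
  qed
  then show ?thesis
    by (subst (1 2) form_expand[OF assms]) (auto simp: sum_distrib_left mult.left_commute intro!: sum.cong)
qed

lemma linear_on_forms: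
  assumes L: "\<And>f g a b. f \<in> forms d \<Longrightarrow> g \<in> forms d \<Longrightarrow> L (\<lambda>z::complex^2. a * f z + b * g z) = a * L f + b * L g"
    and Q: "Q \<in> forms d"
  shows "(L Q :: complex) = (\<Sum>k\<le>d. cf d Q k * L (bmono d k))"
proof -
  have L0: "L (\<lambda>z. 0) = 0" using L[of "\<lambda>_. 0" "\<lambda>_. 0" 0 0] by simp
  have "L (\<lambda>z. \<Sum>k\<in>A. c k * bmono d k z) = (\<Sum>k\<in>A. c k * L (bmono d k))"
    if "finite A" "A \<subseteq> {..d}" for A c
    using that
  proof (induction A)
    case (insert k A)
    have "L (\<lambda>z. c k * bmono d k z + 1 * (\<Sum>k\<in>A. c k * bmono d k z))
        = c k * L (bmono d k) + 1 * L (\<lambda>z. \<Sum>k\<in>A. c k * bmono d k z)"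
      by (rule L) (use insert in \<open>auto intro!: forms_sum forms_scale\<close>)
    then show ?case using insert by simp
  qed (simp add: L0)
  from this[OF finite_atMost subset_refl]
  have "L (\<lambda>z. \<Sum>k\<le>d. cf d Q k * bmono d k z) = (\<Sum>k\<le>d. cf d Q k * L (bmono d k))" .
  moreover have "Q = (\<lambda>z. \<Sum>k\<le>d. cf d Q k * bmono d k z)"
    using form_expand[OF Q] by (rule ext)
  ultimately show ?thesis by (rule ssubst[of Q _ "\<lambda>u. L u = _", rotated])
qed

subsection \<open>Polynomials on spaces of forms\<close>

lemma function_algebra_polynomials_on: "function_algebra (polynomials_on V)"
  unfolding function_algebra_def by (auto intro: polynomials_on.intros)

lemma polynomials_on_eval: "(\<lambda>Q. Q z) \<in> polynomials_on V"
  by (rule polynomials_on.linear) simp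

text \<open>A linear functional on forms is a combination of coefficients, hence of values, so it is enough
  that the values of \<open>F x\<close> depend polynomially on \<open>x\<close>.\<close>

lemma polynomial_comp:
  assumes p: "p \<in> polynomials_on (forms d)" and S: "function_algebra S"
    and F: "\<And>x. F x \<in> forms d" and FS: "\<And>z :: complex^2. (\<lambda>x. F x z) \<in> S"
  shows "(\<lambda>x. p (F x)) \<in> S"
  using p
proof induction
  case (linear L)
  have cfS: "(\<lambda>x. cf d (F x) k) \<in> S" for k
  proof -
    have "(\<lambda>x. \<Sum>j\<le>d. (cis (- (2 * pi * real j * real k / real (Suc d))) / of_nat (Suc d))
        * F x (mk2 (cis (2 * pi * real j / real (Suc d))) 1)) \<in> S"
      by (intro function_algebra_sum[OF S] function_algebraD[OF S] FS)
    then show ?thesis by (simp add: cf_def sum_divide_distrib)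
  qed
  have "(\<lambda>x. L (F x)) = (\<lambda>x. \<Sum>k\<le>d. cf d (F x) k * L (bmono d k))"
    by (rule ext, rule linear_on_forms[OF _ F], rule linear)
  also have "\<dots> \<in> S" by (intro function_algebra_sum[OF S] function_algebraD[OF S] cfS)
  finally show ?case .
qed (auto intro: function_algebraD[OF S])

lemma sum_powers_eq_0_imp:
  assumes "\<And>t::complex. (\<Sum>k\<le>n. c k * t ^ k) = 0" "k \<le> n"
  shows "c k = 0"
  using polyfun_eq_0[of c n] assms by auto

section \<open>Zariski density of the square-free forms\<close>

definition polyfuns :: "(complex \<Rightarrow> complex) set" where
  "polyfuns = {f. \<exists>p. \<forall>t. f t = poly p t}"

lemma function_algebra_polyfuns: "function_algebra polyfuns"
  unfolding function_algebra_def polyfuns_def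
proof (intro conjI allI ballI)
  show "(\<lambda>_. c) \<in> {f. \<exists>p. \<forall>t. f t = poly p t}" for c :: complex
    by (auto intro!: exI[of _ "[:c:]"])
qed (auto simp flip: poly_add poly_mult)

lemma polyfuns_id: "(\<lambda>t. t) \<in> polyfuns"
  unfolding polyfuns_def by (auto intro!: exI[of _ "[:0, 1:]"])

lemma polyfuns_common_nonzero:
  assumes "f \<in> polyfuns" "g \<in> polyfuns" "f s \<noteq> 0" "g t \<noteq> 0"
  shows "\<exists>u. f u \<noteq> 0 \<and> g u \<noteq> 0"
proof -
  obtain p q where pq: "\<And>t. f t = poly p t" "\<And>t. g t = poly q t"
    using assms(1,2) unfolding polyfuns_def by blast
  then have "p * q \<noteq> 0" using assms(3,4) by auto
  then have "\<exists>u. poly (p * q) u \<noteq> 0" using poly_all_0_iff_0 by blast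
  then show ?thesis by (auto simp: pq)
qed

definition prodform :: "nat \<Rightarrow> (nat \<Rightarrow> complex^2) \<Rightarrow> cfun" where
  "prodform n L z = (\<Prod>i<n. L i $ 1 * z $ 1 + L i $ 2 * z $ 2)"

lemma prodform_in_forms: "prodform n L \<in> forms n"
proof (induction n)
  case 0
  then show ?case using forms_const[of 1] by (simp add: prodform_def fun_eq_iff[symmetric])
next
  case (Suc n)
  then show ?case
    using forms_mult[OF Suc forms_linear] by (simp add: prodform_def[abs_def])
qed

text \<open>The fundamental theorem of algebra gives a linear factor of the dehomogenised form; if the top
  coefficient vanishes, the second coordinate is a factor instead.\<close>

lemma form_has_zero:
  assumes Q: "(Q :: cfun) \<in> forms (Suc n)"
  shows "\<exists>a b R. (a, b) \<noteq> (0, 0) \<and> R \<in> forms n \<and> Q = (\<lambda>z. (a * z $ 1 + b * z $ 2) * R z)"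
proof (cases "cf (Suc n) Q (Suc n) = 0")
  case True
  have "Q z = (0 * z $ 1 + 1 * z $ 2) * (\<Sum>k\<le>n. cf (Suc n) Q k * bmono n k z)" for z
    using True by (subst form_expand[OF Q])
      (auto simp: bmono_def sum_distrib_left Suc_diff_le intro!: sum.cong)
  then show ?thesis
    by (intro exI[of _ 0] exI[of _ 1] exI[of _ "\<lambda>z. \<Sum>k\<le>n. cf (Suc n) Q k * bmono n k z"]) auto
next
  case False
  let ?c = "cf (Suc n) Q"
  define p where "p = (\<Sum>k\<le>Suc n. Polynomial.monom (?c k) k)"
  have "coeff p (Suc n) = (\<Sum>k\<le>Suc n. if k = Suc n then ?c k else 0)"
    unfolding p_def coeff_sum coeff_monom by (rule sum.cong) auto
  then have "coeff p (Suc n) \<noteq> 0" using False by simp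
  then have "\<not> (\<exists>a l. a \<noteq> 0 \<and> l = 0 \<and> p = pCons a l)" by auto
  then obtain r where "poly p r = 0" using fundamental_theorem_of_algebra_alt by blast
  then have r: "(\<Sum>k\<le>Suc n. ?c k * r ^ k) = 0"
    unfolding p_def poly_sum poly_monom .
  \<comment> \<open>The quotient by the linear factor, from the factorisations of \<open>x^k - r^k\<close>.\<close>
  define R where "R z = (\<Sum>k\<le>Suc n. ?c k * (\<Sum>i<k. r ^ (k - Suc i) * bmono n i z))" for z
  have RF: "R \<in> forms n" unfolding R_def[abs_def]
    by (intro forms_sum forms_scale forms_mono) auto
  have "Q z = (1 * z $ 1 + (- r) * z $ 2) * R z" for z
  proof -
    have t: "bmono (Suc n) k z - r ^ k * (z $ 2) ^ Suc n
        = (z $ 1 - r * z $ 2) * (\<Sum>i<k. r ^ (k - Suc i) * bmono n i z)" if k: "k \<le> Suc n" for k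
    proof -
      have "bmono (Suc n) k z - r ^ k * (z $ 2) ^ Suc n
        = (z $ 2) ^ (Suc n - k) * ((z $ 1) ^ k - (r * z $ 2) ^ k)"
      proof -
        have "(z $ 2) ^ Suc n = (z $ 2) ^ k * (z $ 2) ^ (Suc n - k)" using k by (simp flip: power_add)
        then show ?thesis by (simp add: bmono_def power_mult_distrib algebra_simps)
      qed
      also have "(z $ 1) ^ k - (r * z $ 2) ^ k
         = (z $ 1 - r * z $ 2) * (\<Sum>i<k. (r * z $ 2) ^ (k - Suc i) * (z $ 1) ^ i)"
        by (rule power_diff_sumr2)
      also have "(z $ 2) ^ (Suc n - k) * \<dots>
         = (z $ 1 - r * z $ 2) * (\<Sum>i<k. (z $ 2) ^ (Suc n - k) * ((r * z $ 2) ^ (k - Suc i) * (z $ 1) ^ i))"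
        by (simp add: sum_distrib_left mult.left_commute)
      also have "(\<Sum>i<k. (z $ 2) ^ (Suc n - k) * ((r * z $ 2) ^ (k - Suc i) * (z $ 1) ^ i))
          = (\<Sum>i<k. r ^ (k - Suc i) * bmono n i z)"
      proof (rule sum.cong[OF refl])
        fix i assume "i \<in> {..<k}"
        then have "n - i = (Suc n - k) + (k - Suc i)" using k by simp
        then show "(z $ 2) ^ (Suc n - k) * ((r * z $ 2) ^ (k - Suc i) * (z $ 1) ^ i) = r ^ (k - Suc i) * bmono n i z"
          by (simp add: bmono_def power_mult_distrib power_add)
      qed
      finally show ?thesis .
    qed
    have "Q z = (\<Sum>k\<le>Suc n. ?c k * bmono (Suc n) k z) - (\<Sum>k\<le>Suc n. ?c k * r ^ k) * (z $ 2) ^ Suc n"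
      using form_expand[OF Q, of z] r by simp
    also have "\<dots> = (\<Sum>k\<le>Suc n. ?c k * (bmono (Suc n) k z - r ^ k * (z $ 2) ^ Suc n))"
      by (simp add: right_diff_distrib sum_subtractf sum_distrib_right mult.assoc distrib_right del: power_Suc)
    also have "\<dots> = (\<Sum>k\<le>Suc n. ?c k * ((z $ 1 - r * z $ 2) * (\<Sum>i<k. r ^ (k - Suc i) * bmono n i z)))"
      by (intro sum.cong refl) (simp only: t atMost_iff)
    also have "\<dots> = (z $ 1 - r * z $ 2) * R z"
      unfolding R_def by (simp add: sum_distrib_left mult.left_commute distrib_left del: power_Suc)
    finally show ?thesis by simp
  qed
  then show ?thesis using RF
    by (intro exI[of _ 1] exI[of _ "-r"] exI[of _ R]) auto
qed

lemma form_factorization: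
  assumes "(Q :: cfun) \<in> forms (Suc n)"
  obtains L where "Q = prodform (Suc n) L"
proof -
  have "\<exists>L. Q = prodform (Suc n) L"
    using assms
  proof (induction n arbitrary: Q)
    case 0
    obtain a b R where *: "R \<in> forms 0" "Q = (\<lambda>z. (a * z $ 1 + b * z $ 2) * R z)"
      using form_has_zero[OF 0] by (elim exE conjE)
    have "R z = cf 0 R 0" for z using form_expand[OF *(1), of z] by (simp add: bmono_def)
    then show ?case using *(2)
      by (intro exI[of _ "\<lambda>_. mk2 (a * cf 0 R 0) (b * cf 0 R 0)"])
        (auto simp: prodform_def fun_eq_iff algebra_simps)
  next
    case (Suc n)
    obtain a b R where *: "R \<in> forms (Suc n)" "Q = (\<lambda>z. (a * z $ 1 + b * z $ 2) * R z)"
      using form_has_zero[OF Suc.prems] by (elim exE conjE)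
    obtain L where L: "R = prodform (Suc n) L" using Suc.IH[OF *(1)] by (elim exE)
    have "Q = prodform (Suc (Suc n)) (\<lambda>i. if i = Suc n then mk2 a b else L i)"
    proof
      fix z
      have "prodform (Suc n) (\<lambda>i. if i = Suc n then mk2 a b else L i) z = prodform (Suc n) L z"
        unfolding prodform_def by (rule prod.cong) auto
      then show "Q z = prodform (Suc (Suc n)) (\<lambda>i. if i = Suc n then mk2 a b else L i) z"
        unfolding *(2) L prodform_def[of "Suc (Suc n)"] prod.lessThan_Suc[of _ "Suc n"]
          prodform_def[of "Suc n", symmetric]
        by simp
    qed
    then show ?case by blast
  qed
  then show thesis using that by blast
qed

text \<open>Functions of tuples of vectors that are polynomial on every line. If neither of two such functions
  vanishes identically, there is a common point where neither vanishes: it lies on the line through a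
  nonzero of the one and a nonzero of the other.\<close>

definition line_algebra :: "((nat \<Rightarrow> complex^2) \<Rightarrow> complex) set" where
  "line_algebra = {f. \<forall>(L :: nat \<Rightarrow> complex^2) (M :: nat \<Rightarrow> complex^2).
    (\<lambda>t. f (\<lambda>i. mk2 (L i $ 1 + t * (M i $ 1 - L i $ 1)) (L i $ 2 + t * (M i $ 2 - L i $ 2)))) \<in> polyfuns}"

lemma function_algebra_line_algebra: "function_algebra line_algebra"
  using function_algebra_polyfuns unfolding function_algebra_def line_algebra_def by auto

lemma line_algebra_coord: "(\<lambda>L. L i $ j) \<in> line_algebra"
proof -
  note P = function_algebraD[OF function_algebra_polyfuns]
  have "(\<lambda>t. a + t * c) \<in> polyfuns" for a c by (intro P polyfuns_id)
  then show ?thesis using exhaust_2[of j] unfolding line_algebra_def by auto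
qed

lemma line_algebra_common_nonzero:
  assumes "f \<in> line_algebra" "g \<in> line_algebra" "f L \<noteq> 0" "g M \<noteq> 0"
  shows "\<exists>N. f N \<noteq> 0 \<and> g N \<noteq> 0"
proof -
  let ?N = "\<lambda>t i. mk2 (L i $ 1 + t * (M i $ 1 - L i $ 1)) (L i $ 2 + t * (M i $ 2 - L i $ 2))"
  have "(\<lambda>t. f (?N t)) \<in> polyfuns" "(\<lambda>t. g (?N t)) \<in> polyfuns"
    using assms(1,2) unfolding line_algebra_def by auto
  moreover have "?N 0 = L" "?N 1 = M" by auto
  ultimately show ?thesis
    using polyfuns_common_nonzero[of "\<lambda>t. f (?N t)" "\<lambda>t. g (?N t)" 0 1] assms(3,4) by auto
qed

text \<open>Nonzero exactly when the linear forms with these coefficient vectors are pairwise non-proportional.\<close>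

definition pairwise_minors :: "nat \<Rightarrow> (nat \<Rightarrow> complex^2) \<Rightarrow> complex" where
  "pairwise_minors n L = (\<Prod>i<n. \<Prod>j<i. L i $ 1 * L j $ 2 - L i $ 2 * L j $ 1)"

lemma squarefree_formI:
  assumes n: "n \<ge> 2" and L: "pairwise_minors n L \<noteq> 0"
  shows "prodform n L \<in> squarefree_forms n"
proof -
  have lt: "L i $ 1 * L j $ 2 - L i $ 2 * L j $ 1 \<noteq> 0" if "i < n" "j < i" for i j
    using L that unfolding pairwise_minors_def by (auto simp: prod_zero_iff)
  have ne: "L i $ 1 * L j $ 2 \<noteq> L i $ 2 * L j $ 1" if "i < n" "j < n" "i \<noteq> j" for i j
    using lt[of i j] lt[of j i] that by (cases "i < j") (auto simp: algebra_simps)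
  let ?l = "\<lambda>i z. L i $ 1 * z $ 1 + L i $ 2 * z $ (2::2)"
  show ?thesis unfolding squarefree_forms_def mem_Collect_eq
  proof (intro exI[of _ ?l] conjI allI impI notI)
    fix i assume i: "i < n"
    show "?l i \<in> forms 1" by (rule forms_linear)
    assume "?l i = (\<lambda>_. 0)"
    then have "?l i (mk2 1 0) = 0" "?l i (mk2 0 1) = 0" by metis+
    then have "L i $ 1 = 0" "L i $ 2 = 0" by simp_all
    moreover have "(if i = 0 then 1 else 0) < n" "(if i = 0 then 1 else 0) \<noteq> i" using n by auto
    ultimately show False using ne[of i "if i = 0 then 1 else 0"] i by simp
  next
    fix i j assume ij: "i < n" "j < n" "i \<noteq> j" and "\<exists>c. ?l i = (\<lambda>z. c * ?l j z)"
    then obtain c where c: "?l i = (\<lambda>z. c * ?l j z)" by blast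
    have "?l i (mk2 1 0) = c * ?l j (mk2 1 0)" "?l i (mk2 0 1) = c * ?l j (mk2 0 1)"
      using fun_cong[OF c] by blast+
    then show False using ne[OF ij] by simp
  qed (auto simp: prodform_def)
qed

lemma squarefree_forms_subset: "squarefree_forms n \<subseteq> forms n"
proof
  fix Q assume "Q \<in> squarefree_forms n"
  then obtain l where l: "\<And>i. i < n \<Longrightarrow> l i \<in> forms 1" "Q = (\<lambda>z. \<Prod>i<n. l i z)"
    unfolding squarefree_forms_def by blast
  have "(\<lambda>z. \<Prod>i<k. l i z) \<in> forms k" if "k \<le> n" for k
    using that
  proof (induction k)
    case 0
    then show ?case using forms_const[of 1] by simp
  next
    case (Suc k)
    then show ?case using forms_mult[of "\<lambda>z. \<Prod>i<k. l i z" k "l k" 1] l(1) by simp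
  qed
  then show "Q \<in> forms n" using l(2) by blast
qed

text \<open>Every form is a product of linear forms. In terms of the factors, both \<open>h\<close> and the condition that the
  factors are pairwise non-proportional are given by polynomials, and neither vanishes identically.\<close>

lemma squarefree_forms_dense:
  assumes h: "h \<in> polynomials_on (forms n)" and n: "n \<ge> 2" and Q: "Q \<in> forms n" "h Q \<noteq> 0"
  shows "\<exists>R\<in>squarefree_forms n. h R \<noteq> 0"
proof -
  note A = function_algebra_line_algebra
  obtain m where m: "n = Suc m" using n by (cases n) auto
  obtain L where L: "Q = prodform n L" using form_factorization Q m by blast
  have "(\<lambda>L. prodform n L z) \<in> line_algebra" for z
    unfolding prodform_def
    by (intro function_algebra_prod[OF A] function_algebraD[OF A] line_algebra_coord)
  then have 1: "(\<lambda>L. h (prodform n L)) \<in> line_algebra"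
    using polynomial_comp[OF h A, of "prodform n"] prodform_in_forms by blast
  have 2: "pairwise_minors n \<in> line_algebra"
    unfolding pairwise_minors_def[abs_def]
    by (intro function_algebra_prod[OF A] function_algebra_diff[OF A] function_algebraD[OF A] line_algebra_coord)
  have 3: "pairwise_minors n (\<lambda>i. mk2 1 (of_nat i)) \<noteq> 0"
    by (auto simp: pairwise_minors_def prod_zero_iff)
  obtain N where "h (prodform n N) \<noteq> 0" "pairwise_minors n N \<noteq> 0"
    using line_algebra_common_nonzero[OF 1 2, of L "\<lambda>i. mk2 1 (of_nat i)"] 3 Q(2) L by auto
  then show ?thesis using squarefree_formI[OF n] by blast
qed

lemma forms_common_nonzero:
  assumes g: "g \<in> polynomials_on (forms n)" and h: "h \<in> polynomials_on (forms n)"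
    and QR: "Q \<in> forms n" "R \<in> forms n" "g Q \<noteq> 0" "h R \<noteq> 0"
  shows "\<exists>S::cfun \<in> forms n. g S \<noteq> 0 \<and> h S \<noteq> 0"
proof -
  note A = function_algebra_polyfuns
  let ?F = "\<lambda>t z. Q z + t * (R z - Q z)"
  have F: "?F t \<in> forms n" for t
    by (rule forms_add[OF QR(1) forms_scale[OF forms_diff[OF QR(2,1)]]])
  have Fz: "(\<lambda>t. ?F t z) \<in> polyfuns" for z
    by (intro function_algebraD[OF A] polyfuns_id)
  have "?F 0 = Q" "?F 1 = R" by auto
  then obtain u where "g (?F u) \<noteq> 0" "h (?F u) \<noteq> 0"
    using polyfuns_common_nonzero[OF polynomial_comp[OF g A F Fz] polynomial_comp[OF h A F Fz], of 0 1] QR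
    by auto
  then show ?thesis using F by blast
qed

lemma squarefree_forms_common_nonzero:
  assumes g: "g \<in> polynomials_on (forms n)" and h: "h \<in> polynomials_on (forms n)"
    and n: "n \<ge> 2" and QR: "Q \<in> forms n" "R \<in> forms n" "g Q \<noteq> 0" "h R \<noteq> 0"
  shows "\<exists>S\<in>squarefree_forms n. g S \<noteq> 0 \<and> h S \<noteq> 0"
proof -
  obtain S where S: "S \<in> forms n" "g S * h S \<noteq> 0"
    using forms_common_nonzero[OF g h QR] by auto
  show ?thesis
    using squarefree_forms_dense[of "\<lambda>Q. g Q * h Q", OF polynomials_on.mult[OF g h] n S] by auto
qed

text \<open>Cross multiplication is transitive because a polynomial that is somewhere nonzero on the
  square-free forms can be cancelled there.\<close>

lemma rational_function_eqI:
  assumes n: "n \<ge> 2"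
    and P: "p \<in> polynomials_on (forms n)" "q \<in> polynomials_on (forms n)"
      "p' \<in> polynomials_on (forms n)" "q' \<in> polynomials_on (forms n)"
    and nz: "\<exists>Q\<in>squarefree_forms n. q Q \<noteq> 0" "\<exists>Q\<in>squarefree_forms n. q' Q \<noteq> 0"
    and eq: "\<And>Q. Q \<in> squarefree_forms n \<Longrightarrow> p Q * q' Q = p' Q * q Q"
  shows "rational_function (forms n) (squarefree_forms n) p q
    = rational_function (forms n) (squarefree_forms n) p' q'"
proof -
  note A = function_algebra_polynomials_on[of "forms n"]
  have *: "rational_function (forms n) (squarefree_forms n) p q
    \<subseteq> rational_function (forms n) (squarefree_forms n) p' q'"
    if P: "p \<in> polynomials_on (forms n)" "q \<in> polynomials_on (forms n)"
      "p' \<in> polynomials_on (forms n)" "q' \<in> polynomials_on (forms n)"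
    and nz: "\<exists>Q\<in>squarefree_forms n. q Q \<noteq> 0"
    and eq: "\<And>Q. Q \<in> squarefree_forms n \<Longrightarrow> p Q * q' Q = p' Q * q Q" for p q p' q'
  proof
    fix x
    assume "x \<in> rational_function (forms n) (squarefree_forms n) p q"
    then obtain a b where x: "x = (a, b)" "\<exists>Q\<in>squarefree_forms n. b Q \<noteq> 0"
      and ab: "a \<in> polynomials_on (forms n)" "b \<in> polynomials_on (forms n)"
      and e: "\<forall>Q\<in>squarefree_forms n. p Q * b Q = a Q * q Q"
      unfolding rational_function_def by blast
    have "p' Q * b Q = a Q * q' Q" if Q: "Q \<in> squarefree_forms n" for Q
    proof (rule ccontr)
      assume ne: "p' Q * b Q \<noteq> a Q * q' Q"
      have h: "(\<lambda>Q. p' Q * b Q - a Q * q' Q) \<in> polynomials_on (forms n)"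
        by (intro function_algebra_diff[OF A] function_algebraD[OF A] P ab)
      obtain Q1 where "Q1 \<in> squarefree_forms n" "q Q1 \<noteq> 0" using nz by blast
      then obtain S where S: "S \<in> squarefree_forms n" "q S \<noteq> 0" "p' S * b S - a S * q' S \<noteq> 0"
        using squarefree_forms_common_nonzero[OF P(2) h n, of Q1 Q] Q ne squarefree_forms_subset by auto
      have "q S * (p' S * b S - a S * q' S) = (p' S * q S) * b S - q' S * (a S * q S)" by (simp add: algebra_simps)
      also have "\<dots> = 0" using eq[OF S(1)] e S(1) by (simp flip: eq)
      finally show False using S(2,3) by simp
    qed
    then show "x \<in> rational_function (forms n) (squarefree_forms n) p' q'"
      using x ab unfolding rational_function_def by blast
  qed
  show ?thesis using *[OF P nz(1) eq] *[OF P(3,4,1,2) nz(2)] eq by (metis subset_antisym)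
qed

section \<open>Linear substitutions and invariant pairings\<close>

definition mkm :: "complex \<Rightarrow> complex \<Rightarrow> complex \<Rightarrow> complex \<Rightarrow> complex^2^2" where
  "mkm a b c d = (\<chi> i. if i = 1 then mk2 a b else mk2 c d)"

lemma mkm_nth [simp]:
  "mkm a b c d $ 1 $ 1 = a" "mkm a b c d $ 1 $ 2 = b" "mkm a b c d $ 2 $ 1 = c" "mkm a b c d $ 2 $ 2 = d"
  by (simp_all add: mkm_def)

lemma mat2_eq_iff: "(A :: complex^2^2) = B \<longleftrightarrow>
    A $ 1 $ 1 = B $ 1 $ 1 \<and> A $ 1 $ 2 = B $ 1 $ 2 \<and> A $ 2 $ 1 = B $ 2 $ 1 \<and> A $ 2 $ 2 = B $ 2 $ 2"
  by (auto simp: Finite_Cartesian_Product.vec_eq_iff forall_2)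

lemma mkm_eta: "A = mkm (A $ 1 $ 1) (A $ 1 $ 2) (A $ 2 $ 1) (A $ 2 $ 2)"
  by (simp add: mat2_eq_iff)

lemma mkm_mult: "mkm a b c d ** mkm p q r s = mkm (a * p + b * r) (a * q + b * s) (c * p + d * r) (c * q + d * s)"
  by (simp add: mat2_eq_iff matrix_matrix_mult_def sum_2)

lemma det_mkm [simp]: "det (mkm a b c d) = a * d - b * c"
  by (simp add: det_2)

lemma vec2_eq_iff: "(z :: complex^2) = w \<longleftrightarrow> z $ 1 = w $ 1 \<and> z $ 2 = w $ 2"
  by (auto simp: Finite_Cartesian_Product.vec_eq_iff forall_2)

text \<open>The matrix of the substitution \<open>A\<close> on the monomials of degree \<open>d\<close>, the symmetric power of \<open>A\<close>.\<close>

definition sym_power :: "nat \<Rightarrow> complex^2^2 \<Rightarrow> nat \<Rightarrow> nat \<Rightarrow> complex" where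
  "sym_power d A k j = cf d (\<lambda>z. bmono d k (A *v z)) j"

lemma bmono_comp:
  assumes "k \<le> d" shows "bmono d k (A *v z) = (\<Sum>j\<le>d. sym_power d A k j * bmono d j z)"
  unfolding sym_power_def using form_expand[OF forms_comp[OF forms_mono[OF assms]]] .

lemma cf_comp:
  assumes "u \<in> forms d" "j \<le> d"
  shows "cf d (\<lambda>z. u (A *v z)) j = (\<Sum>k\<le>d. cf d u k * sym_power d A k j)"
proof -
  have "(\<lambda>z. u (A *v z)) = (\<lambda>z. \<Sum>k\<le>d. cf d u k * bmono d k (A *v z))"
    by (rule ext, rule form_expand[OF assms(1)])
  then show ?thesis by (simp add: cf_sum cf_scale sym_power_def)
qed

lemma sym_power_mult:
  assumes "k \<le> d" "j \<le> d"
  shows "sym_power d (A ** B) k j = (\<Sum>l\<le>d. sym_power d A k l * sym_power d B l j)"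
proof -
  have "sym_power d (A ** B) k j = cf d (\<lambda>z. bmono d k (A *v (B *v z))) j"
    by (simp add: sym_power_def matrix_vector_mul_assoc)
  also have "\<dots> = (\<Sum>l\<le>d. cf d (\<lambda>z. bmono d k (A *v z)) l * sym_power d B l j)"
    by (rule cf_comp) (use assms in auto)
  finally show ?thesis by (simp add: sym_power_def)
qed

lemma ndet_sym_power_mult: "ndet (Suc d) (sym_power d (A ** B)) = ndet (Suc d) (sym_power d A) * ndet (Suc d) (sym_power d B)"
  by (subst ndet_mult[symmetric], rule ndet_cong) (simp add: sym_power_mult lessThan_Suc_atMost)

lemma cf_eqI:
  assumes "\<And>z. f z = (\<Sum>l\<le>d. c l * bmono d l z)" "k \<le> d"
  shows "cf d f k = c k"
proof -
  have "f = (\<lambda>z. \<Sum>l\<le>d. c l * bmono d l z)" using assms(1) by (rule ext)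
  then show ?thesis using cf_mono_sum[OF assms(2), of c] by simp
qed

lemma prod_power_sum: "(\<Prod>i\<in>A. (a::complex) ^ f i) = a ^ (\<Sum>i\<in>A. f i)"
  by (simp add: power_sum)

lemma ndet_sym_power_upper:
  "ndet (Suc d) (sym_power d (mkm a b 0 e)) = (a * e) ^ (d * (d + 1) div 2)"
proof -
  have s: "sym_power d (mkm a b 0 e) k j
      = (if j \<le> k then of_nat (k choose j) * a ^ j * b ^ (k - j) * e ^ (d - k) else 0)"
    if "k \<le> d" "j \<le> d" for k j
    unfolding sym_power_def
  proof (rule cf_eqI[OF _ that(2)])
    fix z
    have "bmono d k (mkm a b 0 e *v z) = (a * z $ 1 + b * z $ 2) ^ k * (e * z $ 2) ^ (d - k)"
      by (simp add: bmono_def matrix_vector_2)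
    also have "\<dots> = (\<Sum>l\<le>k. of_nat (k choose l) * (a * z $ 1) ^ l * (b * z $ 2) ^ (k - l) * (e * z $ 2) ^ (d - k))"
      by (simp add: binomial_ring sum_distrib_right)
    also have "\<dots> = (\<Sum>l\<le>k. of_nat (k choose l) * a ^ l * b ^ (k - l) * e ^ (d - k) * bmono d l z)"
    proof (rule sum.cong[OF refl])
      fix l assume "l \<in> {..k}"
      then have "d - l = (k - l) + (d - k)" using that by simp
      then show "of_nat (k choose l) * (a * z $ 1) ^ l * (b * z $ 2) ^ (k - l) * (e * z $ 2) ^ (d - k)
        = of_nat (k choose l) * a ^ l * b ^ (k - l) * e ^ (d - k) * bmono d l z"
        by (simp add: bmono_def power_mult_distrib power_add)
    qed
    also have "\<dots> = (\<Sum>l\<le>d. (if l \<le> k then of_nat (k choose l) * a ^ l * b ^ (k - l) * e ^ (d - k) else 0) * bmono d l z)"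
      by (rule sum.mono_neutral_cong_left) (use that in auto)
    finally show "bmono d k (mkm a b 0 e *v z) = \<dots>" .
  qed
  have g: "(\<Sum>k<Suc d. k) = d * (d + 1) div 2"
    by (simp add: lessThan_Suc_atMost atMost_atLeast0 gauss_sum_nat)
  have g': "(\<Sum>k<Suc d. d - k) = d * (d + 1) div 2"
    using sum.nat_diff_reindex[of "\<lambda>k. k" "Suc d"] g by simp
  have "ndet (Suc d) (sym_power d (mkm a b 0 e)) = (\<Prod>k<Suc d. sym_power d (mkm a b 0 e) k k)"
    by (rule ndet_lower_triangular) (simp add: s)
  also have "\<dots> = (\<Prod>k<Suc d. a ^ k * e ^ (d - k))"
    by (rule prod.cong) (simp_all add: s)
  also have "\<dots> = a ^ (\<Sum>k<Suc d. k) * e ^ (\<Sum>k<Suc d. d - k)"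
    by (simp only: prod.distrib prod_power_sum)
  finally show ?thesis by (simp only: g g' power_mult_distrib)
qed

lemma ndet_sym_power_lower: "ndet (Suc d) (sym_power d (mkm 1 0 c 1)) = 1"
proof -
  have s: "sym_power d (mkm 1 0 c 1) k j
      = (if k \<le> j then of_nat ((d - k) choose (j - k)) * c ^ (j - k) else 0)"
    if "k \<le> d" "j \<le> d" for k j
    unfolding sym_power_def
  proof (rule cf_eqI[OF _ that(2)])
    fix z
    have "bmono d k (mkm 1 0 c 1 *v z) = (z $ 1) ^ k * (c * z $ 1 + z $ 2) ^ (d - k)"
      by (simp add: bmono_def matrix_vector_2)
    also have "\<dots> = (\<Sum>l\<le>d - k. of_nat ((d - k) choose l) * c ^ l * bmono d (l + k) z)"
      by (auto simp: binomial_ring sum_distrib_left bmono_def power_mult_distrib power_add add.commute[of k] intro!: sum.cong)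
    also have "\<dots> = (\<Sum>l\<in>{k..d}. of_nat ((d - k) choose (l - k)) * c ^ (l - k) * bmono d l z)"
      by (rule sum.reindex_bij_witness[of _ "\<lambda>l. l - k" "\<lambda>l. l + k"]) (use that in auto)
    also have "\<dots> = (\<Sum>l\<le>d. (if k \<le> l then of_nat ((d - k) choose (l - k)) * c ^ (l - k) else 0) * bmono d l z)"
      by (rule sum.mono_neutral_cong_left) auto
    finally show "bmono d k (mkm 1 0 c 1 *v z) = \<dots>" .
  qed
  have "ndet (Suc d) (sym_power d (mkm 1 0 c 1)) = (\<Prod>k<Suc d. sym_power d (mkm 1 0 c 1) k k)"
    by (rule ndet_upper_triangular) (simp add: s)
  also have "\<dots> = 1" by (rule prod.neutral) (simp add: s)
  finally show ?thesis .
qed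

text \<open>The symmetric power is multiplicative and takes triangular matrices to triangular ones, and every
  invertible matrix is a product of triangular matrices.\<close>

lemma ndet_sym_power:
  assumes "det A \<noteq> 0"
  shows "ndet (Suc d) (sym_power d A) = det A ^ (d * (d + 1) div 2)"
proof -
  have *: "ndet (Suc d) (sym_power d (mkm p q r s)) = (p * s - q * r) ^ (d * (d + 1) div 2)"
    if "p \<noteq> 0" for p q r s
  proof -
    have "mkm p q r s = mkm 1 0 (r / p) 1 ** mkm p q 0 (s - r * q / p)"
      using that by (simp add: mkm_mult)
    then have "ndet (Suc d) (sym_power d (mkm p q r s)) = (p * (s - r * q / p)) ^ (d * (d + 1) div 2)"
      by (simp only: ndet_sym_power_mult ndet_sym_power_lower ndet_sym_power_upper) simp
    also have "p * (s - r * q / p) = p * s - q * r" using that by (simp add: right_diff_distrib)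
    finally show ?thesis .
  qed
  obtain p q r s where A: "A = mkm p q r s" using mkm_eta by metis
  show ?thesis
  proof (cases "p = 0")
    case False
    then show ?thesis using * A by simp
  next
    case True
    then have "r \<noteq> 0" using assms A by auto
    \<comment> \<open>A shear moves a nonzero entry into the upper left corner.\<close>
    have "A = mkm 1 (-1) 0 1 ** mkm (p + r) (q + s) r s" by (simp add: A mkm_mult)
    then have "ndet (Suc d) (sym_power d A) = ndet (Suc d) (sym_power d (mkm (p + r) (q + s) r s))"
      by (simp only: ndet_sym_power_mult ndet_sym_power_upper) simp
    also have "\<dots> = ((p + r) * s - (q + s) * r) ^ (d * (d + 1) div 2)"
      by (rule *) (use True \<open>r \<noteq> 0\<close> in simp)
    finally show ?thesis by (simp add: A algebra_simps)
  qed
qed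

subsection \<open>The apolar pairing\<close>

definition dotp :: "complex^2 \<Rightarrow> complex^2 \<Rightarrow> complex" where
  "dotp w z = w $ 1 * z $ 1 + w $ 2 * z $ 2"

text \<open>The bilinear pairing of forms of degree \<open>d\<close> for which pairing with \<open>(w \<cdot> z)^d\<close> is evaluation at \<open>w\<close>
  (\<open>apolar_dotp_power\<close>); the binomial coefficients come from the expansion of that power.\<close>

definition apolar :: "nat \<Rightarrow> cfun \<Rightarrow> cfun \<Rightarrow> complex" where
  "apolar d u B = (\<Sum>k\<le>d. cf d u k * cf d B k / of_nat (d choose k))"

lemma apolar_add_left: "apolar d (\<lambda>z. f z + g z) B = apolar d f B + apolar d g B"
  by (simp add: apolar_def cf_add distrib_right add_divide_distrib sum.distrib)

lemma apolar_scale_left: "apolar d (\<lambda>z. c * f z) B = c * apolar d f B"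
  by (simp add: apolar_def cf_scale sum_distrib_left mult.assoc)

lemma apolar_scale_right: "apolar d f (\<lambda>z. c * B z) = c * apolar d f B"
  by (simp add: apolar_def cf_scale sum_distrib_left mult.left_commute)

lemma apolar_sum_left: "apolar d (\<lambda>z. \<Sum>i\<in>A. f i z) B = (\<Sum>i\<in>A. apolar d (f i) B)"
  by (induction A rule: infinite_finite_induct) (simp_all add: apolar_add_left apolar_def)

lemma apolar_bmono:
  assumes "k \<le> d" shows "apolar d (bmono d k) B = cf d B k / of_nat (d choose k)"
proof -
  have "apolar d (bmono d k) B = (\<Sum>l\<le>d. if l = k then cf d B k / of_nat (d choose k) else 0)"
    unfolding apolar_def by (rule sum.cong) (use assms in \<open>auto simp: cf_mono\<close>)
  then show ?thesis using assms by simp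
qed

lemma dotp_power_expand: "dotp w z ^ d = (\<Sum>k\<le>d. of_nat (d choose k) * bmono d k w * bmono d k z)"
  by (simp add: dotp_def binomial_ring bmono_def power_mult_distrib mult_ac)

lemma forms_dotp_power [simp, intro]: "(\<lambda>z. dotp w z ^ d) \<in> forms d"
  unfolding dotp_power_expand by (rule forms_sum_mono)

lemma cf_dotp_power: "k \<le> d \<Longrightarrow> cf d (\<lambda>z. dotp w z ^ d) k = of_nat (d choose k) * bmono d k w"
  by (rule cf_eqI) (rule dotp_power_expand)

lemma apolar_dotp_power:
  assumes "B \<in> forms d" shows "apolar d (\<lambda>z. dotp w z ^ d) B = B w"
proof -
  have "apolar d (\<lambda>z. dotp w z ^ d) B = (\<Sum>k\<le>d. cf d B k * bmono d k w)"
    unfolding apolar_def by (rule sum.cong) (auto simp: cf_dotp_power)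
  then show ?thesis using form_expand[OF assms] by simp
qed

text \<open>The powers of linear forms span: the values of a linear functional on \<open>(w \<cdot> z)^d\<close> are a form in \<open>w\<close>
  whose coefficients are, up to binomial factors, the values on the monomials.\<close>

lemma linear_on_forms_eqI:
  fixes L M :: "cfun \<Rightarrow> complex"
  assumes L: "\<And>f g a b. f \<in> forms d \<Longrightarrow> g \<in> forms d \<Longrightarrow> L (\<lambda>z. a * f z + b * g z) = a * L f + b * L g"
    and M: "\<And>f g a b. f \<in> forms d \<Longrightarrow> g \<in> forms d \<Longrightarrow> M (\<lambda>z. a * f z + b * g z) = a * M f + b * M g"
    and eq: "\<And>w. L (\<lambda>z. dotp w z ^ d) = M (\<lambda>z. dotp w z ^ d)"
    and Q: "Q \<in> forms d"
  shows "L Q = M Q"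
proof -
  have exp: "N (\<lambda>z. dotp w z ^ d) = (\<Sum>k\<le>d. (of_nat (d choose k) * N (bmono d k)) * bmono d k w)"
    if N: "\<And>f g a b. f \<in> forms d \<Longrightarrow> g \<in> forms d \<Longrightarrow> N (\<lambda>z. a * f z + b * g z) = a * N f + b * N g"
    for N :: "cfun \<Rightarrow> complex" and w
  proof -
    have "N (\<lambda>z. dotp w z ^ d) = (\<Sum>k\<le>d. cf d (\<lambda>z. dotp w z ^ d) k * N (bmono d k))"
      by (rule linear_on_forms) (rule N, assumption+, rule forms_dotp_power)
    then show ?thesis by (auto simp: cf_dotp_power mult_ac intro!: sum.cong)
  qed
  have "L (bmono d k) = M (bmono d k)" if k: "k \<le> d" for k
  proof -
    have "cf d (\<lambda>w. L (\<lambda>z. dotp w z ^ d)) k = of_nat (d choose k) * L (bmono d k)"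
      "cf d (\<lambda>w. M (\<lambda>z. dotp w z ^ d)) k = of_nat (d choose k) * M (bmono d k)"
      by (rule cf_eqI[OF _ k], rule exp, fact L) (rule cf_eqI[OF _ k], rule exp, fact M)
    then show ?thesis using k by (simp add: eq)
  qed
  moreover have "L Q = (\<Sum>k\<le>d. cf d Q k * L (bmono d k))"
    by (rule linear_on_forms[OF _ Q]) (rule L)
  moreover have "M Q = (\<Sum>k\<le>d. cf d Q k * M (bmono d k))"
    by (rule linear_on_forms[OF _ Q]) (rule M)
  ultimately show ?thesis by (auto intro!: sum.cong)
qed

lemma dotp_adjoint: "dotp w (transpose A *v z) = dotp (A *v w) z"
  by (simp add: dotp_def matrix_vector_2 transpose_def algebra_simps)

text \<open>On powers of linear forms both sides are a value of \<open>B\<close>.\<close>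

lemma apolar_adjoint:
  assumes "u \<in> forms d" "B \<in> forms d"
  shows "apolar d (\<lambda>z. u (transpose A *v z)) B = apolar d u (\<lambda>w. B (A *v w))"
proof (rule linear_on_forms_eqI[OF _ _ _ assms(1)])
  show "apolar d (\<lambda>z. dotp w (transpose A *v z) ^ d) B = apolar d (\<lambda>z. dotp w z ^ d) (\<lambda>w. B (A *v w))" for w
    by (simp only: dotp_adjoint apolar_dotp_power[OF assms(2)] apolar_dotp_power[OF forms_comp[OF assms(2)]])
qed (simp_all add: apolar_add_left apolar_scale_left)

text \<open>Rotation by a right angle, which satisfies \<open>A rot A\<^sup>T = det A rot\<close> for every matrix \<open>A\<close>.\<close>

definition rot :: "complex^2 \<Rightarrow> complex^2" where
  "rot t = mk2 (t $ 2) (- (t $ 1))"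

lemma rot_eq: "rot t = mkm 0 1 (-1) 0 *v t"
  by (simp add: rot_def vec2_eq_iff matrix_vector_2)

text \<open>The classical invariant pairing of two forms of equal degree (their last transvectant): the rotation
  turns the adjunction for the apolar pairing into invariance up to a power of the determinant.\<close>

definition skew :: "nat \<Rightarrow> cfun \<Rightarrow> cfun \<Rightarrow> complex" where
  "skew d g h = apolar d g (\<lambda>t. h (rot t))"

lemma forms_rot: "h \<in> forms d \<Longrightarrow> (\<lambda>t. h (rot t)) \<in> forms d"
  unfolding rot_eq by (rule forms_comp)

lemma skew_comp:
  assumes "g \<in> forms d" "h \<in> forms d"
  shows "skew d (\<lambda>t. g (A *v t)) (\<lambda>t. h (A *v t)) = det A ^ d * skew d g h"
proof -
  let ?h = "\<lambda>t. h (A *v rot t)"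
  have hF: "?h \<in> forms d"
    using forms_rot[OF forms_comp[OF assms(2)]] .
  have "skew d (\<lambda>t. g (A *v t)) (\<lambda>t. h (A *v t)) = apolar d (\<lambda>t. g (transpose (transpose A) *v t)) ?h"
    by (simp add: skew_def)
  also have "\<dots> = apolar d g (\<lambda>t. ?h (transpose A *v t))"
    by (rule apolar_adjoint[OF assms(1) hF])
  also have "(\<lambda>t. ?h (transpose A *v t)) = (\<lambda>t. det A ^ d * h (rot t))"
  proof
    fix t
    have "A *v rot (transpose A *v t) = det A *s rot t"
      by (simp add: vec2_eq_iff rot_def matrix_vector_2 det_2 transpose_def algebra_simps)
    then show "?h (transpose A *v t) = det A ^ d * h (rot t)"
      by (simp add: form_scale_arg[OF assms(2)])
  qed
  finally show ?thesis by (simp add: skew_def apolar_scale_right)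
qed

lemma skew_scale: "skew d (\<lambda>z. a * g z) (\<lambda>z. b * h z) = a * b * skew d g h"
  by (simp add: skew_def apolar_scale_left apolar_scale_right)

lemma function_algebra_cf:
  assumes S: "function_algebra S" and F: "\<And>z. (\<lambda>x. F x z) \<in> S"
  shows "(\<lambda>x. cf d (F x) k) \<in> S"
proof -
  have "(\<lambda>x. \<Sum>j\<le>d. (cis (- (2 * pi * real j * real k / real (Suc d))) / of_nat (Suc d))
      * F x (mk2 (cis (2 * pi * real j / real (Suc d))) 1)) \<in> S"
    by (intro function_algebra_sum[OF S] function_algebraD[OF S] F)
  then show ?thesis by (simp add: cf_def sum_divide_distrib)
qed

lemma function_algebra_apolar:
  assumes S: "function_algebra S" and F: "\<And>z. (\<lambda>x. F x z) \<in> S" "\<And>z. (\<lambda>x. G x z) \<in> S"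
  shows "(\<lambda>x. apolar d (F x) (G x)) \<in> S"
proof -
  have "(\<lambda>x. \<Sum>k\<le>d. (1 / of_nat (d choose k)) * (cf d (F x) k * cf d (G x) k)) \<in> S"
    by (intro function_algebra_sum[OF S] function_algebraD[OF S] function_algebra_cf[OF S] F)
  then show ?thesis by (simp add: apolar_def)
qed

lemma function_algebra_skew:
  assumes "function_algebra S" "\<And>z. (\<lambda>x. F x z) \<in> S" "\<And>z. (\<lambda>x. G x z) \<in> S"
  shows "(\<lambda>x. skew d (F x) (G x)) \<in> S"
  unfolding skew_def using assms by (intro function_algebra_apolar) auto

section \<open>The Poisson bracket of binary forms\<close>

abbreviation pd :: "2 \<Rightarrow> cfun \<Rightarrow> cfun" where "pd \<equiv> partial_derivative"

lemma form_directional_derivative: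
  assumes Q: "Q \<in> forms d"
  shows "((\<lambda>t. Q (mk2 (a + t * p) (b + t * q))) has_field_derivative
      p * (\<Sum>k\<le>d. cf d Q k * of_nat k * bmono (d - 1) (k - 1) (mk2 a b))
    + q * (\<Sum>k\<le>d. cf d Q k * of_nat (d - k) * bmono (d - 1) k (mk2 a b))) (at 0)"
proof -
  have 1: "((\<lambda>t. bmono d k (mk2 (a + t * p) (b + t * q))) has_field_derivative
      p * of_nat k * bmono (d - 1) (k - 1) (mk2 a b) + q * of_nat (d - k) * bmono (d - 1) k (mk2 a b)) (at 0)"
    if "k \<le> d" for k
  proof -
    have "((\<lambda>t. (a + t * p) ^ k * (b + t * q) ^ (d - k)) has_field_derivative
      (of_nat k * a ^ (k - 1) * p) * b ^ (d - k) + a ^ k * (of_nat (d - k) * b ^ (d - k - 1) * q)) (at 0)"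
      by (auto intro!: derivative_eq_intros)
    also have "(of_nat k * a ^ (k - 1) * p) * b ^ (d - k) + a ^ k * (of_nat (d - k) * b ^ (d - k - 1) * q)
      = p * of_nat k * bmono (d - 1) (k - 1) (mk2 a b) + q * of_nat (d - k) * bmono (d - 1) k (mk2 a b)"
      using that by (cases k) (auto simp: bmono_def mult_ac)
    finally show ?thesis by (simp add: bmono_def)
  qed
  have "((\<lambda>t. \<Sum>k\<le>d. cf d Q k * bmono d k (mk2 (a + t * p) (b + t * q))) has_field_derivative
      (\<Sum>k\<le>d. cf d Q k * (p * of_nat k * bmono (d - 1) (k - 1) (mk2 a b) + q * of_nat (d - k) * bmono (d - 1) k (mk2 a b)))) (at 0)"
    by (intro DERIV_sum DERIV_cmult 1) simp
  also have "(\<Sum>k\<le>d. cf d Q k * (p * of_nat k * bmono (d - 1) (k - 1) (mk2 a b) + q * of_nat (d - k) * bmono (d - 1) k (mk2 a b)))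
    = p * (\<Sum>k\<le>d. cf d Q k * of_nat k * bmono (d - 1) (k - 1) (mk2 a b))
    + q * (\<Sum>k\<le>d. cf d Q k * of_nat (d - k) * bmono (d - 1) k (mk2 a b))"
    by (simp add: sum_distrib_left distrib_left sum.distrib mult_ac)
  finally show ?thesis by (simp only: form_expand[OF Q, symmetric])
qed

lemma axis_mk2: "axis 1 1 = mk2 1 0" "axis 2 1 = mk2 0 1"
  by (simp_all add: vec2_eq_iff axis_def)

lemma mk2_add: "mk2 a b + mk2 c d = mk2 (a + c) (b + d)"
  by (simp add: vec2_eq_iff)

lemma partial_derivative_form:
  assumes Q: "Q \<in> forms d"
  shows "pd 1 Q z = (\<Sum>k\<le>d. cf d Q k * of_nat k * bmono (d - 1) (k - 1) z)"
    "pd 2 Q z = (\<Sum>k\<le>d. cf d Q k * of_nat (d - k) * bmono (d - 1) k z)"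
proof -
  have z: "z + t *s mk2 p q = mk2 (z $ 1 + t * p) (z $ 2 + t * q)" for t p q
    by (simp add: vec2_eq_iff)
  show "pd 1 Q z = (\<Sum>k\<le>d. cf d Q k * of_nat k * bmono (d - 1) (k - 1) z)"
    using DERIV_imp_deriv[OF form_directional_derivative[OF Q, of "z $ 1" 1 "z $ 2" 0]]
    unfolding partial_derivative_def axis_mk2 z by simp
  show "pd 2 Q z = (\<Sum>k\<le>d. cf d Q k * of_nat (d - k) * bmono (d - 1) k z)"
    using DERIV_imp_deriv[OF form_directional_derivative[OF Q, of "z $ 1" 0 "z $ 2" 1]]
    unfolding partial_derivative_def axis_mk2 z by simp
qed

lemma forms_pd1: assumes Q: "Q \<in> forms d" shows "pd 1 Q \<in> forms (d - 1)"
proof -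
  have "pd 1 Q = (\<lambda>z. \<Sum>k\<le>d. cf d Q k * of_nat k * bmono (d - 1) (k - 1) z)"
    using partial_derivative_form[OF Q] by auto
  also have "\<dots> \<in> forms (d - 1)" by (intro forms_sum forms_scale forms_mono) auto
  finally show ?thesis .
qed

lemma forms_pd2: assumes Q: "Q \<in> forms d" shows "pd 2 Q \<in> forms (d - 1)"
proof -
  have "(\<lambda>z. cf d Q k * of_nat (d - k) * bmono (d - 1) k z) \<in> forms (d - 1)" if "k \<le> d" for k
    using that by (cases "k = d") (auto intro!: forms_scale)
  then have "(\<lambda>z. \<Sum>k\<le>d. cf d Q k * of_nat (d - k) * bmono (d - 1) k z) \<in> forms (d - 1)"
    by (intro forms_sum) auto
  moreover have "pd 2 Q = (\<lambda>z. \<Sum>k\<le>d. cf d Q k * of_nat (d - k) * bmono (d - 1) k z)"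
    using partial_derivative_form[OF Q] by auto
  ultimately show ?thesis by simp
qed

lemma forms_pd [simp]: "Q \<in> forms d \<Longrightarrow> pd i Q \<in> forms (d - 1)"
  using forms_pd1 forms_pd2 exhaust_2[of i] by metis

lemma pd_linear:
  assumes "f \<in> forms d" "g \<in> forms d"
  shows "pd i (\<lambda>z. a * f z + b * g z) z = a * pd i f z + b * pd i g z"
proof -
  have F: "(\<lambda>z. a * f z + b * g z) \<in> forms d" using assms by auto
  show ?thesis
    using exhaust_2[of i] partial_derivative_form[OF assms(1), of z] partial_derivative_form[OF assms(2), of z]
      partial_derivative_form[OF F, of z]
    by (auto simp: cf_add cf_scale sum_distrib_left sum.distrib distrib_right mult.assoc
        simp del: of_nat_diff)
qed

lemma pd_bmono:
  assumes "k \<le> d"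
  shows "pd 1 (bmono d k) z = of_nat k * bmono (d - 1) (k - 1) z"
    "pd 2 (bmono d k) z = of_nat (d - k) * bmono (d - 1) k z"
proof -
  have e: "(\<Sum>l\<le>d. cf d (bmono d k) l * h l) = h k" for h :: "nat \<Rightarrow> complex"
  proof -
    have "(\<Sum>l\<le>d. cf d (bmono d k) l * h l) = (\<Sum>l\<le>d. if l = k then h k else 0)"
      using assms by (intro sum.cong) (auto simp: cf_mono)
    then show ?thesis using assms by simp
  qed
  show "pd 1 (bmono d k) z = of_nat k * bmono (d - 1) (k - 1) z"
    "pd 2 (bmono d k) z = of_nat (d - k) * bmono (d - 1) k z"
    using partial_derivative_form[OF forms_mono[OF assms], of z] by (simp_all only: e mult.assoc)
qed

lemma euler_relation:
  assumes Q: "Q \<in> forms d"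
  shows "z $ 1 * pd 1 Q z + z $ 2 * pd 2 Q z = of_nat d * Q z"
proof -
  have m: "of_nat k * (z $ 1 * bmono (d - 1) (k - 1) z) + of_nat (d - k) * (z $ 2 * bmono (d - 1) k z)
      = of_nat d * bmono d k z" if k: "k \<le> d" for k
  proof -
    have "of_nat k * (z $ 1 * bmono (d - 1) (k - 1) z) = of_nat k * bmono d k z"
      by (cases k) (auto simp: bmono_def)
    moreover have "of_nat (d - k) * (z $ 2 * bmono (d - 1) k z) = of_nat (d - k) * bmono d k z"
    proof (cases "d - k")
      case (Suc m)
      then have "d - 1 - k = m" by simp
      then show ?thesis using Suc by (simp add: bmono_def)
    qed simp
    moreover have "of_nat k + of_nat (d - k) = (of_nat d :: complex)"
      using k by (simp flip: of_nat_add)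
    ultimately show ?thesis by (metis distrib_right)
  qed
  have "z $ 1 * pd 1 Q z + z $ 2 * pd 2 Q z
    = (\<Sum>k\<le>d. cf d Q k * (of_nat k * (z $ 1 * bmono (d - 1) (k - 1) z) + of_nat (d - k) * (z $ 2 * bmono (d - 1) k z)))"
    by (simp add: partial_derivative_form[OF Q] sum_distrib_left sum.distrib[symmetric] algebra_simps)
  also have "\<dots> = (\<Sum>k\<le>d. cf d Q k * (of_nat d * bmono d k z))"
    by (intro sum.cong refl arg_cong2[of _ _ _ _ "(*)"] m) simp
  also have "\<dots> = of_nat d * Q z"
    by (subst form_expand[OF Q]) (simp add: sum_distrib_left mult.left_commute)
  finally show ?thesis .
qed

lemma pd_comp:
  assumes Q: "Q \<in> forms d"
  shows "pd i (\<lambda>z. Q (A *v z)) z = A $ 1 $ i * pd 1 Q (A *v z) + A $ 2 $ i * pd 2 Q (A *v z)"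
proof -
  have A: "A *v (z + t *s axis i 1) = mk2 ((A *v z) $ 1 + t * A $ 1 $ i) ((A *v z) $ 2 + t * A $ 2 $ i)" for t
    using exhaust_2[of i] by (auto simp: vec2_eq_iff matrix_vector_2 axis_mk2 algebra_simps)
  show ?thesis
    using DERIV_imp_deriv[OF form_directional_derivative[OF Q, of "(A *v z) $ 1" "A $ 1 $ i" "(A *v z) $ 2" "A $ 2 $ i"]]
    unfolding partial_derivative_def[of i] A
    by (simp add: partial_derivative_form[OF Q])
qed

text \<open>The Poisson bracket, which is the first transvectant up to a factor.\<close>

definition bracket :: "cfun \<Rightarrow> cfun \<Rightarrow> cfun" where
  "bracket m q z = pd 1 m z * pd 2 q z - pd 2 m z * pd 1 q z"

lemma forms_bracket:
  assumes "m \<in> forms a" "q \<in> forms b" "c = (a - 1) + (b - 1)" shows "bracket m q \<in> forms c"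
  unfolding bracket_def[abs_def] by (intro forms_diff forms_multI[OF _ _ assms(3)] forms_pd assms)

lemma bracket_linear_left:
  assumes "f \<in> forms d" "g \<in> forms d"
  shows "bracket (\<lambda>z. a * f z + b * g z) q = (\<lambda>z. a * bracket f q z + b * bracket g q z)"
  by (rule ext) (simp add: bracket_def pd_linear[OF assms] algebra_simps)

lemma bracket_linear_right:
  assumes "f \<in> forms d" "g \<in> forms d"
  shows "bracket m (\<lambda>z. a * f z + b * g z) = (\<lambda>z. a * bracket m f z + b * bracket m g z)"
  by (rule ext) (simp add: bracket_def pd_linear[OF assms] algebra_simps)

lemma bracket_comp:
  assumes "m \<in> forms a" "q \<in> forms b"
  shows "bracket (\<lambda>z. m (A *v z)) (\<lambda>z. q (A *v z)) = (\<lambda>z. det A * bracket m q (A *v z))"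
  by (rule ext) (simp add: bracket_def pd_comp[OF assms(1)] pd_comp[OF assms(2)] det_2 algebra_simps)

lemma bracket_bmono:
  assumes "i \<le> a" "k \<le> b" "a \<ge> 1" "b \<ge> 1"
  shows "bracket (bmono a i) (bmono b k)
    = (\<lambda>z. (of_nat (i * b) - of_nat (a * k)) * bmono (a + b - 2) (i + k - 1) z)"
proof
  fix z
  have e: "a - 1 + (b - 1) = a + b - 2" using assms by simp
  have 1: "of_nat i * bmono (a - 1) (i - 1) z * (of_nat (b - k) * bmono (b - 1) k z)
      = of_nat (i * (b - k)) * bmono (a + b - 2) (i + k - 1) z"
  proof (cases "i = 0 \<or> k = b")
    case False
    then have "i - 1 \<le> a - 1" "k \<le> b - 1" "i - 1 + k = i + k - 1" using assms by auto
    then have "bmono (a - 1) (i - 1) z * bmono (b - 1) k z = bmono (a + b - 2) (i + k - 1) z"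
      using bmono_mult[of "i - 1" "a - 1" k "b - 1" z] by (simp only: e)
    then show ?thesis by (simp only: of_nat_mult mult_ac)
  qed auto
  have 2: "of_nat (a - i) * bmono (a - 1) i z * (of_nat k * bmono (b - 1) (k - 1) z)
      = of_nat ((a - i) * k) * bmono (a + b - 2) (i + k - 1) z"
  proof (cases "k = 0 \<or> i = a")
    case False
    then have "i \<le> a - 1" "k - 1 \<le> b - 1" "i + (k - 1) = i + k - 1" using assms by auto
    then have "bmono (a - 1) i z * bmono (b - 1) (k - 1) z = bmono (a + b - 2) (i + k - 1) z"
      using bmono_mult[of i "a - 1" "k - 1" "b - 1" z] by (simp only: e)
    then show ?thesis by (simp only: of_nat_mult mult_ac)
  qed auto
  have "bracket (bmono a i) (bmono b k) z
    = (of_nat (i * (b - k)) - of_nat ((a - i) * k)) * bmono (a + b - 2) (i + k - 1) z"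
    unfolding bracket_def pd_bmono[OF assms(1)] pd_bmono[OF assms(2)] 1 2 by (simp add: algebra_simps)
  also have "of_nat (i * (b - k)) - of_nat ((a - i) * k) = (of_nat (i * b) - of_nat (a * k) :: complex)"
    using assms by (simp add: of_nat_diff algebra_simps)
  finally show "bracket (bmono a i) (bmono b k) z
    = (of_nat (i * b) - of_nat (a * k)) * bmono (a + b - 2) (i + k - 1) z" .
qed

section \<open>Two covariant determinants\<close>

lemma ndet_scale: "ndet n (\<lambda>i j. c * M i j) = c ^ n * ndet n M"
proof -
  have "Matrix.mat n n (\<lambda>(i, j). c * M i j) = c \<cdot>\<^sub>m Matrix.mat n n (\<lambda>(i, j). M i j)"
    by (rule eq_matI) auto
  then show ?thesis unfolding ndet_def by simp
qed

text \<open>A change of unknowns by \<open>S\<close> and a recombination of the equations by \<open>K\<close> multiply the matrix of the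
  system on the right and on the left.\<close>

lemma ndet_bordered_covariant:
  assumes M: "\<And>i j. i < n \<Longrightarrow> j \<le> n \<Longrightarrow> M' i j = (\<Sum>k<n. K i k * (\<Sum>l\<le>n. M k l * S l j))"
    and v: "\<And>j. j \<le> n \<Longrightarrow> v' j = (\<Sum>l\<le>n. v l * S l j)"
  shows "ndet (Suc n) (bordered n M' v') = ndet n K * ndet (Suc n) (bordered n M v) * ndet (Suc n) S"
proof -
  let ?K = "\<lambda>i j. if i < n \<and> j < n then K i j else if n \<le> i \<and> n \<le> j then 1 else 0"
  have K1: "ndet 1 (\<lambda>_ _. 1) = 1"
    using ndet_lower_triangular[of 1 "\<lambda>_ _. 1"] by simp
  have K: "ndet (Suc n) ?K = ndet n K"
    using ndet_block_diagonal[of n 1 K "\<lambda>_ _. 1"] K1 by simp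
  have "ndet (Suc n) (bordered n M' v')
    = ndet (Suc n) (\<lambda>i j. \<Sum>k<Suc n. ?K i k * (\<Sum>l<Suc n. bordered n M v k l * S l j))"
  proof (rule ndet_cong)
    fix i j assume ij: "i < Suc n" "j < Suc n"
    show "bordered n M' v' i j = (\<Sum>k<Suc n. ?K i k * (\<Sum>l<Suc n. bordered n M v k l * S l j))"
    proof (cases "i < n")
      case True
      then show ?thesis using ij M[of i j]
        by (simp add: bordered_def lessThan_Suc_atMost[symmetric] del: sum.lessThan_Suc)
           (simp add: bordered_def)
    next
      case False
      then show ?thesis using ij v[of j] by (simp add: bordered_def lessThan_Suc_atMost[symmetric])
    qed
  qed
  then show ?thesis by (simp add: ndet_mult K del: sum.lessThan_Suc)
qed

text \<open>A basis of the degree 8 part of the Jacobian ideal of a sextic, adapted to the decomposition of the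
  cubic multiples of the two partial derivatives into a copy of the quadratic forms, \<open>n Q\<close>, and a copy of
  the quartic forms, \<open>{m, Q}\<close>. In this basis a substitution acts on the relations by symmetric powers.\<close>

definition relation_form :: "cfun \<Rightarrow> nat \<Rightarrow> cfun" where
  "relation_form Q i = (if i < 3 then (\<lambda>z. bmono 2 i z * Q z) else bracket (bmono 4 (i - 3)) Q)"

text \<open>The octic, as a function of \<open>w\<close>, whose coefficients are the maximal minors of the eight relations: the
  last row is the power \<open>(w \<cdot> z)^8\<close>, on which the functional of an octic \<open>B\<close> has the value \<open>B w\<close>.\<close>

definition dual_form :: "cfun \<Rightarrow> cfun" where
  "dual_form Q w = ndet (Suc 8) (bordered 8 (\<lambda>i. cf 8 (relation_form Q i)) (cf 8 (\<lambda>z. dotp w z ^ 8)))"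

text \<open>Six of the eight relations, as operators on the sextic \<open>u\<close>. Choosing six of them covariantly requires
  an auxiliary point \<open>t\<close>: the quartics divisible by the square of the linear form of \<open>t\<close> form a
  three-dimensional space that depends covariantly on \<open>t\<close>.\<close>

definition relation_op :: "complex^2 \<Rightarrow> nat \<Rightarrow> cfun \<Rightarrow> cfun" where
  "relation_op t i u = (if i < 3 then (\<lambda>z. bmono 2 i z * u z)
    else bracket (\<lambda>z. dotp t z ^ 2 * bmono 2 (i - 3) z) u)"

text \<open>The sextic, as a function of \<open>v\<close>, whose coefficients are the maximal minors of the six equations that
  the functional of the octic \<open>B\<close> imposes on sextics.\<close>

definition reconstruct :: "cfun \<Rightarrow> complex^2 \<Rightarrow> cfun" where
  "reconstruct B t v = ndet (Suc 6)
     (bordered 6 (\<lambda>i j. apolar 8 (relation_op t i (bmono 6 j)) B) (\<lambda>j. bmono 6 j v))"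

lemma forms_relation_form: "Q \<in> forms 6 \<Longrightarrow> i < 8 \<Longrightarrow> relation_form Q i \<in> forms 8"
  by (auto simp: relation_form_def intro!: forms_multI[of _ 2] forms_bracket[of _ 4 _ 6])

lemma forms_dotp2_bmono: "i \<le> 2 \<Longrightarrow> (\<lambda>z. dotp t z ^ 2 * bmono 2 i z) \<in> forms 4"
  by (rule forms_multI[of _ 2 _ 2]) auto

lemma forms_relation_op: "u \<in> forms 6 \<Longrightarrow> i < 6 \<Longrightarrow> relation_op t i u \<in> forms 8"
  by (auto simp: relation_op_def intro!: forms_multI[of _ 2] forms_bracket[of _ 4 _ 6] forms_dotp2_bmono)

lemma relation_op_linear:
  assumes "f \<in> forms 6" "g \<in> forms 6"
  shows "relation_op t i (\<lambda>z. a * f z + b * g z) = (\<lambda>z. a * relation_op t i f z + b * relation_op t i g z)"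
  by (auto simp: relation_op_def bracket_linear_right[OF assms] fun_eq_iff algebra_simps)

lemma linear_sum_forms:
  assumes L: "\<And>f g a b. f \<in> forms d \<Longrightarrow> g \<in> forms d \<Longrightarrow> L (\<lambda>z. a * f z + b * g z) = (\<lambda>z. a * L f z + b * L g z)"
    and f: "\<And>i. i \<in> I \<Longrightarrow> f i \<in> forms d" and I: "finite I"
  shows "(L :: cfun \<Rightarrow> cfun) (\<lambda>z. \<Sum>i\<in>I. c i * f i z) z = (\<Sum>i\<in>I. c i * L (f i) z)"
  using I f
proof (induction I)
  case empty
  show ?case using L[of "\<lambda>_. 0" "\<lambda>_. 0" 0 0] by (simp add: fun_eq_iff)
next
  case (insert i I)
  have "L (\<lambda>z. c i * f i z + 1 * (\<Sum>i\<in>I. c i * f i z)) z = c i * L (f i) z + 1 * L (\<lambda>z. \<Sum>i\<in>I. c i * f i z) z"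
    by (subst L) (use insert in \<open>auto intro!: forms_sum forms_scale\<close>)
  then show ?case using insert by simp
qed

lemma bracket_sum_left:
  assumes "finite I" "\<And>i. i \<in> I \<Longrightarrow> f i \<in> forms d"
  shows "bracket (\<lambda>z. \<Sum>i\<in>I. c i * f i z) q z = (\<Sum>i\<in>I. c i * bracket (f i) q z)"
  by (rule linear_sum_forms[of d "\<lambda>m. bracket m q"]) (use assms in \<open>auto simp: bracket_linear_left\<close>)

lemma matrix_inverse_vec:
  assumes "A ** A' = mat 1" shows "A *v (A' *v z) = (z :: complex^2)"
  using assms by (simp add: matrix_vector_mul_assoc)

text \<open>The quadratic relations transform by the symmetric square of the inverse of \<open>A\<close>, the brackets by its
  fourth symmetric power and an additional factor \<open>det A\<close> from the bracket.\<close>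

lemma relation_form_comp:
  assumes Q: "Q \<in> forms 6" and A: "A' ** A = mat 1" "A ** A' = mat 1" and i: "i < 8"
  shows "relation_form (\<lambda>z. Q (A *v z)) i z = (\<Sum>k<8. (if i < 3 \<and> k < 3 then sym_power 2 A' i k
      else if 3 \<le> i \<and> 3 \<le> k then det A * sym_power 4 A' (i - 3) (k - 3) else 0) * relation_form Q k (A *v z))"
proof -
  have split: "(\<Sum>k<8. f k) = (\<Sum>k\<le>2. f k) + (\<Sum>k\<le>4. f (k + 3))" for f :: "nat \<Rightarrow> complex"
    by (simp add: eval_nat_numeral)
  show ?thesis
  proof (cases "i < 3")
    case True
    have "bmono 2 i z = bmono 2 i (A' *v (A *v z))" by (simp add: matrix_inverse_vec[OF A(1)])
    also have "\<dots> = (\<Sum>k\<le>2. sym_power 2 A' i k * bmono 2 k (A *v z))" by (rule bmono_comp) (use True in simp)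
    finally show ?thesis
      unfolding split using True by (simp add: relation_form_def sum_distrib_right mult.assoc cong: sum.cong)
        (auto intro!: sum.cong simp: algebra_simps)
  next
    case False
    have i4: "i - 3 \<le> 4" using i by simp
    have e: "bmono 4 (i - 3) = (\<lambda>z. bmono 4 (i - 3) (A' *v (A *v z)))"
      by (simp add: matrix_inverse_vec[OF A(1)])
    have "bracket (bmono 4 (i - 3)) (\<lambda>z. Q (A *v z)) z
       = bracket (\<lambda>z. bmono 4 (i - 3) (A' *v (A *v z))) (\<lambda>z. Q (A *v z)) z"
      by (rule arg_cong[OF e, of "\<lambda>m. bracket m (\<lambda>z. Q (A *v z)) z"])
    also have "\<dots> = det A * bracket (\<lambda>z. bmono 4 (i - 3) (A' *v z)) Q (A *v z)"
      by (subst bracket_comp[OF forms_comp[OF forms_mono[OF i4]] Q]) simp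
    also have "(\<lambda>z. bmono 4 (i - 3) (A' *v z)) = (\<lambda>z. \<Sum>k\<le>4. sym_power 4 A' (i - 3) k * bmono 4 k z)"
      using bmono_comp[OF i4] by auto
    also have "bracket \<dots> Q (A *v z) = (\<Sum>k\<le>4. sym_power 4 A' (i - 3) k * bracket (bmono 4 k) Q (A *v z))"
      by (rule bracket_sum_left[of _ _ 4]) auto
    finally show ?thesis unfolding split using False
      by (simp add: relation_form_def sum_distrib_left mult.assoc)
  qed
qed

lemma det_inverse: "A ** A' = mat 1 \<Longrightarrow> det A * det (A' :: complex^2^2) = 1"
  by (metis det_I det_mul)

lemma ndet_block2:
  "ndet n (\<lambda>i k. if i < a \<and> k < a then X i k else if a \<le> i \<and> a \<le> k then Y (i - a) (k - a) else 0)
    = ndet a X * ndet (n - a) Y" if "a \<le> n"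
  using ndet_block_diagonal[of a "n - a" X Y] that by simp

text \<open>The substitution on octics contributes the exponent 36. The recombination of the relations
  contributes \<open>- 3\<close> for the quadratic ones and \<open>5 - 10\<close> for the five brackets.\<close>

lemma dual_form_comp:
  assumes Q: "Q \<in> forms 6" and A: "A' ** A = mat 1" "A ** A' = mat 1"
  shows "dual_form (\<lambda>z. Q (A *v z)) w = det A ^ 28 * dual_form Q (transpose A' *v w)"
proof -
  let ?w = "transpose A' *v w"
  let ?K = "\<lambda>i k. if i < 3 \<and> k < 3 then sym_power 2 A' i k
      else if 3 \<le> i \<and> 3 \<le> k then det A * sym_power 4 A' (i - 3) (k - 3) else 0"
  have d: "det A * det A' = 1" by (rule det_inverse[OF A(2)])
  then have d0: "det A \<noteq> 0" "det A' \<noteq> 0" by auto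
  have "dual_form (\<lambda>z. Q (A *v z)) w = ndet 8 ?K * dual_form Q ?w * ndet (Suc 8) (sym_power 8 A)"
    unfolding dual_form_def
  proof (rule ndet_bordered_covariant)
    fix i j :: nat assume i: "i < 8" and j: "j \<le> 8"
    have "relation_form (\<lambda>z. Q (A *v z)) i = (\<lambda>z. \<Sum>k<8. ?K i k * relation_form Q k (A *v z))"
      by (rule ext) (rule relation_form_comp[OF Q A i])
    then have "cf 8 (relation_form (\<lambda>z. Q (A *v z)) i) j = (\<Sum>k<8. ?K i k * cf 8 (\<lambda>z. relation_form Q k (A *v z)) j)"
      by (simp only: cf_sum cf_scale)
    also have "\<dots> = (\<Sum>k<8. ?K i k * (\<Sum>l\<le>8. cf 8 (relation_form Q k) l * sym_power 8 A l j))"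
      by (intro sum.cong refl arg_cong2[of _ _ _ _ "(*)"] cf_comp forms_relation_form Q j) auto
    finally show "cf 8 (relation_form (\<lambda>z. Q (A *v z)) i) j
      = (\<Sum>k<8. ?K i k * (\<Sum>l\<le>8. cf 8 (relation_form Q k) l * sym_power 8 A l j))" .
  next
    fix j :: nat assume j: "j \<le> 8"
    have "dotp w z = dotp ?w (A *v z)" for z
    proof -
      have "dotp ?w (A *v z) = dotp (A *v z) ?w" by (simp add: dotp_def mult.commute)
      also have "\<dots> = dotp (A' *v (A *v z)) w" by (rule dotp_adjoint)
      also have "\<dots> = dotp w z" by (simp add: matrix_inverse_vec[OF A(1)]) (simp add: dotp_def mult.commute)
      finally show ?thesis by simp
    qed
    then have "(\<lambda>z. dotp w z ^ 8) = (\<lambda>z. dotp ?w (A *v z) ^ 8)" by simp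
    then show "cf 8 (\<lambda>z. dotp w z ^ 8) j = (\<Sum>l\<le>8. cf 8 (\<lambda>z. dotp ?w z ^ 8) l * sym_power 8 A l j)"
      using cf_comp[OF forms_dotp_power[of ?w 8] j, of A] by simp
  qed
  also have "ndet 8 ?K = det A' ^ 3 * (det A ^ 5 * det A' ^ 10)"
  proof -
    have "ndet 8 ?K = ndet 3 (sym_power 2 A') * ndet 5 (\<lambda>i k. det A * sym_power 4 A' i k)"
      by (subst ndet_block2) auto
    also have "ndet 3 (sym_power 2 A') = det A' ^ 3"
      using ndet_sym_power[OF d0(2), of 2] by simp
    also have "ndet 5 (\<lambda>i k. det A * sym_power 4 A' i k) = det A ^ 5 * det A' ^ 10"
      using ndet_sym_power[OF d0(2), of 4] by (simp add: ndet_scale) 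
    finally show ?thesis .
  qed
  also have "ndet (Suc 8) (sym_power 8 A) = det A ^ 36"
    using ndet_sym_power[OF d0(1), of 8] by simp
  finally have "dual_form (\<lambda>z. Q (A *v z)) w
     = (det A' ^ 3 * (det A ^ 5 * det A' ^ 10)) * dual_form Q ?w * det A ^ 36" .
  also have "\<dots> = (det A * det A') ^ 13 * (det A ^ 28 * dual_form Q ?w)"
  proof -
    have "det A ^ 36 = det A ^ 8 * det A ^ 28" "det A ^ 13 = det A ^ 5 * det A ^ 8"
      "det A' ^ 13 = det A' ^ 3 * det A' ^ 10"
      by (simp_all flip: power_add)
    then show ?thesis by (simp only: power_mult_distrib mult_ac)
  qed
  finally show ?thesis by (simp add: d)
qed

lemma relation_op_comp:
  assumes u: "u \<in> forms 6" and A: "det A \<noteq> 0" and i: "i < 6"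
  shows "relation_op t i u (transpose A *v z) = (\<Sum>k<6. (if i < 3 \<and> k < 3 then sym_power 2 (transpose A) i k
      else if 3 \<le> i \<and> 3 \<le> k then (1 / det A) * sym_power 2 (transpose A) (i - 3) (k - 3) else 0)
      * relation_op (A *v t) k (\<lambda>z. u (transpose A *v z)) z)"
proof -
  let ?T = "transpose A"
  have split: "(\<Sum>k<6. f k) = (\<Sum>k\<le>2. f k) + (\<Sum>k\<le>2. f (k + 3))" for f :: "nat \<Rightarrow> complex"
    by (simp add: eval_nat_numeral)
  show ?thesis
  proof (cases "i < 3")
    case True
    then have i2: "i \<le> 2" by simp
    have "relation_op t i u (?T *v z) = bmono 2 i (?T *v z) * u (?T *v z)"
      using True by (simp add: relation_op_def)
    also have "\<dots> = (\<Sum>k\<le>2. sym_power 2 ?T i k * bmono 2 k z) * u (?T *v z)"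
      by (simp only: bmono_comp[OF i2])
    finally show ?thesis
      unfolding split using True
      by (simp del: transpose_matrix_vector add: relation_op_def sum_distrib_right mult.assoc cong: sum.cong)
        (auto intro!: sum.cong simp del: transpose_matrix_vector simp: algebra_simps)
  next
    case False
    then have i2: "i - 3 \<le> 2" using i by simp
    let ?m = "\<lambda>z. dotp t z ^ 2 * bmono 2 (i - 3) z"
    have "det A * bracket ?m u (?T *v z) = bracket (\<lambda>z. ?m (?T *v z)) (\<lambda>z. u (?T *v z)) z"
      by (subst bracket_comp[OF forms_dotp2_bmono[OF i2] u]) (simp add: Determinants.det_transpose)
    also have "(\<lambda>z. ?m (?T *v z)) = (\<lambda>z. \<Sum>k\<le>2. sym_power 2 ?T (i - 3) k * (dotp (A *v t) z ^ 2 * bmono 2 k z))"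
      by (simp only: bmono_comp[OF i2] dotp_adjoint sum_distrib_left mult.left_commute)
    also have "bracket \<dots> (\<lambda>z. u (?T *v z)) z
      = (\<Sum>k\<le>2. sym_power 2 ?T (i - 3) k * bracket (\<lambda>z. dotp (A *v t) z ^ 2 * bmono 2 k z) (\<lambda>z. u (?T *v z)) z)"
      by (rule bracket_sum_left[of _ _ 4]) (auto intro: forms_dotp2_bmono)
    finally have "bracket ?m u (?T *v z) = (\<Sum>k\<le>2. (1 / det A) * sym_power 2 ?T (i - 3) k
        * bracket (\<lambda>z. dotp (A *v t) z ^ 2 * bmono 2 k z) (\<lambda>z. u (?T *v z)) z)"
      using A by (simp add: field_simps sum_distrib_left[symmetric] sum_divide_distrib[symmetric])
    then show ?thesis unfolding split using False
      by (simp del: transpose_matrix_vector add: relation_op_def mult.assoc)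
  qed
qed

text \<open>The exponent is 21 from the substitution on sextics, 3 from the quadratic relations, and \<open>3 - 3\<close> from
  the three brackets.\<close>

lemma reconstruct_comp:
  assumes B: "B \<in> forms 8" and A: "A' ** A = mat 1" "A ** A' = mat 1"
  shows "reconstruct (\<lambda>w. B (A *v w)) t v = det A ^ 24 * reconstruct B (A *v t) (transpose A' *v v)"
proof -
  let ?T = "transpose A" and ?v = "transpose A' *v v"
  let ?K = "\<lambda>i k. if i < 3 \<and> k < 3 then sym_power 2 ?T i k
      else if 3 \<le> i \<and> 3 \<le> k then (1 / det A) * sym_power 2 ?T (i - 3) (k - 3) else 0"
  have d0: "det A \<noteq> 0" using det_inverse[OF A(2)] by auto
  have dT: "det ?T = det A" by (rule Determinants.det_transpose)
  have "reconstruct (\<lambda>w. B (A *v w)) t v = ndet 6 ?K * reconstruct B (A *v t) ?v * ndet (Suc 6) (\<lambda>l j. sym_power 6 ?T j l)"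
    unfolding reconstruct_def
  proof (rule ndet_bordered_covariant)
    fix i j :: nat assume i: "i < 6" and j: "j \<le> 6"
    let ?u = "\<lambda>z. bmono 6 j (?T *v z)"
    have uF: "?u \<in> forms 6" by (rule forms_comp) (use j in simp)
    have u: "?u = (\<lambda>z. \<Sum>l\<le>6. sym_power 6 ?T j l * bmono 6 l z)" using bmono_comp[OF j, of ?T] by auto
    have "apolar 8 (relation_op t i (bmono 6 j)) (\<lambda>w. B (A *v w)) = apolar 8 (\<lambda>z. relation_op t i (bmono 6 j) (?T *v z)) B"
      by (rule apolar_adjoint[symmetric]) (use i j B forms_relation_op in auto)
    also have "(\<lambda>z. relation_op t i (bmono 6 j) (?T *v z)) = (\<lambda>z. \<Sum>k<6. ?K i k * relation_op (A *v t) k ?u z)"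
      by (rule ext) (rule relation_op_comp[OF _ d0 i], use j in simp)
    also have "apolar 8 \<dots> B = (\<Sum>k<6. ?K i k * apolar 8 (relation_op (A *v t) k ?u) B)"
      by (simp only: apolar_sum_left apolar_scale_left)
    also have "\<dots> = (\<Sum>k<6. ?K i k * (\<Sum>l\<le>6. apolar 8 (relation_op (A *v t) k (bmono 6 l)) B * sym_power 6 ?T j l))"
    proof (intro sum.cong refl arg_cong2[of _ _ _ _ "(*)"])
      fix k assume "k \<in> {..<6::nat}"
      have "relation_op (A *v t) k ?u = (\<lambda>z. \<Sum>l\<le>6. sym_power 6 ?T j l * relation_op (A *v t) k (bmono 6 l) z)"
        unfolding u by (rule ext, rule linear_sum_forms[of 6]) (auto simp: relation_op_linear)
      then show "apolar 8 (relation_op (A *v t) k ?u) B = (\<Sum>l\<le>6. apolar 8 (relation_op (A *v t) k (bmono 6 l)) B * sym_power 6 ?T j l)"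
        by (simp only: apolar_sum_left apolar_scale_left mult.commute)
    qed
    finally show "apolar 8 (relation_op t i (bmono 6 j)) (\<lambda>w. B (A *v w))
      = (\<Sum>k<6. ?K i k * (\<Sum>l\<le>6. apolar 8 (relation_op (A *v t) k (bmono 6 l)) B * sym_power 6 ?T j l))" .
  next
    fix j :: nat assume j: "j \<le> 6"
    have "?T *v ?v = v"
    proof (rule matrix_inverse_vec)
      show "?T ** transpose A' = mat 1" using A(1) by (metis matrix_transpose_mul transpose_mat)
    qed
    then show "bmono 6 j v = (\<Sum>l\<le>6. bmono 6 l ?v * sym_power 6 ?T j l)"
      using bmono_comp[OF j, of ?T ?v] by (simp only: mult.commute)
  qed
  also have "ndet 6 ?K = det A ^ 3"
  proof -
    have "ndet 6 ?K = ndet 3 (sym_power 2 ?T) * ndet 3 (\<lambda>i k. (1 / det A) * sym_power 2 ?T i k)"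
      by (subst ndet_block2) auto
    also have "ndet 3 (\<lambda>i k. (1 / det A) * sym_power 2 ?T i k) = (1 / det A) ^ 3 * ndet 3 (sym_power 2 ?T)"
      by (rule ndet_scale)
    also have "ndet 3 (sym_power 2 ?T) = det A ^ 3"
      using ndet_sym_power[of ?T 2] d0 dT by simp
    finally show ?thesis using d0 by (simp add: power_divide)
  qed
  also have "ndet (Suc 6) (\<lambda>l j. sym_power 6 ?T j l) = det A ^ 21"
    using ndet_sym_power[of ?T 6] d0 dT ndet_transpose[of "Suc 6" "sym_power 6 ?T"] by simp
  moreover have "det A ^ 24 = det A ^ 3 * det A ^ 21" by (simp flip: power_add)
  ultimately show ?thesis by (simp only: mult_ac)
qed

text \<open>The functional of \<open>B\<close> vanishes on the degree 8 part of the Jacobian ideal of \<open>Q\<close>.\<close>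

definition related :: "cfun \<Rightarrow> cfun \<Rightarrow> bool" where
  "related Q B \<longleftrightarrow> (\<forall>i<8. apolar 8 (relation_form Q i) B = 0)"

lemma apolar_expand: "apolar d u B = (\<Sum>k<Suc d. cf d u k * apolar d (bmono d k) B)"
  by (simp add: apolar_def[of d u] apolar_bmono lessThan_Suc_atMost del: sum.lessThan_Suc)

lemma related_proportional:
  assumes B: "B \<in> forms 8" "related Q B" and j: "j \<le> 8"
  shows "apolar 8 (bmono 8 j) B * dual_form Q w
    = B w * border_cofactor 8 (\<lambda>i. cf 8 (relation_form Q i)) j"
proof -
  have "apolar 8 (bmono 8 j) B * dual_form Q w
    = (\<Sum>k<Suc 8. cf 8 (\<lambda>z. dotp w z ^ 8) k * apolar 8 (bmono 8 k) B) * border_cofactor 8 (\<lambda>i. cf 8 (relation_form Q i)) j"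
    unfolding dual_form_def
    by (rule bordered_cramer) (use B(2) j in \<open>simp_all only: apolar_expand[symmetric] related_def less_Suc_eq_le\<close>)
  also have "(\<Sum>k<Suc 8. cf 8 (\<lambda>z. dotp w z ^ 8) k * apolar 8 (bmono 8 k) B) = B w"
    by (simp only: apolar_expand[symmetric] apolar_dotp_power[OF B(1)])
  finally show ?thesis .
qed

lemma ndet_bordered_dup:
  assumes "i < n" shows "ndet (Suc n) (bordered n M (M i)) = 0"
proof (rule ccontr)
  assume n: "ndet (Suc n) (bordered n M (M i)) \<noteq> 0"
  have "(\<Sum>k<Suc n. (if k = i then 1 else if k = n then -1 else 0) * bordered n M (M i) k j) = 0" for j
  proof -
    have "(\<Sum>k<n. (if k = i then 1 else if k = n then -1 else 0) * bordered n M (M i) k j)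
      = (\<Sum>k<n. if k = i then M i j else 0)"
      by (rule sum.cong) (auto simp: bordered_def)
    then show ?thesis using assms by (simp add: bordered_def)
  qed
  from ndet_nonzero_rows_independent[OF n this, of i] assms show False by simp
qed

lemma dual_form_expand:
  "dual_form Q w = (\<Sum>j\<le>8. (of_nat (8 choose j) * border_cofactor 8 (\<lambda>i. cf 8 (relation_form Q i)) j) * bmono 8 j w)"
  unfolding dual_form_def ndet_bordered lessThan_Suc_atMost
  by (intro sum.cong refl) (simp add: cf_dotp_power)

lemma forms_dual_form [simp]: "dual_form Q \<in> forms 8"
  by (subst forms_iff, rule exI, rule allI, rule dual_form_expand)

lemma apolar_dual_form: "apolar 8 u (dual_form Q) = ndet (Suc 8) (bordered 8 (\<lambda>i. cf 8 (relation_form Q i)) (cf 8 u))"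
proof -
  have "cf 8 (dual_form Q) k = of_nat (8 choose k) * border_cofactor 8 (\<lambda>i. cf 8 (relation_form Q i)) k" if "k \<le> 8" for k
    by (rule cf_eqI[OF dual_form_expand that])
  then show ?thesis
    unfolding ndet_bordered apolar_def lessThan_Suc_atMost by (intro sum.cong refl) simp
qed

lemma related_dual_form: "related Q (dual_form Q)"
  unfolding related_def apolar_dual_form using ndet_bordered_dup[of _ 8 "\<lambda>i. cf 8 (relation_form Q i)"] by auto

lemma form_nonzero_apolar:
  assumes "B \<in> forms d" "B \<noteq> (\<lambda>_. 0)"
  obtains k where "k \<le> d" "apolar d (bmono d k) B \<noteq> 0"
proof -
  have "\<exists>k\<le>d. apolar d (bmono d k) B \<noteq> 0"
  proof (rule ccontr)
    assume "\<not> ?thesis"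
    then have "cf d B k = cf d (\<lambda>_. 0) k" if "k \<le> d" for k
      using that by (auto simp: apolar_bmono)
    then have "B = (\<lambda>_. 0)" by (intro form_eqI[OF assms(1)]) auto
    then show False using assms(2) by simp
  qed
  then show thesis using that by blast
qed

text \<open>Cramer's rule makes every solution proportional to the vector of maximal minors, unless all minors
  vanish.\<close>

lemma related_unique:
  assumes B: "B \<in> forms 8" "related Q B" "B \<noteq> (\<lambda>_. 0)" and w: "dual_form Q w \<noteq> 0"
  obtains c where "c \<noteq> 0" "B = (\<lambda>z. c * dual_form Q z)"
proof -
  let ?C = "border_cofactor 8 (\<lambda>i. cf 8 (relation_form Q i))"
  obtain j where j: "j \<le> 8" "apolar 8 (bmono 8 j) B \<noteq> 0" using form_nonzero_apolar[OF B(1,3)] .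
  have r: "apolar 8 (bmono 8 j) B * dual_form Q z = B z * ?C j" for z
    by (rule related_proportional[OF B(1,2) j(1)])
  have C: "?C j \<noteq> 0" using r[of w] w j(2) by auto
  have "B = (\<lambda>z. (apolar 8 (bmono 8 j) B / ?C j) * dual_form Q z)"
    using r C by (auto simp: field_simps)
  moreover have "apolar 8 (bmono 8 j) B / ?C j \<noteq> 0" using C j(2) by simp
  ultimately show thesis using that by blast
qed

lemma related_bracket:
  assumes B: "related Q B" and m: "m \<in> forms 4"
  shows "apolar 8 (bracket m Q) B = 0"
proof -
  have "bracket m Q = (\<lambda>z. \<Sum>k\<le>4. cf 4 m k * bracket (bmono 4 k) Q z)"
  proof
    fix z
    have "m = (\<lambda>z. \<Sum>k\<le>4. cf 4 m k * bmono 4 k z)" using form_expand[OF m] by auto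
    then have "bracket m Q z = bracket (\<lambda>z. \<Sum>k\<le>4. cf 4 m k * bmono 4 k z) Q z" by simp
    also have "\<dots> = (\<Sum>k\<le>4. cf 4 m k * bracket (bmono 4 k) Q z)" by (rule bracket_sum_left[of _ _ 4]) auto
    finally show "bracket m Q z = (\<Sum>k\<le>4. cf 4 m k * bracket (bmono 4 k) Q z)" .
  qed
  moreover have "apolar 8 (bracket (bmono 4 k) Q) B = 0" if "k \<le> 4" for k
  proof -
    have "k + 3 < 8" using that by simp
    then show ?thesis using B unfolding related_def by (auto simp: relation_form_def dest!: spec[of _ "k + 3"])
  qed
  ultimately show ?thesis by (simp add: apolar_sum_left apolar_scale_left)
qed

lemma related_mult:
  assumes B: "related Q B" and m: "m \<in> forms 2"
  shows "apolar 8 (\<lambda>z. m z * Q z) B = 0"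
proof -
  have "(\<lambda>z. m z * Q z) = (\<lambda>z. \<Sum>k\<le>2. cf 2 m k * (bmono 2 k z * Q z))"
    by (rule ext, subst form_expand[OF m]) (simp add: sum_distrib_right mult.assoc)
  moreover have "apolar 8 (\<lambda>z. bmono 2 k z * Q z) B = 0" if "k \<le> 2" for k
  proof -
    have "k < 3" "k < 8" using that by auto
    then have "apolar 8 (relation_form Q k) B = 0" using B unfolding related_def by blast
    then show ?thesis using \<open>k < 3\<close> by (simp add: relation_form_def)
  qed
  ultimately show ?thesis by (simp add: apolar_sum_left apolar_scale_left)
qed

lemma related_relation_op:
  assumes B: "related Q B" and i: "i < 6"
  shows "apolar 8 (relation_op t i Q) B = 0"
proof (cases "i < 3")
  case True
  then show ?thesis using related_mult[OF B, of "bmono 2 i"] by (simp add: relation_op_def)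
next
  case False
  then show ?thesis using related_bracket[OF B forms_dotp2_bmono, of "i - 3" t] i by (simp add: relation_op_def)
qed

text \<open>Since \<open>Q\<close> solves the six equations, Cramer's rule shows that \<open>reconstruct B t\<close> is a multiple of \<open>Q\<close>; the factor
  is found by evaluation at \<open>v0\<close> and depends on \<open>B\<close> and \<open>t\<close> only.\<close>

lemma reconstruct_factor:
  assumes Q: "Q \<in> forms 6" and B: "related Q B" and v0: "Q v0 \<noteq> 0"
  shows "reconstruct B t v * Q v0 = Q v * reconstruct B t v0"
proof -
  let ?M = "\<lambda>i j. apolar 8 (relation_op t i (bmono 6 j)) B"
  have Qv: "(\<Sum>k<Suc 6. bmono 6 k v * cf 6 Q k) = Q v" for v
    by (simp only: lessThan_Suc_atMost mult.commute[of "bmono 6 _ v"] form_expand[OF Q, symmetric])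
  have "Q \<noteq> (\<lambda>_. 0)" using v0 by auto
  then obtain j where j: "j \<le> 6" "cf 6 Q j \<noteq> 0"
    using form_eqI[OF Q forms_zero] by auto
  have "(\<Sum>k<Suc 6. ?M i k * cf 6 Q k) = 0" if i: "i < 6" for i
  proof -
    have "apolar 8 (relation_op t i Q) B = (\<Sum>k\<le>6. cf 6 Q k * apolar 8 (relation_op t i (bmono 6 k)) B)"
      by (rule linear_on_forms[where L = "\<lambda>u. apolar 8 (relation_op t i u) B", OF _ Q])
        (simp add: relation_op_linear apolar_add_left apolar_scale_left)
    then show ?thesis using related_relation_op[OF B i, of t]
      by (simp only: lessThan_Suc_atMost mult.commute)
  qed
  then have "cf 6 Q j * reconstruct B t v = Q v * border_cofactor 6 ?M j" for v
    unfolding reconstruct_def using bordered_cramer[of 6 ?M "cf 6 Q" j "\<lambda>j. bmono 6 j v"] j(1)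
    by (simp only: Qv less_Suc_eq_le)
  note c = this
  have "cf 6 Q j * (reconstruct B t v * Q v0) = (cf 6 Q j * reconstruct B t v) * Q v0" by simp
  also have "\<dots> = Q v * (cf 6 Q j * reconstruct B t v0)" unfolding c by simp
  finally have "cf 6 Q j * (reconstruct B t v * Q v0) = cf 6 Q j * (Q v * reconstruct B t v0)" by simp
  then show ?thesis using j(2) by simp
qed

subsection \<open>Polynomial dependence on the data\<close>

lemma function_algebra_bracket_left:
  assumes S: "function_algebra S" and F: "\<And>z. (\<lambda>x. F x z) \<in> S" "\<And>x. F x \<in> forms d"
  shows "(\<lambda>x. bracket (F x) q z) \<in> S"
  unfolding bracket_def partial_derivative_form[OF F(2)]
  by (intro function_algebra_diff[OF S] function_algebraD[OF S] function_algebra_sum[OF S]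
      function_algebra_cf[OF S] F)

lemma polynomials_on_dual_form: "(\<lambda>Q. dual_form Q w) \<in> polynomials_on (forms 6)"
  unfolding dual_form_def
proof (intro function_algebra_ndet[OF function_algebra_polynomials_on])
  fix i j :: nat assume "i < Suc 8"
  have "(\<lambda>Q. cf 8 (relation_form Q i) j) \<in> polynomials_on (forms 6)"
  proof (rule polynomials_on.linear)
    fix f g :: cfun and a b assume fg: "f \<in> forms 6" "g \<in> forms 6"
    have "relation_form (\<lambda>z. a * f z + b * g z) i = (\<lambda>z. a * relation_form f i z + b * relation_form g i z)"
      by (auto simp: relation_form_def bracket_linear_right[OF fg] fun_eq_iff algebra_simps)
    then show "cf 8 (relation_form (\<lambda>z. a * f z + b * g z) i) j
      = a * cf 8 (relation_form f i) j + b * cf 8 (relation_form g i) j"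
      by (simp add: cf_add cf_scale)
  qed
  then show "(\<lambda>Q. bordered 8 (\<lambda>i. cf 8 (relation_form Q i)) (cf 8 (\<lambda>z. dotp w z ^ 8)) i j) \<in> polynomials_on (forms 6)"
    by (cases "i < 8") (simp_all add: bordered_def polynomials_on.const)
qed

lemma function_algebra_reconstruct:
  assumes S: "function_algebra S" and F: "\<And>z. (\<lambda>x. F x z) \<in> S"
  shows "(\<lambda>x. reconstruct (F x) t v) \<in> S"
  unfolding reconstruct_def bordered_def
proof (intro function_algebra_ndet[OF S])
  fix i j :: nat
  show "(\<lambda>x. if i < 6 then apolar 8 (relation_op t i (bmono 6 j)) (F x) else bmono 6 j v) \<in> S"
    by (cases "i < 6") (simp_all add: function_algebra_apolar[OF S] F function_algebraD[OF S])
qed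

lemma forms_reconstruct [simp]: "reconstruct B t \<in> forms 6"
proof -
  have "reconstruct B t v = (\<Sum>j\<le>6. border_cofactor 6 (\<lambda>i j. apolar 8 (relation_op t i (bmono 6 j)) B) j * bmono 6 j v)" for v
    unfolding reconstruct_def ndet_bordered lessThan_Suc_atMost by (simp add: mult.commute)
  then show ?thesis by (subst forms_iff, intro exI allI)
qed

text \<open>The polynomial functions on the plane, as sums of forms.\<close>

inductive_set polys2 :: "cfun set" where
  form: "f \<in> forms d \<Longrightarrow> f \<in> polys2"
| add: "f \<in> polys2 \<Longrightarrow> g \<in> polys2 \<Longrightarrow> (\<lambda>t. f t + g t) \<in> polys2"

lemma function_algebra_polys2: "function_algebra polys2"
proof -
  have m1: "(\<lambda>t. f t * g t) \<in> polys2" if "f \<in> forms d" "g \<in> polys2" for f g d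
    using that(2)
  proof induction
    case (form g e)
    then show ?case using forms_mult[OF that(1)] polys2.form by blast
  next
    case (add g h)
    then show ?case using polys2.add by (simp add: distrib_left)
  qed
  have "(\<lambda>t. f t * g t) \<in> polys2" if "f \<in> polys2" "g \<in> polys2" for f g
    using that(1)
  proof induction
    case (form f d)
    then show ?case using m1 that(2) by blast
  next
    case (add f h)
    then show ?case using polys2.add by (simp add: distrib_right)
  qed
  then show ?thesis unfolding function_algebra_def
    using polys2.form[OF forms_const] polys2.add by blast
qed

lemma polys2_decompose:
  assumes "f \<in> polys2"
  shows "\<exists>N u. (\<forall>i. u i \<in> forms i) \<and> (\<forall>i\<ge>N. u i = (\<lambda>_. 0)) \<and> f = (\<lambda>t. \<Sum>i<N. u i t)"
  using assms
proof induction
  case (form f d)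
  have "f = (\<lambda>t. \<Sum>i<Suc d. (if i = d then f else (\<lambda>_. 0)) t)"
    by (auto simp: sum.neutral)
  then show ?case using form
    by (intro exI[of _ "Suc d"] exI[of _ "\<lambda>i. if i = d then f else (\<lambda>_. 0)"]) auto
next
  case (add f g)
  obtain N u where u: "\<And>i. u i \<in> forms i" "\<And>i. i \<ge> N \<Longrightarrow> u i = (\<lambda>_. 0)" "f = (\<lambda>t. \<Sum>i<N. u i t)"
    using add.IH(1) by blast
  obtain M v where v: "\<And>i. v i \<in> forms i" "\<And>i. i \<ge> M \<Longrightarrow> v i = (\<lambda>_. 0)" "g = (\<lambda>t. \<Sum>i<M. v i t)"
    using add.IH(2) by blast
  have "(\<Sum>i<N. u i t) = (\<Sum>i<N + M. u i t)" "(\<Sum>i<M. v i t) = (\<Sum>i<N + M. v i t)" for t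
    by (rule sum.mono_neutral_left; use u(2) v(2) in auto)+
  then have "(\<lambda>t. f t + g t) = (\<lambda>t. \<Sum>i<N + M. u i t + v i t)"
    by (simp add: u(3) v(3) sum.distrib)
  then show ?case using u v
    by (intro exI[of _ "N + M"] exI[of _ "\<lambda>i t. u i t + v i t"]) auto
qed

text \<open>Comparison of coefficients in the scaling parameter isolates the component of degree \<open>D\<close>.\<close>

lemma homogeneous_polys2:
  assumes f: "f \<in> polys2" and h: "\<And>c t. f (c *s t) = c ^ D * f t"
  shows "f \<in> forms D"
proof -
  obtain N u where u: "\<And>i. u i \<in> forms i" "\<And>i. i \<ge> N \<Longrightarrow> u i = (\<lambda>_. 0)" "f = (\<lambda>t. \<Sum>i<N. u i t)"
    using polys2_decompose[OF f] by blast
  have "f t = u D t" for t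
  proof -
    have "(\<Sum>i\<le>N + D. ((if i = D then f t else 0) - u i t) * c ^ i) = 0" for c
    proof -
      have "(\<Sum>i\<le>N + D. u i t * c ^ i) = (\<Sum>i<N. u i t * c ^ i)"
        by (rule sum.mono_neutral_right) (use u(2) in auto)
      also have "\<dots> = f (c *s t)" by (simp add: u(3) form_scale_arg[OF u(1)] mult.commute)
      also have "\<dots> = (\<Sum>i\<le>N + D. if i = D then f t * c ^ i else 0)" by (simp add: h mult.commute)
      also have "\<dots> = (\<Sum>i\<le>N + D. (if i = D then f t else 0) * c ^ i)" by (rule sum.cong) auto
      finally show ?thesis by (simp add: left_diff_distrib sum_subtractf)
    qed
    from sum_powers_eq_0_imp[OF this, of D] show ?thesis by simp
  qed
  then have "f = u D" by auto
  then show ?thesis using u(1) by simp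
qed

lemma ndet_row_scale: "ndet n (\<lambda>i j. r i * M i j) = (\<Prod>i<n. r i) * ndet n M"
proof -
  have "ndet n (\<lambda>i j. r i * M i j) = ndet n (\<lambda>i j. \<Sum>k<n. (if i = k then r i else 0) * M k j)"
  proof (rule ndet_cong)
    fix i j assume "i < n"
    then have "(\<Sum>k<n. (if i = k then r i else 0) * M k j) = (\<Sum>k<n. if k = i then r i * M i j else 0)"
      by (intro sum.cong) auto
    then show "r i * M i j = (\<Sum>k<n. (if i = k then r i else 0) * M k j)" using \<open>i < n\<close> by simp
  qed
  also have "\<dots> = ndet n (\<lambda>i k. if i = k then r i else 0) * ndet n M" by (rule ndet_mult)
  also have "ndet n (\<lambda>i k. if i = k then r i else 0) = (\<Prod>i<n. r i)"
    by (subst ndet_lower_triangular) auto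
  finally show ?thesis .
qed

text \<open>Only the three bracket equations involve \<open>t\<close>, each of them quadratically.\<close>

lemma reconstruct_scale_point: "reconstruct B (c *s t) v = c ^ 6 * reconstruct B t v"
proof -
  have r: "relation_op (c *s t) i u = (\<lambda>z. (if i < 3 then 1 else c ^ 2) * relation_op t i u z)" if "i < 6" for i u
  proof (cases "i < 3")
    case False
    have d: "(\<lambda>z. dotp (c *s t) z ^ 2 * bmono 2 (i - 3) z)
        = (\<lambda>z. c ^ 2 * (dotp t z ^ 2 * bmono 2 (i - 3) z) + 0 * (dotp t z ^ 2 * bmono 2 (i - 3) z))"
      by (auto simp: dotp_def algebra_simps power2_eq_square)
    have "(\<lambda>z. dotp t z ^ 2 * bmono 2 (i - 3) z) \<in> forms 4"
      using that by (intro forms_dotp2_bmono) simp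
    then show ?thesis using False unfolding relation_op_def d by (subst bracket_linear_left) auto
  qed (simp add: relation_op_def)
  have "reconstruct B (c *s t) v = ndet (Suc 6) (\<lambda>i j. (if i < 3 \<or> i = 6 then 1 else c ^ 2)
      * bordered 6 (\<lambda>i j. apolar 8 (relation_op t i (bmono 6 j)) B) (\<lambda>j. bmono 6 j v) i j)"
    unfolding reconstruct_def by (rule ndet_cong) (auto simp: bordered_def r apolar_scale_left)
  also have "\<dots> = (\<Prod>i<Suc 6. if i < 3 \<or> i = 6 then 1 else c ^ 2) * reconstruct B t v"
    unfolding reconstruct_def by (rule ndet_row_scale)
  also have "(\<Prod>i<Suc 6. if i < 3 \<or> i = 6 then 1 else c ^ 2) = c ^ 6"
    by (simp add: eval_nat_numeral)
  finally show ?thesis .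
qed

lemma reconstruct_polys2: "(\<lambda>t. reconstruct B t v) \<in> polys2"
  unfolding reconstruct_def bordered_def
proof (intro function_algebra_ndet[OF function_algebra_polys2])
  note S = function_algebra_polys2
  fix i j :: nat assume "i < Suc 6"
  have "(\<lambda>t. relation_op t i (bmono 6 j) z) \<in> polys2" if i: "i < 6" for z
  proof (cases "i < 3")
    case True
    then show ?thesis by (simp add: relation_op_def function_algebraD[OF S])
  next
    case False
    have "(\<lambda>t. dotp t z ^ 2 * bmono 2 (i - 3) z) \<in> polys2" for z
    proof -
      have "(\<lambda>t. dotp t z) \<in> polys2"
        using polys2.form[OF forms_linear[of "z $ 1" "z $ 2"]] by (simp add: dotp_def mult.commute)
      then show ?thesis by (intro function_algebraD[OF S] function_algebra_power[OF S])
    qed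
    then have "(\<lambda>t. bracket (\<lambda>z. dotp t z ^ 2 * bmono 2 (i - 3) z) (bmono 6 j) z) \<in> polys2"
      by (rule function_algebra_bracket_left[OF S, of _ 4]) (use i in \<open>auto intro: forms_dotp2_bmono\<close>)
    then show ?thesis using False by (simp add: relation_op_def)
  qed
  then show "(\<lambda>t. if i < 6 then apolar 8 (relation_op t i (bmono 6 j)) B else bmono 6 j v) \<in> polys2"
    by (cases "i < 6") (auto intro!: function_algebra_apolar[OF S] function_algebraD[OF S])
qed

subsection \<open>The Sylvester determinant of the partial derivatives\<close>

text \<open>Its rows are the multiples of the two partial derivatives by the quartic monomials. If it does not
  vanish, these ten forms are a basis of the forms of degree 9: the Jacobian ideal contains all forms
  of degree 9, and the partial derivatives have no relation with quartic coefficients.\<close>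

definition sylvester :: "cfun \<Rightarrow> complex" where
  "sylvester Q = ndet 10 (\<lambda>i. cf 9 (\<lambda>z. if i < 5 then bmono 4 i z * pd 1 Q z else bmono 4 (i - 5) z * pd 2 Q z))"

lemma polynomials_on_sylvester: "sylvester \<in> polynomials_on (forms 6)"
  unfolding sylvester_def[abs_def]
  by (intro function_algebra_ndet[OF function_algebra_polynomials_on] polynomials_on.linear)
    (auto simp: pd_linear cf_add[symmetric] cf_scale[symmetric] algebra_simps intro!: arg_cong2[of _ _ _ _ "cf 9"])

lemma sum_10_split: "(\<Sum>i<10. f i) = (\<Sum>i\<le>4. f i) + (\<Sum>i\<le>4. f (i + 5))" for f :: "nat \<Rightarrow> complex"
  by (simp add: eval_nat_numeral)

lemma sylvester_span:
  assumes Q: "Q \<in> forms 6" and s: "sylvester Q \<noteq> 0" and u: "u \<in> forms 9"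
  obtains a c where "a \<in> forms 4" "c \<in> forms 4" "u = (\<lambda>z. a z * pd 1 Q z + c z * pd 2 Q z)"
proof -
  let ?R = "\<lambda>i z. if i < 5 then bmono 4 i z * pd 1 Q z else bmono 4 (i - 5) z * pd 2 Q z"
  obtain x where x: "\<And>j. j < 10 \<Longrightarrow> (\<Sum>i<10. x i * cf 9 (?R i) j) = cf 9 u j"
    using ndet_nonzero_rows_span[OF s[unfolded sylvester_def], of "cf 9 u"] by blast
  define a where "a = (\<lambda>z. \<Sum>i\<le>4. x i * bmono 4 i z)"
  define c where "c = (\<lambda>z. \<Sum>i\<le>4. x (i + 5) * bmono 4 i z)"
  have ac: "a \<in> forms 4" "c \<in> forms 4" unfolding a_def c_def by (rule forms_sum_mono)+
  have pdF: "pd i Q \<in> forms 5" for i using forms_pd[OF Q] by simp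
  have e: "(\<lambda>z. \<Sum>i<10. x i * ?R i z) = (\<lambda>z. a z * pd 1 Q z + c z * pd 2 Q z)"
    unfolding sum_10_split a_def c_def by (rule ext) (simp add: sum_distrib_right mult.assoc)
  have "u = (\<lambda>z. a z * pd 1 Q z + c z * pd 2 Q z)"
  proof (rule form_eqI[OF u])
    show "(\<lambda>z. a z * pd 1 Q z + c z * pd 2 Q z) \<in> forms 9"
      using forms_add[OF forms_mult[OF ac(1) pdF[of 1]] forms_mult[OF ac(2) pdF[of 2]]] by simp
      show "cf 9 u k = cf 9 (\<lambda>z. a z * pd 1 Q z + c z * pd 2 Q z) k" if "k \<le> 9" for k
      using x[of k] that unfolding e[symmetric] by (simp only: cf_sum cf_scale)
  qed
  then show thesis using that ac by blast
qed

lemma sylvester_inj: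
  assumes Q: "Q \<in> forms 6" and s: "sylvester Q \<noteq> 0" and ac: "a \<in> forms 4" "c \<in> forms 4"
    and eq: "\<And>z. a z * pd 1 Q z + c z * pd 2 Q z = 0"
  shows "a = (\<lambda>_. 0)" "c = (\<lambda>_. 0)"
proof -
  let ?R = "\<lambda>i z. if i < 5 then bmono 4 i z * pd 1 Q z else bmono 4 (i - 5) z * pd 2 Q z"
  define x where "x i = (if i < 5 then cf 4 a i else cf 4 c (i - 5))" for i
  have e: "(\<lambda>z. \<Sum>i<10. x i * ?R i z) = (\<lambda>z. 0)"
  proof
    fix z
    have "(\<Sum>i<10. x i * ?R i z) = (\<Sum>i\<le>4. cf 4 a i * bmono 4 i z) * pd 1 Q z + (\<Sum>i\<le>4. cf 4 c i * bmono 4 i z) * pd 2 Q z"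
      unfolding sum_10_split by (simp add: x_def sum_distrib_right mult.assoc)
    then show "(\<Sum>i<10. x i * ?R i z) = 0"
      using eq[of z] by (simp only: form_expand[OF ac(1), symmetric] form_expand[OF ac(2), symmetric])
  qed
  have "(\<Sum>i<10. x i * cf 9 (?R i) j) = 0" for j
    using arg_cong[OF e, of "\<lambda>f. cf 9 f j"] by (simp only: cf_sum cf_scale cf_zero)
  then have x: "x i = 0" if "i < 10" for i
    using ndet_nonzero_rows_independent[OF s[unfolded sylvester_def], of x i] that by blast
  show "a = (\<lambda>_. 0)"
  proof (rule form_eqI[OF ac(1)])
    show "cf 4 a k = cf 4 (\<lambda>_. 0) k" if "k \<le> 4" for k using x[of k] that by (simp add: x_def)
  qed auto
  show "c = (\<lambda>_. 0)"
  proof (rule form_eqI[OF ac(2)])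
    show "cf 4 c k = cf 4 (\<lambda>_. 0) k" if "k \<le> 4" for k using x[of "k + 5"] that by (simp add: x_def)
  qed auto
qed

section \<open>The octahedral sextic\<close>

text \<open>The symmetry of this sextic under the octahedral group leaves few nonzero coefficients in the systems
  of equations below, which can therefore be solved by hand.\<close>

definition octa :: cfun where "octa z = bmono 6 5 z - bmono 6 1 z"

lemma octa_eq: "octa = (\<lambda>z. 1 * bmono 6 5 z + (-1) * bmono 6 1 z)"
  by (simp add: octa_def fun_eq_iff)

lemma forms_octa [simp]: "octa \<in> forms 6"
  unfolding octa_eq by (intro forms_add forms_scale forms_mono) auto

lemma sum_cf_two:
  assumes "k \<le> d" "l \<le> d"
  shows "(\<Sum>j<Suc d. cf d (\<lambda>z. a * bmono d k z + b * bmono d l z) j * x j) = a * x k + b * x l"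
proof -
  have "(\<Sum>j<Suc d. cf d (\<lambda>z. a * bmono d k z + b * bmono d l z) j * x j)
    = (\<Sum>j<Suc d. (if j = k then a * x k else 0) + (if j = l then b * x l else 0))"
    by (rule sum.cong) (use assms in \<open>auto simp: cf_add cf_scale cf_mono less_Suc_eq_le distrib_right\<close>)
  also have "\<dots> = a * x k + b * x l"
    using assms by (simp add: sum.distrib less_Suc_eq_le distrib_right del: sum.lessThan_Suc)
  finally show ?thesis .
qed

lemma apolar_two:
  "apolar d (\<lambda>z. a * bmono d k z + b * bmono d l z) B = a * apolar d (bmono d k) B + b * apolar d (bmono d l) B"
  by (simp add: apolar_add_left apolar_scale_left)

lemma pd_octa:
  "pd 1 octa z = 5 * bmono 5 4 z - bmono 5 0 z"
  "pd 2 octa z = bmono 5 5 z - 5 * bmono 5 1 z"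
  unfolding octa_eq by (subst pd_linear[of _ 6]; simp add: pd_bmono)+

lemma all_less_10: "(\<forall>j<10. P j) \<longleftrightarrow> P 0 \<and> P 1 \<and> P 2 \<and> P 3 \<and> P 4 \<and> P 5 \<and> P 6 \<and> P 7 \<and> P 8 \<and> P (9::nat)"
  by (auto simp: eval_nat_numeral All_less_Suc)

lemma sylvester_octa: "sylvester octa \<noteq> 0"
  unfolding sylvester_def
proof (rule ndet_nonzeroI)
  fix x :: "nat \<Rightarrow> complex"
  let ?R = "\<lambda>i z. if i < 5 then bmono 4 i z * pd 1 octa z else bmono 4 (i - 5) z * pd 2 octa z"
  assume x: "\<And>i. i < 10 \<Longrightarrow> (\<Sum>j<10. cf 9 (?R i) j * x j) = 0"
  have 1: "5 * x (i + 4) + (-1) * x i = 0" if i: "i \<le> 4" for i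
  proof -
    have "?R i = (\<lambda>z. 5 * bmono 9 (i + 4) z + (-1) * bmono 9 i z)"
      using i bmono_mult[of i 4 4 5] bmono_mult[of i 4 0 5] by (auto simp: pd_octa algebra_simps)
    then show ?thesis using x[of i] i sum_cf_two[of "i + 4" 9 i 5 "-1" x] by simp
  qed
  have 2: "1 * x (i + 5) + (-5) * x (i + 1) = 0" if i: "i \<le> 4" for i
  proof -
    have "?R (i + 5) = (\<lambda>z. 1 * bmono 9 (i + 5) z + (-5) * bmono 9 (i + 1) z)"
      using i bmono_mult[of i 4 5 5] bmono_mult[of i 4 1 5] by (auto simp: pd_octa algebra_simps)
    then show ?thesis using x[of "i + 5"] i sum_cf_two[of "i + 5" 9 "i + 1" 1 "-5" x] by simp
  qed
  have e: "x 0 = 5 * x 4" "x 1 = 5 * x 5" "x 2 = 5 * x 6" "x 3 = 5 * x 7" "x 4 = 5 * x 8"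
    "x 5 = 5 * x 1" "x 6 = 5 * x 2" "x 7 = 5 * x 3" "x 8 = 5 * x 4" "x 9 = 5 * x 5"
    using 1[of 0] 1[of 1] 1[of 2] 1[of 3] 1[of 4] 2[of 0] 2[of 1] 2[of 2] 2[of 3] 2[of 4] by (simp_all add: numeral_2_eq_2[symmetric])
  have z: "a = 0" if "a = 5 * b" "b = 5 * a" for a b :: complex
  proof -
    have "a = 25 * a" using that by simp
    then show ?thesis by simp
  qed
  have A: "x 1 = 0" "x 2 = 0" "x 3 = 0" "x 4 = 0"
    using z[OF e(2) e(6)] z[OF e(3) e(7)] z[OF e(4) e(8)] z[OF e(5) e(9)] by blast+
  have B: "x 0 = 0" "x 5 = 0" "x 6 = 0" "x 7 = 0" "x 8 = 0"
    unfolding e(1) e(6) e(7) e(8) e(9) A by simp_all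
  have "x 9 = 0" unfolding e(10) B by simp
  with A B show "\<forall>j<10. x j = 0" unfolding all_less_10 by blast
qed

lemma relation_form_octa:
  "i \<le> 2 \<Longrightarrow> relation_form octa i = (\<lambda>z. 1 * bmono 8 (i + 5) z + (-1) * bmono 8 (i + 1) z)"
  "a \<le> 4 \<Longrightarrow> relation_form octa (a + 3)
    = (\<lambda>z. (6 * of_nat a - 20) * bmono 8 (a + 4) z + (4 - 6 * of_nat a) * bmono 8 a z)"
proof -
  show "relation_form octa i = (\<lambda>z. 1 * bmono 8 (i + 5) z + (-1) * bmono 8 (i + 1) z)" if "i \<le> 2"
    using that bmono_mult[of i 2 5 6] bmono_mult[of i 2 1 6] 
    by (auto simp: relation_form_def octa_def algebra_simps)
  show "relation_form octa (a + 3)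
    = (\<lambda>z. (6 * of_nat a - 20) * bmono 8 (a + 4) z + (4 - 6 * of_nat a) * bmono 8 a z)" if "a \<le> 4"
    using that unfolding octa_eq relation_form_def
    by (subst bracket_linear_right[of _ 6]) (auto simp: bracket_bmono fun_eq_iff algebra_simps)
qed

text \<open>Here \<open>x k\<close> is the value of the unknown functional on the octic monomial with index \<open>k\<close>. The solution is
  the octahedral octic.\<close>

lemma octa_relations_solution:
  fixes x :: "nat \<Rightarrow> complex"
  assumes 1: "\<And>i. i \<le> 2 \<Longrightarrow> 1 * x (i + 5) + (-1) * x (i + 1) = 0"
    and 2: "\<And>a. a \<le> 4 \<Longrightarrow> (6 * of_nat a - 20) * x (a + 4) + (4 - 6 * of_nat a) * x a = 0"
  shows "x 0 = 5 * x 4" "x 1 = 0" "x 2 = 0" "x 3 = 0" "x 5 = 0" "x 6 = 0" "x 7 = 0" "x 8 = 5 * x 4"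
proof -
  have e: "x 5 = x 1" "x 6 = x 2" "x 7 = x 3"
    using 1[of 0] 1[of 1] 1[of 2] by (simp_all add: numeral_2_eq_2[symmetric])
  have f: "4 * x 0 = 20 * x 4" "- 14 * x 5 - 2 * x 1 = 0" "- 8 * x 6 - 8 * x 2 = 0"
    "- 2 * x 7 - 14 * x 3 = 0" "4 * x 8 = 20 * x 4"
    using 2[of 0] 2[of 1] 2[of 2] 2[of 3] 2[of 4] by (simp_all add: eq_neg_iff_add_eq_0)
  have "4 * x 0 = 4 * (5 * x 4)" "4 * x 8 = 4 * (5 * x 4)" using f by simp_all
  then show "x 0 = 5 * x 4" "x 8 = 5 * x 4" by (simp_all only: mult_cancel_left) simp_all
  have "- 16 * x 1 = 0" "- 16 * x 2 = 0" "- 16 * x 3 = 0"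
    using f(2-4) unfolding e by (simp_all add: algebra_simps)
  then show "x 1 = 0" "x 2 = 0" "x 3 = 0" "x 5 = 0" "x 6 = 0" "x 7 = 0" using e by simp_all
qed

lemma all_less_9: "(\<forall>j<Suc 8. P j) \<longleftrightarrow> P 0 \<and> P 1 \<and> P 2 \<and> P 3 \<and> P 4 \<and> P 5 \<and> P 6 \<and> P 7 \<and> P (8::nat)"
  by (auto simp: eval_nat_numeral All_less_Suc)

text \<open>A functional that solves the eight relations of the octahedral sextic and vanishes on the eighth power
  of the first coordinate is zero.\<close>

lemma dual_form_octa: "dual_form octa (mk2 1 0) \<noteq> 0"
  unfolding dual_form_def
proof (rule ndet_nonzeroI)
  fix x :: "nat \<Rightarrow> complex"
  let ?M = "bordered 8 (\<lambda>i. cf 8 (relation_form octa i)) (cf 8 (\<lambda>z. dotp (mk2 1 0) z ^ 8))"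
  assume x: "\<And>i. i < Suc 8 \<Longrightarrow> (\<Sum>j<Suc 8. ?M i j * x j) = 0"
  have r: "(\<Sum>j<Suc 8. cf 8 (relation_form octa i) j * x j) = 0" if "i < 8" for i
    using x[of i] that by (simp add: bordered_def del: sum.lessThan_Suc)
  have 1: "1 * x (i + 5) + (-1) * x (i + 1) = 0" if i: "i \<le> 2" for i
    using r[of i] that sum_cf_two[of "i + 5" 8 "i + 1" 1 "-1" x]
    by (simp add: relation_form_octa(1) del: sum.lessThan_Suc)
  have 2: "(6 * of_nat a - 20) * x (a + 4) + (4 - 6 * of_nat a) * x a = 0" if a: "a \<le> 4" for a
    using r[of "a + 3"] that sum_cf_two[of "a + 4" 8 a "6 * of_nat a - 20" "4 - 6 * of_nat a" x]
    by (simp add: relation_form_octa(2) del: sum.lessThan_Suc)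
  note s = octa_relations_solution[of x, OF 1 2]
  have "(\<lambda>z. dotp (mk2 1 0) z ^ 8) = (\<lambda>z. 1 * bmono 8 8 z + 0 * bmono 8 8 z)"
    by (simp add: dotp_def bmono_def)
  then have "x 8 = 0" using x[of 8] sum_cf_two[of 8 8 8 1 0 x]
    by (simp add: bordered_def del: sum.lessThan_Suc)
  then show "\<forall>j<Suc 8. x j = 0" using s unfolding all_less_9 by simp
qed

lemma apolar_dual_form_octa:
  obtains s where "s \<noteq> 0" "\<And>k. k \<le> 8 \<Longrightarrow>
    apolar 8 (bmono 8 k) (dual_form octa) = (if k = 0 \<or> k = 8 then 5 * s else if k = 4 then s else 0)"
proof -
  define x where "x k = apolar 8 (bmono 8 k) (dual_form octa)" for k
  have r: "apolar 8 (relation_form octa i) (dual_form octa) = 0" if "i < 8" for i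
    using related_dual_form that unfolding related_def by blast
  have 1: "1 * x (i + 5) + (-1) * x (i + 1) = 0" if i: "i \<le> 2" for i
    using r[of i] that unfolding x_def relation_form_octa(1)[OF i] apolar_two by simp
  have 2: "(6 * of_nat a - 20) * x (a + 4) + (4 - 6 * of_nat a) * x a = 0" if a: "a \<le> 4" for a
    using r[of "a + 3"] that unfolding x_def relation_form_octa(2)[OF a] apolar_two by simp
  note s = octa_relations_solution[of x, OF 1 2]
  have "x 8 \<noteq> 0"
  proof -
    have "bmono 8 8 = (\<lambda>z. dotp (mk2 1 0) z ^ 8)" by (auto simp: dotp_def bmono_def)
    then have "x 8 = dual_form octa (mk2 1 0)" unfolding x_def by (simp add: apolar_dotp_power)
    then show ?thesis using dual_form_octa by simp
  qed
  then have x4: "x 4 \<noteq> 0" using s by auto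
  have x: "\<forall>k<Suc 8. x k = (if k = 0 \<or> k = 8 then 5 * x 4 else if k = 4 then x 4 else 0)"
    unfolding all_less_9 using s by simp
  show thesis
  proof (rule that[OF x4])
    fix k :: nat assume "k \<le> 8"
    then have "k < Suc 8" by simp
    from x[rule_format, OF this]
    show "apolar 8 (bmono 8 k) (dual_form octa) = (if k = 0 \<or> k = 8 then 5 * x 4 else if k = 4 then x 4 else 0)"
      by (simp only: x_def[of k])
  qed
qed

lemma ndet_laplace:
  "ndet (Suc n) M = (\<Sum>j<Suc n. (-1) ^ (n + j) * M n j * ndet n (\<lambda>i k. M i (if k < j then k else Suc k)))"
proof -
  let ?A = "Matrix.mat (Suc n) (Suc n) (\<lambda>(i, j). M i j)"
  have "ndet (Suc n) M = (\<Sum>j<Suc n. ?A $$ (n, j) * Determinant.cofactor ?A n j)"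
    unfolding ndet_def by (rule laplace_expansion_row) auto
  also have "\<dots> = (\<Sum>j<Suc n. (-1) ^ (n + j) * M n j * ndet n (\<lambda>i k. M i (if k < j then k else Suc k)))"
  proof (intro sum.cong refl)
    fix j assume j: "j \<in> {..<Suc n}"
    have "mat_delete ?A n j = Matrix.mat n n (\<lambda>(i, k). M i (if k < j then k else Suc k))"
      using j by (intro eq_matI) (auto simp: mat_delete_def)
    then show "?A $$ (n, j) * Determinant.cofactor ?A n j
      = (-1) ^ (n + j) * M n j * ndet n (\<lambda>i k. M i (if k < j then k else Suc k))"
      using j by (simp add: Determinant.cofactor_def ndet_def)
  qed
  finally show ?thesis .
qed

lemma ndet_0: "ndet 0 M = 1"
  by (simp add: ndet_def)

lemma ndet_3: "ndet 3 M = M 0 0 * (M 1 1 * M 2 2 - M 1 2 * M 2 1)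
    - M 0 1 * (M 1 0 * M 2 2 - M 1 2 * M 2 0) + M 0 2 * (M 1 0 * M 2 1 - M 1 1 * M 2 0)"
proof -
  have "ndet 3 M = ndet (Suc (Suc (Suc 0))) M" by (simp add: numeral_3_eq_3)
  also have "\<dots> = M 0 0 * (M 1 1 * M 2 2 - M 1 2 * M 2 1)
    - M 0 1 * (M 1 0 * M 2 2 - M 1 2 * M 2 0) + M 0 2 * (M 1 0 * M 2 1 - M 1 1 * M 2 0)"
    by (simp add: ndet_laplace ndet_0 numeral_2_eq_2 algebra_simps)
  finally show ?thesis .
qed

lemma all_less_7: "(\<forall>j<Suc 6. P j) \<longleftrightarrow> P 0 \<and> P 1 \<and> P 2 \<and> P 3 \<and> P 4 \<and> P 5 \<and> P (6::nat)"
  by (auto simp: eval_nat_numeral All_less_Suc)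

lemma sum_7: "(\<Sum>j<Suc 6. f j) = f 0 + f 1 + f 2 + f 3 + f 4 + f 5 + f 6" for f :: "nat \<Rightarrow> complex"
  by (simp add: eval_nat_numeral)

lemma relation_op_expand:
  assumes u: "u \<in> forms 6" and m: "m \<le> 2"
  shows "relation_op t (m + 3) u = (\<lambda>z. (t $ 1)^2 * bracket (bmono 4 (m + 2)) u z
    + (2 * t $ 1 * t $ 2 * bracket (bmono 4 (m + 1)) u z + (t $ 2)^2 * bracket (bmono 4 m) u z))"
proof -
  have F: "bmono 4 (m + 2) \<in> forms 4" "bmono 4 (m + 1) \<in> forms 4" "bmono 4 m \<in> forms 4"
    using m by auto
  have "dotp t z ^ 2 * bmono 2 m z = (t $ 1)^2 * bmono 4 (m + 2) z
      + 1 * (2 * t $ 1 * t $ 2 * bmono 4 (m + 1) z + (t $ 2)^2 * bmono 4 m z)" for z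
  proof -
    have "bmono 2 2 z * bmono 2 m z = bmono 4 (m + 2) z" "bmono 2 1 z * bmono 2 m z = bmono 4 (m + 1) z"
      "bmono 2 0 z * bmono 2 m z = bmono 4 m z"
      using m by (simp_all add: bmono_mult add.commute)
    moreover have "dotp t z ^ 2 = (t $ 1)^2 * bmono 2 2 z + 2 * t $ 1 * t $ 2 * bmono 2 1 z + (t $ 2)^2 * bmono 2 0 z"
      by (simp add: dotp_def bmono_def power2_eq_square algebra_simps)
    ultimately show ?thesis by (simp add: distrib_right mult.assoc)
  qed
  then have "relation_op t (m + 3) u = bracket (\<lambda>z. (t $ 1)^2 * bmono 4 (m + 2) z
      + 1 * (2 * t $ 1 * t $ 2 * bmono 4 (m + 1) z + (t $ 2)^2 * bmono 4 m z)) u"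
    by (simp add: relation_op_def)
  also have "\<dots> = (\<lambda>z. (t $ 1)^2 * bracket (bmono 4 (m + 2)) u z
    + 1 * bracket (\<lambda>z. 2 * t $ 1 * t $ 2 * bmono 4 (m + 1) z + (t $ 2)^2 * bmono 4 m z) u z)"
    by (rule bracket_linear_left[OF F(1)]) (intro forms_add forms_scale F)
  also have "bracket (\<lambda>z. 2 * t $ 1 * t $ 2 * bmono 4 (m + 1) z + (t $ 2)^2 * bmono 4 m z) u
    = (\<lambda>z. 2 * t $ 1 * t $ 2 * bracket (bmono 4 (m + 1)) u z + (t $ 2)^2 * bracket (bmono 4 m) u z)"
    by (rule bracket_linear_left[OF F(2,3)])
  finally show ?thesis by simp
qed

text \<open>For the dual form of the octahedral sextic the equation given by the quartic \<open>x^2 y^2\<close> is void, and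
  those given by \<open>x^4\<close> and \<open>y^4\<close> are opposite to each other. The equations that involve \<open>t\<close> are thus
  combinations of the three equations given by \<open>x^4\<close>, \<open>x^3 y\<close> and \<open>x y^3\<close>, and the determinant of the
  matrix of these combinations is a multiple of \<open>octa t\<close>.\<close>

lemma reconstruct_octa:
  obtains c where "c \<noteq> 0" "\<And>t. reconstruct (dual_form octa) t (mk2 2 1) = c * octa t"
proof -
  let ?B = "dual_form octa" and ?v = "mk2 2 1"
  obtain s where s: "s \<noteq> 0" "\<And>k. k \<le> 8 \<Longrightarrow>
    apolar 8 (bmono 8 k) ?B = (if k = 0 \<or> k = 8 then 5 * s else if k = 4 then s else 0)"
    using apolar_dual_form_octa by blast
  have h: "apolar 8 (bmono 8 0) ?B = 5 * s" "apolar 8 (bmono 8 (Suc 0)) ?B = 0" "apolar 8 (bmono 8 2) ?B = 0"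
    "apolar 8 (bmono 8 3) ?B = 0" "apolar 8 (bmono 8 4) ?B = s" "apolar 8 (bmono 8 5) ?B = 0"
    "apolar 8 (bmono 8 6) ?B = 0" "apolar 8 (bmono 8 7) ?B = 0" "apolar 8 (bmono 8 8) ?B = 5 * s"
    using s(2) by simp_all
  define e where "e a j = apolar 8 (bracket (bmono 4 a) (bmono 6 j)) ?B" for a j
  have e: "e a j = (6 * of_nat a - 4 * of_nat j) * apolar 8 (bmono 8 (a + j - 1)) ?B" if "a \<le> 4" "j \<le> 6" for a j
    using that unfolding e_def by (simp add: bracket_bmono apolar_scale_left)
  define M where "M i j = (if i < 3 then apolar 8 (\<lambda>z. bmono 2 i z * bmono 6 j z) ?B
      else if i = 3 then e 4 j else if i = 4 then e 3 j else e 1 j)" for i j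
  have M3: "M i j = apolar 8 (bmono 8 (i + j)) ?B" if "i < 3" "j \<le> 6" for i j
    using that unfolding M_def by (simp add: bmono_mult cong: if_cong)
  have e2: "e 2 j = 0" if "j \<le> 6" for j
  proof -
    have "\<forall>j<Suc 6. e 2 j = 0" unfolding all_less_7 by (simp add: e h)
    then show ?thesis using that by (simp add: less_Suc_eq_le)
  qed
  have e0: "e 0 j = - e 4 j" if "j \<le> 6" for j
  proof -
    have "\<forall>j<Suc 6. e 0 j = - e 4 j" unfolding all_less_7 by (simp add: e h)
    then show ?thesis using that by (simp add: less_Suc_eq_le)
  qed
  \<comment> \<open>The three equations with \<open>t\<close> in terms of those given by \<open>x^4\<close>, \<open>x^3 y\<close> and \<open>x y^3\<close>, in this order.\<close>
  let ?T = "\<lambda>t (i::nat) (k::nat). if i = 0 then (if k = 0 then - ((t $ 2)^2) else if k = 1 then 0 else 2 * t $ 1 * t $ 2)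
     else if i = 1 then (if k = 0 then 0 else if k = 1 then (t $ 1)^2 else (t $ 2)^2)
     else (if k = 0 then (t $ 1)^2 else if k = 1 then 2 * t $ 1 * t $ 2 else (0::complex))"
  let ?K = "\<lambda>t i k. if i < 3 \<and> k < 3 then (if i = k then 1 else 0)
      else if 3 \<le> i \<and> 3 \<le> k then ?T t (i - 3) (k - 3) else (0::complex)"
  let ?c = "ndet (Suc 6) (bordered 6 M (\<lambda>j. bmono 6 j ?v))"
  have r: "reconstruct ?B t ?v = - 2 * ?c * octa t" for t
  proof -
    have "reconstruct ?B t ?v = ndet 6 (?K t) * ?c * ndet (Suc 6) (\<lambda>i j. if i = j then 1 else 0)"
      unfolding reconstruct_def
    proof (rule ndet_bordered_covariant)
      fix i j :: nat assume ij: "i < 6" "j \<le> 6"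
      have id: "(\<Sum>l\<le>6. f l * (if l = j then 1 else 0)) = f j" for f :: "nat \<Rightarrow> complex"
      proof -
        have "(\<Sum>l\<le>6. f l * (if l = j then 1 else 0)) = (\<Sum>l\<le>6. if l = j then f j else 0)"
          by (rule sum.cong) auto
        then show ?thesis using ij by simp
      qed
      have K: "(\<Sum>k<6. ?K t i k * M k j) = (if i < 3 then M i j
          else ?T t (i - 3) 0 * e 4 j + ?T t (i - 3) 1 * e 3 j + ?T t (i - 3) 2 * e 1 j)"
      proof -
        have "(\<Sum>k<6. f k) = f 0 + f 1 + f 2 + f 3 + f 4 + f 5" for f :: "nat \<Rightarrow> complex"
          by (simp add: eval_nat_numeral)
        then show ?thesis using ij by (auto simp: M_def numeral_2_eq_2 less_Suc_eq numeral_3_eq_3)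
      qed
      show "apolar 8 (relation_op t i (bmono 6 j)) ?B = (\<Sum>k<6. ?K t i k * (\<Sum>l\<le>6. M k l * (if l = j then 1 else 0)))"
      proof (cases "i < 3")
        case True
        then show ?thesis unfolding id K by (simp add: relation_op_def M_def)
      next
        case False
        obtain m where m: "i = m + 3" "m \<le> 2"
          using False ij by (intro that[of "i - 3"]) auto
        have "apolar 8 (relation_op t i (bmono 6 j)) ?B
          = (t $ 1)^2 * e (m + 2) j + (2 * t $ 1 * t $ 2 * e (m + 1) j + (t $ 2)^2 * e m j)"
          unfolding m(1) e_def by (subst relation_op_expand) (use m ij in \<open>simp_all add: apolar_add_left apolar_scale_left\<close>)
        moreover have "m = 0 \<or> m = 1 \<or> m = 2" using m by auto
        ultimately show ?thesis unfolding id K using ij m(1) e0 e2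
          by (auto simp: numeral_2_eq_2[symmetric])
      qed
    qed (auto simp: if_distrib[of "\<lambda>x. _ * x"] cong: if_cong)
    also have "ndet (Suc 6) (\<lambda>i j. if i = j then 1 else 0) = 1"
      by (subst ndet_lower_triangular) auto
    also have "ndet 6 (?K t) = ndet 3 (\<lambda>i k. if i = k then 1 else 0) * ndet 3 (?T t)"
      by (subst ndet_block2) auto
    also have "ndet 3 (\<lambda>i k. if i = k then 1 else (0::complex)) = 1"
      by (subst ndet_lower_triangular) auto
    also have "ndet 3 (?T t) = - 2 * octa t"
      unfolding ndet_3 by (simp add: octa_def bmono_def) (simp add: eval_nat_numeral algebra_simps)
    finally show ?thesis by (simp add: mult_ac)
  qed
  have "?c \<noteq> 0"
  proof (rule ndet_nonzeroI)
    fix q :: "nat \<Rightarrow> complex"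
    assume q: "\<And>i. i < Suc 6 \<Longrightarrow> (\<Sum>j<Suc 6. bordered 6 M (\<lambda>j. bmono 6 j ?v) i j * q j) = 0"
    have "5 * s * q 0 + s * q 4 = 0" "s * q 3 = 0" "s * q 2 + 5 * s * q 6 = 0"
      using q[of 0] q[of 1] q[of 2] unfolding sum_7 by (simp_all add: bordered_def M3 h numeral_2_eq_2[symmetric] numeral_3_eq_3[symmetric])
    moreover have "20 * s * q 1 + 20 * s * q 5 = 0" "10 * s * q 2 - 30 * s * q 6 = 0" "30 * s * q 0 - 10 * s * q 4 = 0"
      using q[of 3] q[of 4] q[of 5] unfolding sum_7 by (simp_all add: bordered_def M_def e h algebra_simps numeral_2_eq_2[symmetric] numeral_3_eq_3[symmetric])
    moreover have "q 0 + 2 * q 1 + 4 * q 2 + 8 * q 3 + 16 * q 4 + 32 * q 5 + 64 * q 6 = 0"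
      using q[of 6] unfolding sum_7 by (simp add: bordered_def bmono_def)
    moreover have "s * (5 * q 0 + q 4) = 0 \<Longrightarrow> 5 * q 0 + q 4 = 0" "s * (q 2 + 5 * q 6) = 0 \<Longrightarrow> q 2 + 5 * q 6 = 0"
      "(20 * s) * (q 1 + q 5) = 0 \<Longrightarrow> q 1 + q 5 = 0" "(10 * s) * (q 2 - 3 * q 6) = 0 \<Longrightarrow> q 2 - 3 * q 6 = 0"
      "(10 * s) * (3 * q 0 - q 4) = 0 \<Longrightarrow> 3 * q 0 - q 4 = 0"
      using s(1) by simp_all
    ultimately have f: "5 * q 0 + q 4 = 0" "q 3 = 0" "q 2 + 5 * q 6 = 0" "q 1 + q 5 = 0" "q 2 - 3 * q 6 = 0" "3 * q 0 - q 4 = 0"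
      and g: "q 0 + 2 * q 1 + 4 * q 2 + 8 * q 3 + 16 * q 4 + 32 * q 5 + 64 * q 6 = 0"
      using s(1) by (simp_all add: algebra_simps)
    have "8 * q 0 = (5 * q 0 + q 4) + (3 * q 0 - q 4)" "8 * q 6 = (q 2 + 5 * q 6) - (q 2 - 3 * q 6)" by simp_all
    then have 06: "q 0 = 0" "q 6 = 0" using f by simp_all
    then have 24: "q 2 = 0" "q 4 = 0" using f by simp_all
    have "q 1 = - q 5" using f(4) by (simp add: eq_neg_iff_add_eq_0)
    then have "q 5 = 0" "q 1 = 0" using g 06 24 f(2) by simp_all
    then show "\<forall>j<Suc 6. q j = 0" unfolding all_less_7 using 06 24 f(2) by simp
  qed
  then show thesis using that[of "- 2 * ?c"] r by simp
qed

lemma octa_rot: "octa (rot t) = octa t"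
  by (simp add: octa_def bmono_def rot_def algebra_simps)

lemma octa_power_expand:
  "octa t ^ d = (\<Sum>j\<le>d. (of_nat (d choose j) * (-1) ^ (d - j)) * bmono (6 * d) (d + 4 * j) t)"
proof -
  have "octa t ^ d = (bmono 6 5 t + (- bmono 6 1 t)) ^ d" by (simp add: octa_def)
  also have "\<dots> = (\<Sum>j\<le>d. of_nat (d choose j) * bmono 6 5 t ^ j * (- bmono 6 1 t) ^ (d - j))"
    by (rule binomial_ring)
  also have "\<dots> = (\<Sum>j\<le>d. (of_nat (d choose j) * (-1) ^ (d - j)) * bmono (6 * d) (d + 4 * j) t)"
  proof (intro sum.cong refl)
    fix j assume "j \<in> {..d}"
    then obtain k where d: "d = j + k" using le_Suc_ex by auto
    have "6 * (j + k) - (j + k + 4 * j) = j + 5 * k" by simp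
    then have "bmono 6 5 t ^ j * bmono 6 1 t ^ k = bmono (6 * d) (d + 4 * j) t"
      by (simp add: d bmono_def power_mult_distrib power_mult[symmetric] power_add[symmetric] algebra_simps)
        (simp add: algebra_simps power_add)
    then show "of_nat (d choose j) * bmono 6 5 t ^ j * (- bmono 6 1 t) ^ (d - j)
      = (of_nat (d choose j) * (-1) ^ (d - j)) * bmono (6 * d) (d + 4 * j) t"
      using d by (simp add: power_minus[of "bmono 6 (Suc 0) t"] mult_ac)
  qed
  finally show ?thesis .
qed

text \<open>The octahedral sextic is invariant under the rotation by a right angle and has real coefficients, so
  the pairing is a sum of real squares with positive weights.\<close>

lemma skew_octa: "skew (6 * d) (\<lambda>t. octa t ^ d) (\<lambda>t. octa t ^ d) \<noteq> 0"
proof -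
  let ?g = "\<lambda>t. octa t ^ d"
  define r :: "nat \<Rightarrow> real" where
    "r k = (\<Sum>j\<le>d. (of_nat (d choose j) * (-1) ^ (d - j)) * (if d + 4 * j = k then 1 else 0))" for k
  have cf: "cf (6 * d) ?g k = of_real (r k)" if "k \<le> 6 * d" for k
  proof -
    have "cf (6 * d) ?g k = (\<Sum>j\<le>d. (of_nat (d choose j) * (-1) ^ (d - j)) * cf (6 * d) (bmono (6 * d) (d + 4 * j)) k)"
      unfolding octa_power_expand by (simp only: cf_sum cf_scale)
    also have "\<dots> = (\<Sum>j\<le>d. of_real ((of_nat (d choose j) * (-1) ^ (d - j)) * (if d + 4 * j = k then 1 else 0)))"
      by (intro sum.cong refl) (use that in \<open>auto simp: cf_mono\<close>)
    finally show ?thesis by (simp add: r_def)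
  qed
  have "skew (6 * d) ?g ?g = of_real (\<Sum>k\<le>6 * d. r k * r k / of_nat (6 * d choose k))"
    unfolding skew_def octa_rot apolar_def by (simp add: cf)
  moreover have "(\<Sum>k\<le>6 * d. r k * r k / of_nat (6 * d choose k)) > 0"
  proof (rule sum_pos2[of _ "5 * d"])
    have "r (5 * d) = (\<Sum>j\<le>d. if j = d then 1 else 0)"
      unfolding r_def by (rule sum.cong) auto
    then show "0 < r (5 * d) * r (5 * d) / real (6 * d choose (5 * d))" by simp
  qed auto
  ultimately show ?thesis by (metis less_irrefl of_real_eq_0_iff)
qed

section \<open>Division of holomorphic functions of two variables\<close>

definition cdiff :: "cfun \<Rightarrow> complex^2 \<Rightarrow> bool" where
  "cdiff f z \<longleftrightarrow> (\<exists>D. (f has_derivative D) (at z) \<and> (\<forall>c v. D (c *s v) = c * D v))"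

abbreviation hol :: "cfun \<Rightarrow> bool" where "hol \<equiv> holomorphic_near_0"

lemma hol_iff: "hol f \<longleftrightarrow> (\<forall>\<^sub>F z in nhds 0. cdiff f z)"
  by (simp add: holomorphic_near_0_def cdiff_def)

lemma cdiff_iff: "cdiff f z \<longleftrightarrow> (\<exists>p q. (f has_derivative (\<lambda>h. p * h $ 1 + q * h $ 2)) (at z))"
proof
  assume "cdiff f z"
  then obtain D where D: "(f has_derivative D) (at z)" "\<And>c v. D (c *s v) = c * D v"
    unfolding cdiff_def by blast
  have "D = (\<lambda>h. D (mk2 1 0) * h $ 1 + D (mk2 0 1) * h $ 2)"
  proof
    fix h :: "complex^2"
    have "D h = D (h $ 1 *s mk2 1 0 + h $ 2 *s mk2 0 1)"
      by (rule arg_cong[of _ _ D]) (simp add: vec2_eq_iff)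
    also have "\<dots> = D (h $ 1 *s mk2 1 0) + D (h $ 2 *s mk2 0 1)"
      using has_derivative_bounded_linear[OF D(1)] by (rule linear_add[OF bounded_linear.linear])
    finally show "D h = D (mk2 1 0) * h $ 1 + D (mk2 0 1) * h $ 2"
      by (simp only: D(2) mult.commute)
  qed
  with D(1) have "(f has_derivative (\<lambda>h. D (mk2 1 0) * h $ 1 + D (mk2 0 1) * h $ 2)) (at z)" by simp
  then show "\<exists>p q. (f has_derivative (\<lambda>h. p * h $ 1 + q * h $ 2)) (at z)" by (intro exI)
next
  assume "\<exists>p q. (f has_derivative (\<lambda>h. p * h $ 1 + q * h $ 2)) (at z)"
  then obtain p q where D: "(f has_derivative (\<lambda>h. p * h $ 1 + q * h $ 2)) (at z)" by (elim exE)
  show "cdiff f z" unfolding cdiff_def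
    by (rule exI, rule conjI, rule D) (simp add: algebra_simps)
qed

lemma bounded_linear_nth: "bounded_linear (\<lambda>z :: complex^2. z $ i)"
  by (rule bounded_linear_vec_nth)

lemma cdiff_const: "cdiff (\<lambda>_. c) z"
  unfolding cdiff_def by (auto intro!: exI[of _ "\<lambda>_. 0"])

lemma cdiff_coord: "cdiff (\<lambda>z. z $ i) z"
  unfolding cdiff_def
  by (rule exI[of _ "\<lambda>h. h $ i"]) (auto intro!: bounded_linear_imp_has_derivative bounded_linear_nth)

lemma cdiff_add:
  assumes "cdiff f z" "cdiff g z" shows "cdiff (\<lambda>z. f z + g z) z"
proof -
  obtain D E where "(f has_derivative D) (at z)" "\<forall>c v. D (c *s v) = c * D v"
    "(g has_derivative E) (at z)" "\<forall>c v. E (c *s v) = c * E v"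
    using assms unfolding cdiff_def by blast
  then show ?thesis unfolding cdiff_def
    by (intro exI[of _ "\<lambda>h. D h + E h"]) (auto intro!: has_derivative_add simp: distrib_left)
qed

lemma cdiff_mult:
  assumes "cdiff f z" "cdiff g z" shows "cdiff (\<lambda>z. f z * g z) z"
proof -
  obtain D where D: "(f has_derivative D) (at z)" "\<And>c v. D (c *s v) = c * D v"
    using assms(1) unfolding cdiff_def by blast
  obtain E where E: "(g has_derivative E) (at z)" "\<And>c v. E (c *s v) = c * E v"
    using assms(2) unfolding cdiff_def by blast
  show ?thesis unfolding cdiff_def
    by (rule exI, rule conjI, rule has_derivative_mult[OF D(1) E(1)]) (simp add: D(2) E(2) algebra_simps)
qed

lemma cdiff_inverse:
  assumes "cdiff f z" "f z \<noteq> 0" shows "cdiff (\<lambda>z. inverse (f z)) z"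
proof -
  obtain D where D: "(f has_derivative D) (at z)" "\<And>c v. D (c *s v) = c * D v"
    using assms(1) unfolding cdiff_def by blast
  show ?thesis unfolding cdiff_def
    by (rule exI, rule conjI, rule Deriv.has_derivative_inverse[of f z, OF assms(2) D(1)]) (simp add: D(2))
qed

lemma cdiff_isCont: "cdiff f z \<Longrightarrow> isCont f z"
  unfolding cdiff_def using has_derivative_continuous by blast

lemma cdiff_cong:
  assumes "cdiff f z" "\<forall>\<^sub>F w in nhds z. g w = f w" shows "cdiff g z"
proof -
  obtain D where D: "(f has_derivative D) (at z)" "\<forall>c v. D (c *s v) = c * D v"
    using assms(1) unfolding cdiff_def by blast
  have "(g has_derivative D) (at z)"
  proof (rule has_derivative_transform_eventually[OF D(1)])
    show "\<forall>\<^sub>F x in at z. f x = g x"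
      using assms(2) unfolding eventually_nhds_conv_at by (auto elim: eventually_mono)
    show "f z = g z" using eventually_nhds_x_imp_x[OF assms(2)] by simp
  qed auto
  then show ?thesis using D(2) unfolding cdiff_def by blast
qed

lemma norm_mk2_le: "norm (mk2 a b) \<le> norm a + norm b"
proof -
  have "norm (mk2 a b) \<le> (\<Sum>i\<in>UNIV. norm (mk2 a b $ i))"
    unfolding norm_vec_def by (rule L2_set_le_sum) simp
  then show ?thesis by (simp add: sum_2)
qed

lemma norm_nth_le2: "norm ((z::complex^2) $ i) \<le> norm z"
  by (rule Finite_Cartesian_Product.norm_nth_le)

lemma hol_polydisc:
  "hol f \<longleftrightarrow> (\<exists>r>0. \<forall>a b. norm a < r \<longrightarrow> norm b < r \<longrightarrow> cdiff f (mk2 a b))"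
proof
  assume "hol f"
  then obtain d where d: "d > 0" "\<And>z. dist z 0 < d \<Longrightarrow> cdiff f z"
    unfolding hol_iff eventually_nhds_metric by blast
  have "cdiff f (mk2 a b)" if "norm a < d / 2" "norm b < d / 2" for a b
    using norm_mk2_le[of a b] that by (intro d(2)) auto
  then show "\<exists>r>0. \<forall>a b. norm a < r \<longrightarrow> norm b < r \<longrightarrow> cdiff f (mk2 a b)"
    using d(1) by (intro exI[of _ "d / 2"]) auto
next
  assume "\<exists>r>0. \<forall>a b. norm a < r \<longrightarrow> norm b < r \<longrightarrow> cdiff f (mk2 a b)"
  then obtain r where r: "r > 0" "\<And>a b. norm a < r \<Longrightarrow> norm b < r \<Longrightarrow> cdiff f (mk2 a b)" by blast
  have "cdiff f z" if "dist z 0 < r" for z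
    using r(2)[of "z $ 1" "z $ 2"] norm_nth_le2[of z 1] norm_nth_le2[of z 2] that by simp
  then show "hol f" unfolding hol_iff eventually_nhds_metric using r(1) by blast
qed

lemma bounded_linear_mk2: "bounded_linear (\<lambda>(a, b). mk2 a b)"
proof (rule bounded_linear_intro[of _ 2])
  show "norm (case x of (a, b) \<Rightarrow> mk2 a b) \<le> norm x * 2" for x
    using norm_mk2_le[of "fst x" "snd x"] norm_fst_le[of "fst x" "snd x"] norm_snd_le[of "snd x" "fst x"]
    by (simp add: case_prod_unfold)
qed (auto simp: vec2_eq_iff)

lemma cdiff_partials:
  assumes "cdiff f (mk2 a b)"
  shows "(\<lambda>x. f (mk2 x b)) field_differentiable (at a)" "(\<lambda>y. f (mk2 a y)) field_differentiable (at b)"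
proof -
  obtain p q where D: "(f has_derivative (\<lambda>h. p * h $ 1 + q * h $ 2)) (at (mk2 a b))"
    using assms cdiff_iff by blast
  have 1: "((\<lambda>x. mk2 x b) has_derivative (\<lambda>h. mk2 h 0)) (at a)"
  proof -
    have "((\<lambda>x. mk2 x 0 + mk2 0 b) has_derivative (\<lambda>h. mk2 h 0 + 0)) (at a)"
      by (intro has_derivative_add bounded_linear_imp_has_derivative has_derivative_const
          bounded_linear_compose[OF bounded_linear_mk2, of "\<lambda>x. (x, 0)", simplified])
        (intro bounded_linear_Pair bounded_linear_ident bounded_linear_zero)
    then show ?thesis by (simp add: mk2_add)
  qed
  have 2: "((\<lambda>y. mk2 a y) has_derivative (\<lambda>h. mk2 0 h)) (at b)"
  proof -
    have "((\<lambda>y. mk2 0 y + mk2 a 0) has_derivative (\<lambda>h. mk2 0 h + 0)) (at b)"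
      by (intro has_derivative_add bounded_linear_imp_has_derivative has_derivative_const
          bounded_linear_compose[OF bounded_linear_mk2, of "\<lambda>x. (0, x)", simplified])
        (intro bounded_linear_Pair bounded_linear_ident bounded_linear_zero)
    then show ?thesis by (simp add: mk2_add)
  qed
  show "(\<lambda>x. f (mk2 x b)) field_differentiable (at a)"
    using has_derivative_compose[OF 1 D]
    unfolding field_differentiable_def has_field_derivative_def by (auto intro!: exI[of _ p])
  show "(\<lambda>y. f (mk2 a y)) field_differentiable (at b)"
    using has_derivative_compose[OF 2 D]
    unfolding field_differentiable_def has_field_derivative_def by (auto intro!: exI[of _ q])
qed

lemma cdiff_from_partials:
  assumes y: "(\<lambda>y. f (mk2 a y)) field_differentiable (at b)"
    and x: "\<And>a' b'. norm a' < r \<Longrightarrow> norm b' < r \<Longrightarrow> ((\<lambda>x. f (mk2 x b')) has_field_derivative g a' b') (at a')"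
    and g: "continuous_on (ball 0 r \<times> ball 0 r) (\<lambda>(a, b). g a b)"
    and ab: "norm a < r" "norm b < r"
  shows "cdiff f (mk2 a b)"
proof -
  obtain q where q: "((\<lambda>y. f (mk2 a y)) has_field_derivative q) (at b)"
    using y unfolding field_differentiable_def by blast
  have cont: "continuous_on (ball 0 r \<times> ball 0 r) (\<lambda>(b, a). blinfun_mult_right (g a b))"
  proof -
    have "continuous_on (ball 0 r \<times> ball 0 r) ((\<lambda>(a, b). g a b) \<circ> (\<lambda>(b, a). (a, b)))"
      by (rule continuous_on_compose)
        (auto intro!: continuous_intros continuous_on_subset[OF g[unfolded case_prod_unfold]] simp: case_prod_unfold)
    then show ?thesis
      by (auto simp: case_prod_unfold o_def intro!: bounded_linear.continuous_on[OF bounded_linear_blinfun_mult_right])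
  qed
  have "((\<lambda>(y, x). f (mk2 x y)) has_derivative (\<lambda>(ty, tx). q * ty + blinfun_mult_right (g a b) tx))
      (at (b, a) within ball 0 r \<times> ball 0 r)"
  proof (rule has_derivative_partialsI)
    show "((\<lambda>y. f (mk2 a y)) has_derivative (*) q) (at b within ball 0 r)"
      using q has_field_derivative_at_within unfolding has_field_derivative_def by blast
    show "((\<lambda>x. f (mk2 x b')) has_derivative blinfun_mult_right (g a' b')) (at a' within ball 0 r)"
      if "b' \<in> ball 0 r" "a' \<in> ball 0 r" for a' b'
      using x[of a' b'] that has_field_derivative_at_within unfolding has_field_derivative_def by fastforce
    show "continuous (at (b, a) within ball 0 r \<times> ball 0 r) (\<lambda>(b, a). blinfun_mult_right (g a b))"
      using cont ab unfolding continuous_on_eq_continuous_within by auto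
  qed (use ab in auto)
  then have "((\<lambda>(y, x). f (mk2 x y)) has_derivative (\<lambda>(ty, tx). q * ty + g a b * tx)) (at (b, a))"
    using ab by (subst (asm) at_within_open) (auto intro!: open_Times)
  then have 1: "((\<lambda>(y, x). f (mk2 x y)) has_derivative (\<lambda>(ty, tx). q * ty + g a b * tx)) (at (mk2 a b $ 2, mk2 a b $ 1))"
    by simp
  have 2: "((\<lambda>z::complex^2. (z $ 2, z $ 1)) has_derivative (\<lambda>h. (h $ 2, h $ 1))) (at (mk2 a b))"
    by (intro has_derivative_Pair bounded_linear_imp_has_derivative bounded_linear_nth)
  have "((\<lambda>z. f (mk2 (z $ 1) (z $ 2))) has_derivative (\<lambda>h. q * h $ 2 + g a b * h $ 1)) (at (mk2 a b))"
    using has_derivative_compose[OF 2 1] by simp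
  then show ?thesis unfolding cdiff_iff
    by (intro exI[of _ "g a b"] exI[of _ q]) (simp add: add.commute)
qed

text \<open>The quotient of \<open>f(a, b) - f(0, b)\<close> by \<open>a\<close> is the Cauchy integral of \<open>f(\<zeta>, b) / (\<zeta> (\<zeta> - a))\<close> over a circle
  in the \<open>\<zeta>\<close>-plane, an expression without a singularity at \<open>a = 0\<close>. Its derivative with respect to \<open>a\<close> is an
  integral of the same kind, which is jointly continuous. Differentiability with respect to \<open>b\<close> is clear
  for \<open>a \<noteq> 0\<close> and passes to \<open>a = 0\<close> by uniform convergence.\<close>

lemma divide_first_coordinate:
  assumes r: "r > 0" and f: "\<And>a b. norm a < r \<Longrightarrow> norm b < r \<Longrightarrow> cdiff f (mk2 a b)"
  shows "\<exists>h. \<forall>a b. norm a < r / 2 \<longrightarrow> norm b < r / 2 \<longrightarrow>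
    cdiff h (mk2 a b) \<and> f (mk2 a b) - f (mk2 0 b) = a * h (mk2 a b)"
proof -
  define \<rho> where "\<rho> = r / 2"
  have \<rho>: "\<rho> > 0" "\<rho> < r" using r by (auto simp: \<rho>_def)
  let ?F = "\<lambda>a b. f (mk2 a b)"
  have cF: "continuous_on (ball 0 r \<times> ball 0 r) (\<lambda>(a, b). ?F a b)"
  proof -
    have "isCont (\<lambda>x. f ((\<lambda>(a, b). mk2 a b) x)) x" if "x \<in> ball 0 r \<times> ball 0 r" for x
    proof (rule isCont_o2[where f = "\<lambda>(a, b). mk2 a b" and g = f])
      show "isCont (\<lambda>(a, b). mk2 a b) x"
        by (rule linear_continuous_at[OF bounded_linear_mk2])
      show "isCont f (case x of (a, b) \<Rightarrow> mk2 a b)"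
        using that f by (auto intro!: cdiff_isCont simp: case_prod_unfold mem_Times_iff)
    qed
    then show ?thesis by (auto intro!: continuous_at_imp_continuous_on simp: o_def case_prod_unfold)
  qed
  have hx: "(\<lambda>a. ?F a b) holomorphic_on ball 0 r" if "norm b < r" for b
    unfolding holomorphic_on_def using that cdiff_partials(1)[OF f] by (auto intro: field_differentiable_at_within)
  have hy: "(\<lambda>b. ?F a b) holomorphic_on ball 0 r" if "norm a < r" for a
    unfolding holomorphic_on_def using that cdiff_partials(2)[OF f] by (auto intro: field_differentiable_at_within)
  define H where "H k a b = contour_integral (circlepath 0 \<rho>) (\<lambda>u. (?F u b / u) / (u - a) ^ k)" for k :: nat and a b
  let ?c = "\<lambda>t::real. \<rho> * exp (2 * of_real pi * \<i> * t) :: complex"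
  have nc: "norm (?c t) = \<rho>" for t
    using \<rho> by (simp add: norm_mult mult.assoc)
  have contH: "continuous_on (ball 0 \<rho> \<times> ball 0 r) (\<lambda>(a, b). H k a b)" for k
  proof -
    have H: "H k a b = integral (cbox 0 1) (\<lambda>t. (?F (?c t) b / ?c t) / (?c t - a) ^ k
        * (2 * pi * \<i> * \<rho> * exp (2 * of_real pi * \<i> * t)))" for a b
      unfolding H_def contour_integral_integral vector_derivative_circlepath
      unfolding circlepath cbox_interval by simp
    have "continuous_on ((ball 0 \<rho> \<times> ball 0 r) \<times> cbox 0 1) (\<lambda>(x, t). (?F (?c t) (snd x) / ?c t) / (?c t - fst x) ^ k
        * (2 * pi * \<i> * \<rho> * exp (2 * of_real pi * \<i> * t)))"
    proof -
      have 1: "continuous_on ((ball 0 \<rho> \<times> ball 0 r) \<times> cbox 0 1) (\<lambda>(x, t). ?F (?c t) (snd x))"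
      proof -
        have "continuous_on ((ball 0 \<rho> \<times> ball 0 r) \<times> cbox 0 1) ((\<lambda>(a, b). ?F a b) \<circ> (\<lambda>(x, t). (?c t, snd x)))"
          by (rule continuous_on_compose)
            (use \<rho> nc in \<open>auto intro!: continuous_intros continuous_on_subset[OF cF[unfolded case_prod_unfold]] simp: case_prod_unfold\<close>)
        then show ?thesis by (simp add: o_def case_prod_unfold)
      qed
      have 2: "?c t \<noteq> 0" "?c t - a \<noteq> 0" if "norm a < \<rho>" for t a
        using nc[of t] \<rho> that by auto
      show ?thesis unfolding case_prod_unfold
        by (intro continuous_intros 1[unfolded case_prod_unfold]) (use 2 in \<open>auto simp: mem_Times_iff\<close>)
    qed
    from integral_continuous_on_param[OF this] show ?thesis by (simp add: H case_prod_unfold)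
  qed
  have path: "path_image (circlepath 0 \<rho>) = sphere 0 \<rho>" using \<rho> by simp
  have cint: "continuous_on (path_image (circlepath 0 \<rho>)) (\<lambda>u. ?F u b / u)" if "norm b < r" for b
  proof -
    have "continuous_on (sphere 0 \<rho>) (\<lambda>u. ?F u b)"
      by (rule holomorphic_on_imp_continuous_on, rule holomorphic_on_subset[OF hx[OF that]]) (use \<rho> in auto)
    then show ?thesis unfolding path using \<rho> by (intro continuous_intros) auto
  qed
  have intH: "((\<lambda>u. (?F u b / u) / (u - a) ^ 1) has_contour_integral H 1 a b) (circlepath 0 \<rho>)"
    if "norm a < \<rho>" "norm b < r" for a b
    unfolding H_def
    by (rule has_contour_integral_integral, rule contour_integrable_continuous_circlepath,
        rule continuous_on_divide[OF cint[OF that(2)]])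
      (use that \<rho> in \<open>auto intro!: continuous_intros simp: path\<close>)
  have dH: "((\<lambda>a. H 1 a b) has_field_derivative H 2 a b) (at a)" if "norm a < \<rho>" "norm b < r" for a b
  proof -
    have "((\<lambda>a. H 1 a b) has_field_derivative
      (of_nat 1 * contour_integral (circlepath 0 \<rho>) (\<lambda>u. (?F u b / u) / (u - a) ^ Suc 1))) (at a)"
      by (rule Cauchy_next_derivative_circlepath(2)[OF cint[OF that(2)]]) (use intH that in auto)
    then show ?thesis by (simp add: H_def numeral_2_eq_2)
  qed
  have Cauchy: "a * H 1 a b = (2 * pi * \<i>) * (?F a b - ?F 0 b)" if ab: "norm a < \<rho>" "norm b < r" for a b
  proof (cases "a = 0")
    case False
    have "(\<lambda>u. ?F u b) holomorphic_on cball 0 \<rho>"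
      by (rule holomorphic_on_subset[OF hx[OF ab(2)]]) (use \<rho> in auto)
    note C = Cauchy_integral_circlepath_simple[OF this]
    have 1: "((\<lambda>u. ?F u b / (u - a) - ?F u b / (u - 0)) has_contour_integral
      2 * of_real pi * \<i> * ?F a b - 2 * of_real pi * \<i> * ?F 0 b) (circlepath 0 \<rho>)"
      by (intro has_contour_integral_diff C) (use ab \<rho> in auto)
    have 2: "((\<lambda>u. a * ((?F u b / u) / (u - a) ^ 1)) has_contour_integral a * H 1 a b) (circlepath 0 \<rho>)"
      by (rule has_contour_integral_lmul[OF intH[OF ab]])
    have 3: "?F u b / (u - a) - ?F u b / (u - 0) = a * ((?F u b / u) / (u - a) ^ 1)"
      if "u \<in> path_image (circlepath 0 \<rho>)" for u
    proof -
      have "u \<noteq> 0" "u - a \<noteq> 0" using that ab \<rho> unfolding path by auto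
      then show ?thesis by (simp add: field_simps)
    qed
    have "a * H 1 a b = 2 * of_real pi * \<i> * ?F a b - 2 * of_real pi * \<i> * ?F 0 b"
      by (rule has_contour_integral_unique[OF 2 has_contour_integral_eq[OF 1 3]])
    then show ?thesis by (simp add: right_diff_distrib)
  qed simp
  define h where "h z = H 1 (z $ 1) (z $ 2) / (2 * pi * \<i>)" for z :: "complex^2"
  have holn: "(\<lambda>b. H 1 a b) holomorphic_on ball 0 \<rho>" if "norm a < \<rho>" "a \<noteq> 0" for a
  proof -
    have "(\<lambda>b. (2 * pi * \<i>) * (?F a b - ?F 0 b) / a) holomorphic_on ball 0 \<rho>"
      by (intro holomorphic_intros holomorphic_on_subset[OF hy] that) (use that \<rho> in auto)
    moreover have "H 1 a b = (2 * pi * \<i>) * (?F a b - ?F 0 b) / a" if "b \<in> ball 0 \<rho>" for b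
      using Cauchy[of a b] that \<open>norm a < \<rho>\<close> \<open>a \<noteq> 0\<close> \<rho> by (simp add: field_simps)
    ultimately show ?thesis using holomorphic_cong by (metis (no_types, lifting))
  qed
  \<comment> \<open>For \<open>a = 0\<close> the function is a locally uniform limit of the ones for \<open>a \<noteq> 0\<close>.\<close>
  have hol0: "(\<lambda>b. H 1 0 b) holomorphic_on ball 0 \<rho>"
  proof (rule holomorphic_uniform_sequence[where f = "\<lambda>n b. H 1 (of_real (\<rho> / (real n + 2))) b"])
    show "open (ball (0::complex) \<rho>)" by simp
    show "(\<lambda>b. H 1 (of_real (\<rho> / (real n + 2))) b) holomorphic_on ball 0 \<rho>" for n
    proof (rule holn)
      have "0 < \<rho> / (real n + 2)" using \<rho>(1) by (intro divide_pos_pos) auto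
      moreover have "\<rho> / (real n + 2) \<le> \<rho> / 2" using \<rho> by (intro divide_left_mono) auto
      ultimately show "norm (of_real (\<rho> / (real n + 2)) :: complex) < \<rho>" "of_real (\<rho> / (real n + 2)) \<noteq> (0 :: complex)"
        unfolding norm_of_real of_real_eq_0_iff using \<rho>(1) by linarith+
    qed
    fix x :: complex assume "x \<in> ball 0 \<rho>"
    define d where "d = (\<rho> - norm x) / 2"
    have d: "d > 0" "cball x d \<subseteq> ball 0 \<rho>"
      using \<open>x \<in> ball 0 \<rho>\<close> norm_triangle_sub by (auto simp: d_def dist_norm subset_iff) (smt (verit) field_sum_of_halves norm_minus_commute norm_triangle_sub)
    let ?K = "cball (0::complex) (\<rho> / 2) \<times> cball x d"
    have "continuous_on ?K (\<lambda>(a, b). H 1 a b)"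
      by (rule continuous_on_subset[OF contH]) (use d \<rho> in \<open>auto simp: subset_iff\<close>)
    then have uc: "uniformly_continuous_on ?K (\<lambda>(a, b). H 1 a b)"
      by (rule compact_uniformly_continuous) (intro compact_Times compact_cball)
    have "uniform_limit (cball x d) (\<lambda>n b. H 1 (of_real (\<rho> / (real n + 2))) b) (\<lambda>b. H 1 0 b) sequentially"
    proof (rule uniform_limitI)
      fix e :: real assume "e > 0"
      then obtain \<delta> where \<delta>: "\<delta> > 0" "\<And>p q. p \<in> ?K \<Longrightarrow> q \<in> ?K \<Longrightarrow> dist p q < \<delta> \<Longrightarrow>
          dist (case p of (a, b) \<Rightarrow> H 1 a b) (case q of (a, b) \<Rightarrow> H 1 a b) < e"
        using uc unfolding uniformly_continuous_on_def by metis
      have "(\<lambda>n. \<rho> / (real n + 2)) \<longlonglongrightarrow> 0" by real_asymp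
      then have "\<forall>\<^sub>F n in sequentially. \<rho> / (real n + 2) < \<delta>" using \<delta>(1) by (rule order_tendstoD)
      then show "\<forall>\<^sub>F n in sequentially. \<forall>b\<in>cball x d. dist (H 1 (of_real (\<rho> / (real n + 2))) b) (H 1 0 b) < e"
      proof (rule eventually_mono, intro ballI)
        fix n b assume n: "\<rho> / (real n + 2) < \<delta>" and b: "b \<in> cball x d"
        have le: "\<rho> / (real n + 2) \<le> \<rho> / 2" using \<rho> by (intro divide_left_mono) auto
        have nn: "norm (of_real (\<rho> / (real n + 2)) :: complex) = \<rho> / (real n + 2)"
          using \<rho> by (subst norm_of_real) (simp add: add_nonneg_pos)
        have "(of_real (\<rho> / (real n + 2)), b) \<in> ?K" "(0, b) \<in> ?K"
          using b le nn \<rho> by auto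
        moreover have "dist (of_real (\<rho> / (real n + 2)) :: complex, b) (0, b) < \<delta>"
          using n nn \<rho>(1) by (simp add: dist_Pair_Pair)
        ultimately show "dist (H 1 (of_real (\<rho> / (real n + 2))) b) (H 1 0 b) < e"
          using \<delta>(2)[of "(of_real (\<rho> / (real n + 2)), b)" "(0, b)"] by simp
      qed
    qed
    then show "\<exists>d>0. cball x d \<subseteq> ball 0 \<rho> \<and>
        uniform_limit (cball x d) (\<lambda>n b. H 1 (of_real (\<rho> / (real n + 2))) b) (\<lambda>b. H 1 0 b) sequentially"
      using d by blast
  qed
  have "cdiff h (mk2 a b)" if ab: "norm a < \<rho>" "norm b < \<rho>" for a b
  proof (rule cdiff_from_partials[where r = \<rho> and g = "\<lambda>a b. H 2 a b / (2 * pi * \<i>)"])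
    have "(\<lambda>b. H 1 a b) holomorphic_on ball 0 \<rho>" using holn[OF ab(1)] hol0 by (cases "a = 0") auto
    then have "(\<lambda>b. H 1 a b / (2 * pi * \<i>)) holomorphic_on ball 0 \<rho>" by (intro holomorphic_intros) auto
    then show "(\<lambda>y. h (mk2 a y)) field_differentiable at b"
      using ab(2) holomorphic_on_imp_differentiable_at[of _ "ball 0 \<rho>" b] by (simp add: h_def)
    show "((\<lambda>x. h (mk2 x b')) has_field_derivative H 2 a' b' / (2 * pi * \<i>)) (at a')"
      if "norm a' < \<rho>" "norm b' < \<rho>" for a' b'
      unfolding h_def mk2_nth using DERIV_cdivide[OF dH] that \<rho> by simp
    show "continuous_on (ball 0 \<rho> \<times> ball 0 \<rho>) (\<lambda>(a, b). H 2 a b / (2 * pi * \<i>))"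
    proof -
      have "continuous_on (ball 0 \<rho> \<times> ball 0 \<rho>) (\<lambda>(a, b). H 2 a b)"
        by (rule continuous_on_subset[OF contH]) (use \<rho> in auto)
      then show ?thesis unfolding case_prod_unfold by (intro continuous_intros) auto
    qed
  qed (use ab in auto)
  moreover have "f (mk2 a b) - f (mk2 0 b) = a * h (mk2 a b)" if "norm a < \<rho>" "norm b < \<rho>" for a b
    using Cauchy[of a b] that \<rho> by (simp add: h_def)
  ultimately show ?thesis unfolding \<rho>_def by blast
qed

lemma cdiff_matrix:
  assumes "cdiff f (A *v z)" shows "cdiff (\<lambda>z. f ((A :: complex^2^2) *v z)) z"
proof -
  obtain D where D: "(f has_derivative D) (at (A *v z))" "\<forall>c v. D (c *s v) = c * D v"
    using assms unfolding cdiff_def by blast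
  have A: "A *v z = mk2 (A $ 1 $ 1 * z $ 1 + A $ 1 $ 2 * z $ 2) (A $ 2 $ 1 * z $ 1 + A $ 2 $ 2 * z $ 2)" for z
    by (simp add: vec2_eq_iff matrix_vector_2)
  have "bounded_linear (\<lambda>z. A *v z)"
    unfolding A
    by (rule bounded_linear_compose[OF bounded_linear_mk2, of "\<lambda>z. (_ z, _ z)", simplified])
      (intro bounded_linear_Pair bounded_linear_add bounded_linear_const_mult bounded_linear_nth)
  then have "((\<lambda>z. A *v z) has_derivative (\<lambda>z. A *v z)) (at z)"
    by (rule bounded_linear_imp_has_derivative)
  from has_derivative_compose[OF this D(1)] show ?thesis
    unfolding cdiff_def using D(2)
  proof (intro exI[of _ "\<lambda>h. D (A *v h)"] conjI allI)
    fix c v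
    have "A *v (c *s v) = c *s (A *v v)"
      by (simp add: vec2_eq_iff matrix_vector_2 algebra_simps)
    then show "D (A *v (c *s v)) = c * D (A *v v)" using D(2) by simp
  qed auto
qed

section \<open>Taylor expansion of germs\<close>

lemma hol_const [simp]: "hol (\<lambda>_. c)"
  by (simp add: hol_iff cdiff_const)

lemma hol_coord [simp]: "hol (\<lambda>z. z $ i)"
  by (simp add: hol_iff cdiff_coord)

lemma hol_add: "hol f \<Longrightarrow> hol g \<Longrightarrow> hol (\<lambda>z. f z + g z)"
  unfolding hol_iff by (erule (1) eventually_elim2) (rule cdiff_add)

lemma hol_mult: "hol f \<Longrightarrow> hol g \<Longrightarrow> hol (\<lambda>z. f z * g z)"
  unfolding hol_iff by (erule (1) eventually_elim2) (rule cdiff_mult)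

lemma hol_isCont: "hol f \<Longrightarrow> isCont f 0"
  unfolding hol_iff using eventually_nhds_x_imp_x cdiff_isCont by blast

lemma isCont_tendsto_nhds: "isCont f a \<Longrightarrow> (f \<longlongrightarrow> f a) (nhds a)"
  by (simp add: isCont_def tendsto_at_iff_tendsto_nhds)

lemma hol_inverse:
  assumes "hol f" "f 0 \<noteq> 0" shows "hol (\<lambda>z. inverse (f z))"
proof -
  have "\<forall>\<^sub>F z in nhds 0. f z \<noteq> 0"
    using isCont_tendsto_nhds[OF hol_isCont[OF assms(1)]] assms(2) by (rule tendsto_imp_eventually_ne)
  then show ?thesis using assms(1) unfolding hol_iff by eventually_elim (rule cdiff_inverse)
qed

lemma hol_cong:
  assumes "hol f" "\<forall>\<^sub>F z in nhds 0. g z = f z" shows "hol g"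
proof -
  have "\<forall>\<^sub>F z in nhds 0. \<forall>\<^sub>F w in nhds z. g w = f w"
    using assms(2) eventually_eventually by blast
  then show ?thesis using assms(1) unfolding hol_iff by eventually_elim (rule cdiff_cong)
qed

lemma hol_power: "hol f \<Longrightarrow> hol (\<lambda>z. f z ^ n)"
  by (induction n) (auto intro: hol_mult)

lemma hol_sum: "(\<And>i. i \<in> A \<Longrightarrow> hol (f i)) \<Longrightarrow> hol (\<lambda>z. \<Sum>i\<in>A. f i z)"
  by (induction A rule: infinite_finite_induct) (auto intro: hol_add)

lemma hol_form: "u \<in> forms d \<Longrightarrow> hol u"
proof -
  assume u: "u \<in> forms d"
  have "hol (\<lambda>z. \<Sum>k\<le>d. cf d u k * bmono d k z)"
    unfolding bmono_def by (intro hol_sum hol_mult hol_power hol_const hol_coord)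
  moreover have "u = (\<lambda>z. \<Sum>k\<le>d. cf d u k * bmono d k z)" using form_expand[OF u] by (rule ext)
  ultimately show ?thesis by simp
qed

lemma eventually_polydisc:
  assumes "r > 0" "\<And>a b. norm a < r \<Longrightarrow> norm b < r \<Longrightarrow> P (mk2 a b)"
  shows "\<forall>\<^sub>F z in nhds (0 :: complex^2). P z"
  unfolding eventually_nhds_metric
proof (intro exI[of _ r] conjI allI impI)
  fix z :: "complex^2" assume "dist z 0 < r"
  then show "P z"
    using assms(2)[of "z $ 1" "z $ 2"] norm_nth_le2[of z 1] norm_nth_le2[of z 2] by simp
qed (rule assms(1))

lemma hol_matrix:
  assumes "hol f" shows "hol (\<lambda>z. f ((A :: complex^2^2) *v z))"
proof -
  have "isCont (\<lambda>z. A *v z) 0"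
  proof -
    have "A *v z = mk2 (A $ 1 $ 1 * z $ 1 + A $ 1 $ 2 * z $ 2) (A $ 2 $ 1 * z $ 1 + A $ 2 $ 2 * z $ 2)" for z
      by (simp add: vec2_eq_iff matrix_vector_2)
    then have "(\<lambda>z. A *v z) = (\<lambda>(a, b). mk2 a b) \<circ> (\<lambda>z. (A $ 1 $ 1 * z $ 1 + A $ 1 $ 2 * z $ 2, A $ 2 $ 1 * z $ 1 + A $ 2 $ 2 * z $ 2))"
      by auto
    then show ?thesis
      by (simp only:) (intro continuous_at_compose linear_continuous_at[OF bounded_linear_mk2] continuous_intros)
  qed
  then have "filterlim (\<lambda>z. A *v z) (nhds (A *v 0)) (nhds 0)"
    by (rule isCont_tendsto_nhds)
  then have "filterlim (\<lambda>z. A *v z) (nhds 0) (nhds 0)" by simp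
  then have "\<forall>\<^sub>F z in nhds 0. cdiff f (A *v z)"
    using assms unfolding hol_iff by (simp add: filterlim_iff)
  then show ?thesis unfolding hol_iff by (rule eventually_mono) (rule cdiff_matrix)
qed

text \<open>Divide \<open>f\<close> by the first coordinate, and the restriction of \<open>f\<close> to the second axis by the second one.\<close>

lemma hadamard:
  assumes f: "hol f"
  obtains h1 h2 where "hol h1" "hol h2" "\<forall>\<^sub>F z in nhds 0. f z = f 0 + z $ 1 * h1 z + z $ 2 * h2 z"
proof -
  have div: "\<exists>h. hol h \<and> (\<exists>r>0. \<forall>a b. norm a < r \<longrightarrow> norm b < r \<longrightarrow> g (mk2 a b) - g (mk2 0 b) = a * h (mk2 a b))"
    if g: "hol g" for g
  proof -
    obtain r where r: "r > 0" "\<forall>a b. norm a < r \<longrightarrow> norm b < r \<longrightarrow> cdiff g (mk2 a b)"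
      using g unfolding hol_polydisc by (elim exE conjE)
    obtain h where h: "\<forall>a b. norm a < r / 2 \<longrightarrow> norm b < r / 2 \<longrightarrow>
        cdiff h (mk2 a b) \<and> g (mk2 a b) - g (mk2 0 b) = a * h (mk2 a b)"
    proof -
      have "\<exists>h. \<forall>a b. norm a < r / 2 \<longrightarrow> norm b < r / 2 \<longrightarrow>
          cdiff h (mk2 a b) \<and> g (mk2 a b) - g (mk2 0 b) = a * h (mk2 a b)"
        by (rule divide_first_coordinate[OF r(1)]) (use r(2) in simp)
      then show thesis using that by (elim exE)
    qed
    have r2: "r / 2 > 0" using r(1) by simp
    have "hol h" unfolding hol_polydisc
      by (intro exI[of _ "r / 2"] conjI allI impI r2) (simp add: h)
    moreover have "\<exists>r>0. \<forall>a b. norm a < r \<longrightarrow> norm b < r \<longrightarrow> g (mk2 a b) - g (mk2 0 b) = a * h (mk2 a b)"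
      by (intro exI[of _ "r / 2"] conjI allI impI r2) (simp add: h)
    ultimately show ?thesis by blast
  qed
  obtain h1 r where h1: "hol h1" "r > 0"
    "\<And>a b. norm a < r \<Longrightarrow> norm b < r \<Longrightarrow> f (mk2 a b) - f (mk2 0 b) = a * h1 (mk2 a b)"
    using div[OF f] by (elim exE conjE) (rule that, assumption+, blast)
  let ?g = "\<lambda>z. f (mkm 0 0 1 0 *v z)"
  have g: "mkm 0 0 1 0 *v mk2 a b = mk2 0 a" for a b by (simp add: vec2_eq_iff matrix_vector_2)
  obtain k s where k: "hol k" "s > 0"
    "\<And>a b. norm a < s \<Longrightarrow> norm b < s \<Longrightarrow> ?g (mk2 a b) - ?g (mk2 0 b) = a * k (mk2 a b)"
    using div[OF hol_matrix[OF f, of "mkm 0 0 1 0"]] by (elim exE conjE) (rule that, assumption+, blast)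
  define h2 where "h2 z = k (mkm 0 1 0 0 *v z)" for z
  have "hol h2" unfolding h2_def using hol_matrix[OF k(1)] .
  have h2: "h2 (mk2 a b) = k (mk2 b 0)" for a b
    unfolding h2_def by (rule arg_cong[of _ _ k]) (simp add: vec2_eq_iff matrix_vector_2)
  have "\<forall>\<^sub>F z in nhds 0. f z = f 0 + z $ 1 * h1 z + z $ 2 * h2 z"
  proof (rule eventually_polydisc[of "min r s"])
    fix a b :: complex assume ab: "norm a < min r s" "norm b < min r s"
    then have "f (mk2 a b) - f (mk2 0 b) = a * h1 (mk2 a b)" using h1(3) by simp
    moreover have "f (mk2 0 b) - f 0 = b * k (mk2 b 0)"
      using k(3)[of b 0] ab k(2) unfolding g by (simp add: mk2_0)
    ultimately show "f (mk2 a b) = f 0 + mk2 a b $ 1 * h1 (mk2 a b) + mk2 a b $ 2 * h2 (mk2 a b)"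
      by (simp add: h2 algebra_simps)
  qed (use h1(2) k(2) in simp)
  with h1(1) \<open>hol h2\<close> show thesis by (rule that)
qed

text \<open>The germs in the \<open>N\<close>-th power of the maximal ideal, generated by the forms of degree \<open>N\<close>.\<close>

inductive_set order_ideal :: "nat \<Rightarrow> cfun set" for N where
  gen: "u \<in> forms N \<Longrightarrow> hol h \<Longrightarrow> \<forall>\<^sub>F z in nhds 0. f z = u z * h z \<Longrightarrow> f \<in> order_ideal N"
| sum: "f \<in> order_ideal N \<Longrightarrow> g \<in> order_ideal N \<Longrightarrow> \<forall>\<^sub>F z in nhds 0. k z = f z + g z \<Longrightarrow> k \<in> order_ideal N"

lemma order_ideal_step:
  assumes "f \<in> order_ideal N"
  shows "\<exists>v\<in>forms N. (\<lambda>z. f z - v z) \<in> order_ideal (Suc N)"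
  using assms
proof induction
  case (gen u h f)
  obtain h1 h2 where h: "hol h1" "hol h2" "\<forall>\<^sub>F z in nhds 0. h z = h 0 + z $ 1 * h1 z + z $ 2 * h2 z"
    using hadamard[OF gen(2)] .
  have F: "(\<lambda>z. u z * z $ i) \<in> forms (Suc N)" for i using forms_mult[OF gen(1) forms_coord] by simp
  have "(\<lambda>z. f z - h 0 * u z) \<in> order_ideal (Suc N)"
  proof (rule order_ideal.sum)
    show "(\<lambda>z. (u z * z $ 1) * h1 z) \<in> order_ideal (Suc N)" by (rule order_ideal.gen[OF F[of 1] h(1)]) simp
    show "(\<lambda>z. (u z * z $ 2) * h2 z) \<in> order_ideal (Suc N)" by (rule order_ideal.gen[OF F[of 2] h(2)]) simp
    show "\<forall>\<^sub>F z in nhds 0. f z - h 0 * u z = (u z * z $ 1) * h1 z + (u z * z $ 2) * h2 z"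
      using h(3) gen(3)
    proof eventually_elim
      case (elim z)
      have "f z - h 0 * u z = u z * (h z - h 0)" using elim(2) by (simp add: algebra_simps)
      also have "h z - h 0 = z $ 1 * h1 z + z $ 2 * h2 z" using elim(1) by simp
      finally show ?case by (simp add: algebra_simps)
    qed
  qed
  then show ?case by (intro bexI[of _ "\<lambda>z. h 0 * u z"] forms_scale gen(1))
next
  case (sum f g k)
  then obtain v w where vw: "v \<in> forms N" "w \<in> forms N"
    "(\<lambda>z. f z - v z) \<in> order_ideal (Suc N)" "(\<lambda>z. g z - w z) \<in> order_ideal (Suc N)" by blast
  have "(\<lambda>z. k z - (v z + w z)) \<in> order_ideal (Suc N)"
    by (rule order_ideal.sum[OF vw(3,4)]) (use sum.hyps in \<open>auto elim: eventually_mono\<close>)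
  then show ?case by (intro bexI[of _ "\<lambda>z. v z + w z"] forms_add vw(1,2))
qed

lemma taylor:
  assumes "hol f"
  shows "\<exists>u. (\<forall>i. u i \<in> forms i) \<and> (\<lambda>z. f z - (\<Sum>i<N. u i z)) \<in> order_ideal N"
proof (induction N)
  case 0
  have "(\<lambda>z. f z - (\<Sum>i<0. (0::complex))) \<in> order_ideal 0"
    by (rule order_ideal.gen[OF forms_const[of 1] assms]) simp
  then show ?case by (intro exI[of _ "\<lambda>_ _. 0"]) simp
next
  case (Suc N)
  then obtain u where u: "\<And>i. u i \<in> forms i" "(\<lambda>z. f z - (\<Sum>i<N. u i z)) \<in> order_ideal N" by blast
  obtain v where v: "v \<in> forms N" "(\<lambda>z. f z - (\<Sum>i<N. u i z) - v z) \<in> order_ideal (Suc N)"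
    using order_ideal_step[OF u(2)] by blast
  have "(\<lambda>z. f z - (\<Sum>i<Suc N. (u(N := v)) i z)) = (\<lambda>z. f z - (\<Sum>i<N. u i z) - v z)"
    by (auto simp: algebra_simps)
  then have "(\<lambda>z. f z - (\<Sum>i<Suc N. (u(N := v)) i z)) \<in> order_ideal (Suc N)" using v(2) by simp
  moreover have "\<forall>i. (u(N := v)) i \<in> forms i" using u(1) v(1) by simp
  ultimately show ?case by blast
qed

definition big_o :: "nat \<Rightarrow> cfun \<Rightarrow> bool" where
  "big_o N f \<longleftrightarrow> (\<exists>C. \<forall>\<^sub>F z in nhds 0. norm (f z) \<le> C * norm z ^ N)"

lemma form_bound:
  assumes "u \<in> forms d" shows "norm (u z) \<le> (\<Sum>k\<le>d. norm (cf d u k)) * norm z ^ d"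
proof -
  have "norm (bmono d k z) \<le> norm z ^ d" if "k \<le> d" for k
  proof -
    have "norm (bmono d k z) = norm (z $ 1) ^ k * norm (z $ 2) ^ (d - k)"
      by (simp add: bmono_def norm_mult norm_power)
    also have "\<dots> \<le> norm z ^ k * norm z ^ (d - k)"
      by (intro mult_mono power_mono norm_nth_le2) auto
    also have "\<dots> = norm z ^ d" using that by (simp flip: power_add)
    finally show ?thesis .
  qed
  then have "norm (\<Sum>k\<le>d. cf d u k * bmono d k z) \<le> (\<Sum>k\<le>d. norm (cf d u k) * norm z ^ d)"
    by (intro sum_norm_le) (auto simp: norm_mult intro!: mult_left_mono)
  then show ?thesis using form_expand[OF assms, of z] by (simp add: sum_distrib_right)
qed

lemma hol_bounded: "hol h \<Longrightarrow> \<exists>K\<ge>0. \<forall>\<^sub>F z in nhds 0. norm (h z) \<le> K"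
proof -
  assume "hol h"
  then have "isCont (\<lambda>z. norm (h z)) 0" by (intro continuous_intros hol_isCont)
  then have "((\<lambda>z. norm (h z)) \<longlongrightarrow> norm (h 0)) (nhds 0)"
    by (rule isCont_tendsto_nhds)
  then have "\<forall>\<^sub>F z in nhds 0. norm (h z) < norm (h 0) + 1" by (rule order_tendstoD) simp
  then have "\<forall>\<^sub>F z in nhds 0. norm (h z) \<le> norm (h 0) + 1" by (rule eventually_mono) simp
  then show ?thesis by (intro exI[of _ "norm (h 0) + 1"]) auto
qed

lemma big_o_add: "big_o N f \<Longrightarrow> big_o N g \<Longrightarrow> big_o N (\<lambda>z. f z + g z)"
proof -
  assume "big_o N f" "big_o N g"
  then obtain C D where CD: "\<forall>\<^sub>F z in nhds 0. norm (f z) \<le> C * norm z ^ N"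
    "\<forall>\<^sub>F z in nhds 0. norm (g z) \<le> D * norm z ^ N" unfolding big_o_def by blast
  then have "\<forall>\<^sub>F z in nhds 0. norm (f z + g z) \<le> (C + D) * norm z ^ N"
  proof eventually_elim
    case (elim z)
    then show ?case using norm_triangle_ineq[of "f z" "g z"] by (simp add: distrib_right)
  qed
  then show ?thesis unfolding big_o_def by blast
qed

lemma big_o_cong: "big_o N f \<Longrightarrow> \<forall>\<^sub>F z in nhds 0. g z = f z \<Longrightarrow> big_o N g"
  unfolding big_o_def
proof (elim exE)
  fix C assume "\<forall>\<^sub>F z in nhds 0. norm (f z) \<le> C * norm z ^ N" "\<forall>\<^sub>F z in nhds 0. g z = f z"
  then have "\<forall>\<^sub>F z in nhds 0. norm (g z) \<le> C * norm z ^ N" by eventually_elim simp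
  then show "\<exists>C. \<forall>\<^sub>F z in nhds 0. norm (g z) \<le> C * norm z ^ N" by (rule exI)
qed

lemma big_o_form_mult: "u \<in> forms d \<Longrightarrow> big_o N f \<Longrightarrow> big_o (N + d) (\<lambda>z. f z * u z)"
proof -
  assume u: "u \<in> forms d" and "big_o N f"
  then obtain C where C: "\<forall>\<^sub>F z in nhds 0. norm (f z) \<le> C * norm z ^ N" unfolding big_o_def by blast
  let ?K = "\<Sum>k\<le>d. norm (cf d u k)"
  have "\<forall>\<^sub>F z in nhds 0. norm (f z * u z) \<le> (\<bar>C\<bar> * ?K) * norm z ^ (N + d)"
    using C
  proof eventually_elim
    case (elim z)
    have "norm (f z * u z) \<le> (C * norm z ^ N) * (?K * norm z ^ d)"
      unfolding norm_mult
      by (rule mult_mono[OF elim form_bound[OF u]]) (use elim norm_ge_zero[of "f z"] in linarith, simp)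
    also have "\<dots> \<le> (\<bar>C\<bar> * norm z ^ N) * (?K * norm z ^ d)"
      by (intro mult_right_mono mult_nonneg_nonneg sum_nonneg) auto
    finally show ?case by (simp add: power_add mult_ac)
  qed
  then show ?thesis unfolding big_o_def by blast
qed

lemma big_o_hol: "hol h \<Longrightarrow> big_o 0 h"
  using hol_bounded unfolding big_o_def by auto

lemma big_o_mono: "big_o N f \<Longrightarrow> M \<le> N \<Longrightarrow> big_o M f"
proof -
  assume "big_o N f" and MN: "M \<le> N"
  then obtain C where C: "\<forall>\<^sub>F z in nhds 0. norm (f z) \<le> C * norm z ^ N" unfolding big_o_def by blast
  have "\<forall>\<^sub>F z in nhds (0::complex^2). norm z < 1"
    unfolding eventually_nhds_metric by (intro exI[of _ 1]) auto
  with C have "\<forall>\<^sub>F z in nhds 0. norm (f z) \<le> \<bar>C\<bar> * norm z ^ M"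
  proof eventually_elim
    case (elim z)
    have "norm (f z) \<le> \<bar>C\<bar> * norm z ^ N" using elim(1) by (smt (verit) mult_right_mono zero_le_power norm_ge_zero)
    also have "\<dots> \<le> \<bar>C\<bar> * norm z ^ M"
      using elim(2) MN by (intro mult_left_mono power_decreasing) auto
    finally show ?case .
  qed
  then show ?thesis unfolding big_o_def by blast
qed

lemma order_ideal_big_o: "f \<in> order_ideal N \<Longrightarrow> big_o N f"
proof (induction rule: order_ideal.induct)
  case (gen u h f)
  have "big_o (0 + N) (\<lambda>z. h z * u z)" by (rule big_o_form_mult[OF gen(1) big_o_hol[OF gen(2)]])
  then have "big_o N (\<lambda>z. h z * u z)" by simp
  moreover have "\<forall>\<^sub>F z in nhds 0. f z = h z * u z" using gen(3) by (simp add: mult.commute)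
  ultimately show ?case by (rule big_o_cong)
next
  case (sum f g k)
  then show ?case using big_o_cong[OF big_o_add] by blast
qed

text \<open>The homogeneous Taylor components of \<open>f\<close> in degrees below \<open>N\<close>; the values \<open>u i\<close> for \<open>i \<ge> N\<close> are arbitrary
  forms.\<close>

definition jet :: "nat \<Rightarrow> cfun \<Rightarrow> (nat \<Rightarrow> cfun) \<Rightarrow> bool" where
  "jet N f u \<longleftrightarrow> (\<forall>i. u i \<in> forms i) \<and> big_o N (\<lambda>z. f z - (\<Sum>i<N. u i z))"

lemma jet_exists: "hol f \<Longrightarrow> \<exists>u. jet N f u \<and> (\<lambda>z. f z - (\<Sum>i<N. u i z)) \<in> order_ideal N"
  using taylor order_ideal_big_o unfolding jet_def by blast

lemma jet_add:
  assumes "jet N f u" "jet N g v" shows "jet N (\<lambda>z. f z + g z) (\<lambda>i z. u i z + v i z)"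
  using assms big_o_add[of N "\<lambda>z. f z - (\<Sum>i<N. u i z)" "\<lambda>z. g z - (\<Sum>i<N. v i z)"]
  unfolding jet_def by (auto simp: sum.distrib algebra_simps)

lemma jet_scale:
  assumes "jet N f u" shows "jet N (\<lambda>z. c * f z) (\<lambda>i z. c * u i z)"
  using assms big_o_form_mult[OF forms_const[of c], where N = N and f = "\<lambda>z. f z - (\<Sum>i<N. u i z)"]
  unfolding jet_def by (auto simp: sum_distrib_left[symmetric] algebra_simps)

lemma jet_cong: "jet N f u \<Longrightarrow> \<forall>\<^sub>F z in nhds 0. g z = f z \<Longrightarrow> jet N g u"
  unfolding jet_def by (auto elim!: big_o_cong eventually_mono)

lemma jet_form_mult:
  assumes f: "jet N f u" and p: "p \<in> forms d"
  shows "jet (N + d) (\<lambda>z. f z * p z) (\<lambda>i. if d \<le> i then (\<lambda>z. u (i - d) z * p z) else (\<lambda>_. 0))"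
proof -
  have "(\<Sum>i<N + d. (if d \<le> i then (\<lambda>z. u (i - d) z * p z) else (\<lambda>_. 0)) z) = (\<Sum>i<N. u i z) * p z" for z
  proof -
    have "(\<Sum>i<N + d. (if d \<le> i then (\<lambda>z. u (i - d) z * p z) else (\<lambda>_. 0)) z)
      = (\<Sum>i\<in>{d..<N + d}. u (i - d) z * p z)"
      by (rule sum.mono_neutral_cong_right) auto
    also have "\<dots> = (\<Sum>i<N. u i z * p z)"
      by (rule sum.reindex_bij_witness[of _ "\<lambda>i. i + d" "\<lambda>i. i - d"]) auto
    finally show ?thesis by (simp add: sum_distrib_right)
  qed
  moreover have "big_o (N + d) (\<lambda>z. (f z - (\<Sum>i<N. u i z)) * p z)"
    using f big_o_form_mult[OF p] unfolding jet_def by blast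
  moreover have "(\<lambda>z. u (i - d) z * p z) \<in> forms i" if "d \<le> i" for i
    using f that unfolding jet_def by (intro forms_multI[OF _ p]) auto
  ultimately show ?thesis unfolding jet_def by (simp add: left_diff_distrib)
qed

lemma jet_mono:
  assumes f: "jet N f u" and M: "M \<le> N" shows "jet M f u"
proof -
  have u: "u i \<in> forms i" for i using f unfolding jet_def by blast
  \<comment> \<open>The components in degrees from \<open>M\<close> on are themselves of order \<open>M\<close>.\<close>
  have tail: "big_o M (\<lambda>z. \<Sum>i\<in>A. u i z)" if "finite A" "\<And>i. i \<in> A \<Longrightarrow> M \<le> i" for A
    using that
  proof (induction A)
    case empty
    show ?case unfolding big_o_def by (rule exI[of _ 0]) simp
  next
    case (insert i A)
    have "big_o (0 + i) (\<lambda>z. 1 * u i z)"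
      by (rule big_o_form_mult[OF u]) (rule big_o_hol[OF hol_const])
    then have "big_o i (u i)" by simp
    moreover have "M \<le> i" using insert.prems by simp
    ultimately have 1: "big_o M (u i)" by (rule big_o_mono)
    have 2: "big_o M (\<lambda>z. \<Sum>i\<in>A. u i z)" by (rule insert.IH) (use insert.prems in simp)
    have "big_o M (\<lambda>z. u i z + (\<Sum>i\<in>A. u i z))" by (rule big_o_add[OF 1 2])
    then show ?case using insert.hyps by simp
  qed
  have "big_o M (\<lambda>z. \<Sum>i\<in>{M..<N}. u i z)" by (rule tail) auto
  moreover have "big_o M (\<lambda>z. f z - (\<Sum>i<N. u i z))"
    by (rule big_o_mono[OF _ M]) (use f in \<open>simp add: jet_def\<close>)
  have "f z - (\<Sum>i<M. u i z) = (f z - (\<Sum>i<N. u i z)) + (\<Sum>i\<in>{M..<N}. u i z)" for z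
  proof -
    have "{..<N} = {..<M} \<union> {M..<N}" using M by auto
    then have "(\<Sum>i<N. u i z) = (\<Sum>i\<in>{..<M} \<union> {M..<N}. u i z)" by (rule arg_cong)
    also have "\<dots> = (\<Sum>i<M. u i z) + (\<Sum>i\<in>{M..<N}. u i z)"
      by (rule sum.union_disjoint) auto
    finally have "(\<Sum>i<N. u i z) = (\<Sum>i<M. u i z) + (\<Sum>i\<in>{M..<N}. u i z)" .
    then show ?thesis by simp
  qed
  note split = this
  have "big_o M (\<lambda>z. f z - (\<Sum>i<M. u i z))" unfolding split by (rule big_o_add) fact+
  then show ?thesis using u unfolding jet_def by simp
qed

text \<open>On a ray the sum is a polynomial of degree less than \<open>N\<close> in one variable that vanishes to order \<open>N\<close>; its
  coefficients vanish one after the other.\<close>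

lemma big_o_homogeneous_zero:
  assumes w: "\<And>i. w i \<in> forms i" and O: "big_o N (\<lambda>z. \<Sum>i<N. w i z)" and i: "i < N"
  shows "w i = (\<lambda>_. 0)"
proof
  fix z :: "complex^2"
  obtain C where C: "\<forall>\<^sub>F z in nhds 0. norm (\<Sum>i<N. w i z) \<le> C * norm z ^ N"
    using O unfolding big_o_def by blast
  have "isCont (\<lambda>s::complex. s *s z) 0"
  proof -
    have "(\<lambda>s::complex. s *s z) = (\<lambda>(a, b). mk2 a b) \<circ> (\<lambda>s. (s * z $ 1, s * z $ 2))"
      by (auto simp: vec2_eq_iff)
    then show ?thesis
      by (simp only:) (intro continuous_at_compose linear_continuous_at[OF bounded_linear_mk2] continuous_intros)
  qed
  then have "filterlim (\<lambda>s::complex. s *s z) (nhds (0 *s z)) (nhds 0)"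
    by (rule isCont_tendsto_nhds)
  then have "filterlim (\<lambda>s::complex. s *s z) (nhds 0) (nhds 0)" by simp
  from eventually_compose_filterlim[OF C this]
  have "\<forall>\<^sub>F s in nhds (0::complex). norm (\<Sum>i<N. w i (s *s z)) \<le> C * norm (s *s z) ^ N" .
  moreover have n: "norm (s *s z) = norm s * norm z" for s :: complex
    by (simp add: norm_vec_def norm_mult L2_set_right_distrib)
  ultimately have ev: "\<forall>\<^sub>F s in nhds (0::complex). norm (\<Sum>i<N. w i z * s ^ i) \<le> (C * norm z ^ N) * norm s ^ N"
    by (simp add: form_scale_arg[OF w] n power_mult_distrib mult_ac)
  have "i < N \<longrightarrow> w i z = 0" for i
  proof (induction i rule: less_induct)
    case (less i)
    show ?case
    proof
      assume i: "i < N"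
      define q where "q s = (\<Sum>j\<in>{i..<N}. w j z * s ^ (j - i))" for s
      have q: "(\<Sum>j<N. w j z * s ^ j) = s ^ i * q s" for s
      proof -
        have "(\<Sum>j<N. w j z * s ^ j) = (\<Sum>j\<in>{i..<N}. w j z * s ^ j)"
          by (rule sum.mono_neutral_right) (use less in auto)
        also have "\<dots> = (\<Sum>j\<in>{i..<N}. s ^ i * (w j z * s ^ (j - i)))"
          by (rule sum.cong) (auto simp: power_add[symmetric] mult.left_commute)
        finally show ?thesis by (simp add: q_def sum_distrib_left)
      qed
      have q0: "q 0 = w i z"
      proof -
        have "q 0 = (\<Sum>j\<in>{i..<N}. if j = i then w i z else 0)"
          unfolding q_def by (rule sum.cong) auto
        then show ?thesis using i by simp
      qed
      have lim: "(q \<longlongrightarrow> q 0) (at 0)"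
        unfolding q_def[abs_def] by (intro tendsto_intros)
      have "\<forall>\<^sub>F s in at 0. norm (q s) \<le> (C * norm z ^ N) * norm s ^ (N - i)"
      proof -
        have "\<forall>\<^sub>F s in at (0::complex). norm (\<Sum>i<N. w i z * s ^ i) \<le> (C * norm z ^ N) * norm s ^ N"
          using ev by (simp add: eventually_nhds_conv_at)
        moreover have "\<forall>\<^sub>F s in at (0::complex). s \<noteq> 0" by (simp add: eventually_at_filter)
        ultimately show ?thesis
        proof eventually_elim
          case (elim s)
          have "norm s ^ N = norm s ^ i * norm s ^ (N - i)" using i by (simp flip: power_add)
          then have "norm s ^ i * norm (q s) \<le> norm s ^ i * ((C * norm z ^ N) * norm s ^ (N - i))"
            using elim(1) unfolding q norm_mult norm_power by (simp add: mult_ac)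
          then show ?case using elim(2) by (simp add: mult_le_cancel_left_pos)
        qed
      qed
      moreover have "((\<lambda>s::complex. (C * norm z ^ N) * norm s ^ (N - i)) \<longlongrightarrow> (C * norm z ^ N) * norm (0::complex) ^ (N - i)) (at 0)"
        by (intro tendsto_intros)
      then have "((\<lambda>s::complex. (C * norm z ^ N) * norm s ^ (N - i)) \<longlongrightarrow> 0) (at 0)"
        using i by (simp add: power_0_left)
      ultimately have "(q \<longlongrightarrow> 0) (at 0)" by (rule Lim_null_comparison)
      then have "q 0 = 0" using lim tendsto_unique trivial_limit_at by blast
      then show "w i z = 0" using q0 by simp
    qed
  qed
  then show "w i z = 0" using i by blast
qed

lemma jet_unique:
  assumes "jet N f u" "jet N f v" "i < N" shows "u i = v i"
proof -
  have "big_o N (\<lambda>z. \<Sum>i<N. u i z + (-1) * v i z)"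
  proof -
    have "jet N (\<lambda>z. f z + (-1) * f z) (\<lambda>i z. u i z + (-1) * v i z)"
      by (intro jet_add jet_scale assms)
    then have "big_o N (\<lambda>z. 0 - (\<Sum>i<N. u i z + (-1) * v i z))" unfolding jet_def by simp
    from big_o_form_mult[OF forms_const[of "-1"] this] show ?thesis by simp
  qed
  moreover have "(\<lambda>z. u i z + (-1) * v i z) \<in> forms i" for i
    using assms(1,2) unfolding jet_def by (intro forms_add forms_scale) auto
  ultimately have "(\<lambda>z. u i z + (-1) * v i z) = (\<lambda>_. 0)"
    using assms(3) by (intro big_o_homogeneous_zero[where w = "\<lambda>i z. u i z + (-1) * v i z"]) auto
  then show ?thesis by (auto simp: fun_eq_iff dest!: spec)
qed

lemma jet_form: "p \<in> forms d \<Longrightarrow> d < N \<Longrightarrow> jet N p (\<lambda>i. if i = d then p else (\<lambda>_. 0))"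
proof -
  assume p: "p \<in> forms d" and d: "d < N"
  have "(\<Sum>i<N. (if i = d then p else (\<lambda>_. 0)) z) = p z" for z
  proof -
    have "(\<Sum>i<N. (if i = d then p else (\<lambda>_. 0)) z) = (\<Sum>i<N. if i = d then p z else 0)"
      by (rule sum.cong) auto
    then show ?thesis using d by simp
  qed
  then show ?thesis using p unfolding jet_def big_o_def by (auto intro!: exI[of _ 0])
qed

section \<open>The Jacobian ideal in terms of germs\<close>

definition in_jac :: "cfun \<Rightarrow> cfun \<Rightarrow> bool" where
  "in_jac Q f \<longleftrightarrow> (\<exists>a c. hol a \<and> hol c \<and> (\<forall>\<^sub>F z in nhds 0. f z = a z * pd 1 Q z + c z * pd 2 Q z))"

lemma in_jacI:
  "hol a \<Longrightarrow> hol c \<Longrightarrow> \<forall>\<^sub>F z in nhds 0. f z = a z * pd 1 Q z + c z * pd 2 Q z \<Longrightarrow> in_jac Q f"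
  unfolding in_jac_def by blast

lemma forms_pd6: "Q \<in> forms 6 \<Longrightarrow> pd i Q \<in> forms 5"
  using forms_pd[of Q 6 i] by simp

lemma in_jac_hol: "Q \<in> forms 6 \<Longrightarrow> in_jac Q f \<Longrightarrow> hol f"
proof -
  assume Q: "Q \<in> forms 6" and "in_jac Q f"
  then obtain a c where ac: "hol a" "hol c" "\<forall>\<^sub>F z in nhds 0. f z = a z * pd 1 Q z + c z * pd 2 Q z"
    unfolding in_jac_def by blast
  have "hol (\<lambda>z. a z * pd 1 Q z + c z * pd 2 Q z)"
    by (intro hol_add hol_mult ac hol_form[OF forms_pd6[OF Q]])
  then show ?thesis by (rule hol_cong[OF _ ac(3)])
qed

lemma in_jac_add: "in_jac Q f \<Longrightarrow> in_jac Q g \<Longrightarrow> in_jac Q (\<lambda>z. f z + g z)"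
proof -
  assume "in_jac Q f" "in_jac Q g"
  then obtain a c b d where h: "hol a" "hol c" "hol b" "hol d"
    and e: "\<forall>\<^sub>F z in nhds 0. f z = a z * pd 1 Q z + c z * pd 2 Q z"
      "\<forall>\<^sub>F z in nhds 0. g z = b z * pd 1 Q z + d z * pd 2 Q z"
    unfolding in_jac_def by blast
  show ?thesis
  proof (rule in_jacI[OF hol_add[OF h(1,3)] hol_add[OF h(2,4)]])
    show "\<forall>\<^sub>F z in nhds 0. f z + g z = (a z + b z) * pd 1 Q z + (c z + d z) * pd 2 Q z"
      using e by eventually_elim (simp add: algebra_simps)
  qed
qed

lemma in_jac_mult: "in_jac Q f \<Longrightarrow> hol g \<Longrightarrow> in_jac Q (\<lambda>z. g z * f z)"
proof -
  assume "in_jac Q f" and g: "hol g"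
  then obtain a c where h: "hol a" "hol c"
    and e: "\<forall>\<^sub>F z in nhds 0. f z = a z * pd 1 Q z + c z * pd 2 Q z"
    unfolding in_jac_def by blast
  show ?thesis
  proof (rule in_jacI[OF hol_mult[OF g h(1)] hol_mult[OF g h(2)]])
    show "\<forall>\<^sub>F z in nhds 0. g z * f z = (g z * a z) * pd 1 Q z + (g z * c z) * pd 2 Q z"
      using e by eventually_elim (simp add: algebra_simps)
  qed
qed

lemma in_jac_cong: "in_jac Q f \<Longrightarrow> \<forall>\<^sub>F z in nhds 0. g z = f z \<Longrightarrow> in_jac Q g"
proof -
  assume "in_jac Q f" and g: "\<forall>\<^sub>F z in nhds 0. g z = f z"
  then obtain a c where h: "hol a" "hol c"
    and e: "\<forall>\<^sub>F z in nhds 0. f z = a z * pd 1 Q z + c z * pd 2 Q z"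
    unfolding in_jac_def by blast
  show ?thesis
  proof (rule in_jacI[OF h])
    show "\<forall>\<^sub>F z in nhds 0. g z = a z * pd 1 Q z + c z * pd 2 Q z"
      using e g by eventually_elim simp
  qed
qed

lemma in_jac_0: "in_jac Q (\<lambda>_. 0)"
  by (rule in_jacI[of "\<lambda>_. 0" "\<lambda>_. 0"]) simp_all

lemma in_jac_sum: "(\<And>i. i \<in> A \<Longrightarrow> in_jac Q (f i)) \<Longrightarrow> in_jac Q (\<lambda>z. \<Sum>i\<in>A. f i z)"
  by (induction A rule: infinite_finite_induct) (auto intro: in_jac_0 in_jac_add)

lemma in_jac_diff: "in_jac Q f \<Longrightarrow> in_jac Q g \<Longrightarrow> in_jac Q (\<lambda>z. f z - g z)"
  using in_jac_add[OF _ in_jac_mult[OF _ hol_const[of "-1"]], of Q f g] by simp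

lemma form_at_0: "(u :: cfun) \<in> forms d \<Longrightarrow> d > 0 \<Longrightarrow> u 0 = 0"
  using form_scale_arg[of u d 0 0] by (simp add: power_0_left)

lemma in_jac_at_0: "Q \<in> forms 6 \<Longrightarrow> in_jac Q f \<Longrightarrow> f 0 = 0"
proof -
  assume Q: "Q \<in> forms 6" and "in_jac Q f"
  then obtain a c where "\<forall>\<^sub>F z in nhds 0. f z = a z * pd 1 Q z + c z * pd 2 Q z"
    unfolding in_jac_def by blast
  then have "f 0 = a 0 * pd 1 Q 0 + c 0 * pd 2 Q 0" by (rule eventually_nhds_x_imp_x)
  then show ?thesis using form_at_0[OF forms_pd6[OF Q]] by simp
qed

text \<open>By the Sylvester determinant, the forms of degree 9 that generate the order ideal lie in the Jacobian
  ideal.\<close>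

lemma order_ideal_in_jac:
  assumes Q: "Q \<in> forms 6" "sylvester Q \<noteq> 0" and "f \<in> order_ideal 9"
  shows "in_jac Q f"
  using assms(3)
proof induction
  case (gen u h f)
  obtain a c where ac: "a \<in> forms 4" "c \<in> forms 4" "u = (\<lambda>z. a z * pd 1 Q z + c z * pd 2 Q z)"
    using sylvester_span[OF Q gen(1)] .
  show ?case
  proof (rule in_jacI[OF hol_mult[OF hol_form[OF ac(1)] gen(2)] hol_mult[OF hol_form[OF ac(2)] gen(2)]])
    show "\<forall>\<^sub>F z in nhds 0. f z = (a z * h z) * pd 1 Q z + (c z * h z) * pd 2 Q z"
      using gen(3) by eventually_elim (simp add: ac(3) algebra_simps)
  qed
next
  case (sum f g k)
  show ?case by (rule in_jac_cong[OF in_jac_add[OF sum.IH] sum.hyps(3)])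
qed

text \<open>The component of degree \<open>k\<close> of the ideal generated by the two partial derivatives in the polynomial
  ring.\<close>

definition graded_jac :: "cfun \<Rightarrow> nat \<Rightarrow> cfun \<Rightarrow> bool" where
  "graded_jac Q k u \<longleftrightarrow> (if k < 5 then u = (\<lambda>_. 0)
    else (\<exists>a\<in>forms (k - 5). \<exists>c\<in>forms (k - 5). u = (\<lambda>z. a z * pd 1 Q z + c z * pd 2 Q z)))"

lemma graded_jac_in_jac: "graded_jac Q k u \<Longrightarrow> in_jac Q u"
proof (cases "k < 5")
  case False
  assume "graded_jac Q k u"
  with False obtain a c where "a \<in> forms (k - 5)" "c \<in> forms (k - 5)" "u = (\<lambda>z. a z * pd 1 Q z + c z * pd 2 Q z)"
    unfolding graded_jac_def by auto
  then show ?thesis by (intro in_jacI[of a c]) (auto intro: hol_form)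
qed (simp add: graded_jac_def in_jac_0)

text \<open>The Taylor components of the two coefficients give the components of the combination, because the
  partial derivatives are homogeneous.\<close>

lemma in_jac_components:
  assumes Q: "Q \<in> forms 6" and f: "in_jac Q f" and u: "jet 9 f u" and k: "k < 9"
  shows "graded_jac Q k (u k)"
proof -
  obtain a c where h: "hol a" "hol c"
    and e: "\<forall>\<^sub>F z in nhds 0. f z = a z * pd 1 Q z + c z * pd 2 Q z"
    using f unfolding in_jac_def by blast
  obtain v w where vw: "jet 4 a v" "jet 4 c w" using jet_exists h by blast
  have F: "v i \<in> forms i" "w i \<in> forms i" for i using vw unfolding jet_def by auto
  have "jet (4 + 5) (\<lambda>z. a z * pd 1 Q z + c z * pd 2 Q z)
    (\<lambda>i z. (if 5 \<le> i then (\<lambda>z. v (i - 5) z * pd 1 Q z) else (\<lambda>_. 0)) z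
      + (if 5 \<le> i then (\<lambda>z. w (i - 5) z * pd 2 Q z) else (\<lambda>_. 0)) z)"
    by (intro jet_add jet_form_mult vw forms_pd6 Q)
  then have "jet 9 f (\<lambda>i z. (if 5 \<le> i then (\<lambda>z. v (i - 5) z * pd 1 Q z) else (\<lambda>_. 0)) z
      + (if 5 \<le> i then (\<lambda>z. w (i - 5) z * pd 2 Q z) else (\<lambda>_. 0)) z)"
    by (intro jet_cong[OF _ e]) simp
  from jet_unique[OF u this k] have "u k = (\<lambda>z. (if 5 \<le> k then (\<lambda>z. v (k - 5) z * pd 1 Q z) else (\<lambda>_. 0)) z
      + (if 5 \<le> k then (\<lambda>z. w (k - 5) z * pd 2 Q z) else (\<lambda>_. 0)) z)" .
  note uk = this
  show ?thesis
  proof (cases "k < 5")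
    case True
    then show ?thesis unfolding graded_jac_def using uk by simp
  next
    case False
    then have "u k = (\<lambda>z. v (k - 5) z * pd 1 Q z + w (k - 5) z * pd 2 Q z)" using uk by simp
    then show ?thesis unfolding graded_jac_def using F False by auto
  qed
qed

subsection \<open>The socle of the Jacobian algebra\<close>

lemma cf_shift:
  assumes "(u :: cfun) \<in> forms d" "k \<le> d"
  shows "cf (Suc d) (\<lambda>z. z $ 1 * u z) (Suc k) = cf d u k"
    "cf (Suc d) (\<lambda>z. z $ 1 * u z) 0 = 0"
    "cf (Suc d) (\<lambda>z. z $ 2 * u z) k = cf d u k"
    "cf (Suc d) (\<lambda>z. z $ 2 * u z) (Suc d) = 0"
proof -
  have 1: "z $ 1 * u z = (\<Sum>l\<le>Suc d. (case l of 0 \<Rightarrow> 0 | Suc m \<Rightarrow> cf d u m) * bmono (Suc d) l z)" for z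
    by (subst form_expand[OF assms(1)], subst sum.atMost_Suc_shift)
      (auto simp: sum_distrib_left bmono_def intro!: sum.cong)
  have 2: "z $ 2 * u z = (\<Sum>l\<le>Suc d. (if l \<le> d then cf d u l else 0) * bmono (Suc d) l z)" for z
    by (subst form_expand[OF assms(1)])
      (auto simp: sum_distrib_left bmono_def Suc_diff_le intro!: sum.cong)
  show "cf (Suc d) (\<lambda>z. z $ 1 * u z) (Suc k) = cf d u k"
    using cf_eqI[OF 1, of "Suc k"] assms(2) by simp
  show "cf (Suc d) (\<lambda>z. z $ 1 * u z) 0 = 0" using cf_eqI[OF 1, of 0] by simp
  show "cf (Suc d) (\<lambda>z. z $ 2 * u z) k = cf d u k"
    using cf_eqI[OF 2, of k] assms(2) by simp
  show "cf (Suc d) (\<lambda>z. z $ 2 * u z) (Suc d) = 0" using cf_eqI[OF 2, of "Suc d"] by simp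
qed

lemma cancel_coord1:
  assumes u: "(u :: cfun) \<in> forms d" and z: "\<And>z. z $ 1 * u z = 0" shows "u = (\<lambda>_. 0)"
proof (rule form_eqI[OF u forms_zero])
  fix k assume "k \<le> d"
  from cf_shift(1)[OF u this] show "cf d u k = cf d (\<lambda>_. 0) k" by (simp add: z)
qed

lemma cancel_coord1_power:
  assumes u: "(u :: cfun) \<in> forms d" and z: "\<And>z. (z $ 1) ^ m * u z = 0" shows "u = (\<lambda>_. 0)"
  using z
proof (induction m)
  case 0
  then show ?case by auto
next
  case (Suc m)
  have F: "(\<lambda>z. (z $ 1) ^ m * u z) \<in> forms (m * 1 + d)"
    by (rule forms_mult[OF forms_power[OF forms_coord] u])
  have "(\<lambda>z. (z $ 1) ^ m * u z) = (\<lambda>_. 0)"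
    by (rule cancel_coord1[OF F]) (use Suc.prems in \<open>simp add: mult.assoc\<close>)
  then show ?case by (intro Suc.IH) (rule fun_cong)
qed

lemma coprime_coords:
  assumes a: "(a :: cfun) \<in> forms r" "(b :: cfun) \<in> forms r" and eq: "\<And>z. z $ 2 * a z = z $ 1 * b z"
  shows "if r = 0 then a = (\<lambda>_. 0) else \<exists>e\<in>forms (r - 1). a = (\<lambda>z. z $ 1 * e z)"
proof -
  have e: "(\<lambda>z. z $ 2 * a z) = (\<lambda>z. z $ 1 * b z)" using eq by auto
  have a0: "cf r a 0 = 0"
    using cf_shift(3)[OF a(1), of 0] cf_shift(2)[OF a(2), of 0] unfolding e by simp
  show ?thesis
  proof (cases r)
    case 0
    then have "a = (\<lambda>_. 0)" using a0 by (intro form_eqI[OF a(1)]) auto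
    then show ?thesis using 0 by simp
  next
    case (Suc m)
    let ?e = "\<lambda>z. \<Sum>k\<le>m. cf r a (Suc k) * bmono m k z"
    have "a z = z $ 1 * ?e z" for z
      by (subst form_expand[OF a(1)], unfold Suc, subst sum.atMost_Suc_shift)
        (use a0 in \<open>auto simp: Suc sum_distrib_left bmono_def intro!: sum.cong\<close>)
    then have "a = (\<lambda>z. z $ 1 * ?e z)" by auto
    then show ?thesis using Suc by (auto intro!: bexI[of _ ?e])
  qed
qed

lemma sylvester_inj_low:
  assumes Q: "Q \<in> forms 6" "sylvester Q \<noteq> 0" and ac: "a \<in> forms j" "c \<in> forms j" "j \<le> 4"
    and eq: "\<And>z. a z * pd 1 Q z + c z * pd 2 Q z = 0"
  shows "a = (\<lambda>_. 0)" "c = (\<lambda>_. 0)"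
proof -
  have F: "(\<lambda>z. (z $ 1) ^ (4 - j) * u z) \<in> forms 4" if "u \<in> forms j" for u :: cfun
    using forms_mult[OF forms_power[OF forms_coord[of 1], of "4 - j"] that] ac(3) by simp
  have "(z $ 1) ^ (4 - j) * a z * pd 1 Q z + (z $ 1) ^ (4 - j) * c z * pd 2 Q z = 0" for z
    using eq[of z] by (simp add: mult.assoc flip: distrib_left)
  note z = sylvester_inj[OF Q F[OF ac(1)] F[OF ac(2)] this]
  show "a = (\<lambda>_. 0)" by (rule cancel_coord1_power[OF ac(1)]) (rule fun_cong[OF z(1)])
  show "c = (\<lambda>_. 0)" by (rule cancel_coord1_power[OF ac(2)]) (rule fun_cong[OF z(2)])
qed

text \<open>The partial derivatives have no relation with coefficients of degree at most four. Comparing the two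
  representations of \<open>z\<^sub>1 z\<^sub>2 u\<close> therefore gives proportional coefficients, and the common factor represents
  \<open>u\<close> itself. The bound on \<open>k\<close> keeps the degrees of the coefficients within this range.\<close>

lemma graded_socle:
  assumes Q: "Q \<in> forms 6" "sylvester Q \<noteq> 0" and u: "u \<in> forms k" "k < 8"
    and j: "graded_jac Q (Suc k) (\<lambda>z. z $ 1 * u z)" "graded_jac Q (Suc k) (\<lambda>z. z $ 2 * u z)"
  shows "graded_jac Q k u"
proof (cases "k < 4")
  case True
  then have "(\<lambda>z. z $ 1 * u z) = (\<lambda>_. 0)" using j(1) unfolding graded_jac_def by simp
  then have "u = (\<lambda>_. 0)" by (intro cancel_coord1[OF u(1)]) (rule fun_cong)
  then show ?thesis using True unfolding graded_jac_def by simp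
next
  case False
  define r where "r = k - 4"
  have r: "Suc k - 5 = r" "\<not> Suc k < 5" "r \<le> 3" using False u(2) by (auto simp: r_def)
  obtain a c where ac: "a \<in> forms r" "c \<in> forms r" "(\<lambda>z. z $ 1 * u z) = (\<lambda>z. a z * pd 1 Q z + c z * pd 2 Q z)"
    using j(1) unfolding graded_jac_def r(1) using r(2) by auto
  obtain b d where bd: "b \<in> forms r" "d \<in> forms r" "(\<lambda>z. z $ 2 * u z) = (\<lambda>z. b z * pd 1 Q z + d z * pd 2 Q z)"
    using j(2) unfolding graded_jac_def r(1) using r(2) by auto
  have F: "(\<lambda>z. z $ 2 * x z - z $ 1 * y z) \<in> forms (Suc r)" if "x \<in> forms r" "y \<in> forms r" for x y :: cfun
    by (rule forms_diff[OF forms_multI[OF forms_coord that(1)] forms_multI[OF forms_coord that(2)]]) simp_all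
  have "(z $ 2 * a z - z $ 1 * b z) * pd 1 Q z + (z $ 2 * c z - z $ 1 * d z) * pd 2 Q z = 0" for z
  proof -
    have "(z $ 2 * a z - z $ 1 * b z) * pd 1 Q z + (z $ 2 * c z - z $ 1 * d z) * pd 2 Q z
      = z $ 2 * (a z * pd 1 Q z + c z * pd 2 Q z) - z $ 1 * (b z * pd 1 Q z + d z * pd 2 Q z)"
      by (simp add: algebra_simps)
    also have "\<dots> = z $ 2 * (z $ 1 * u z) - z $ 1 * (z $ 2 * u z)"
      using fun_cong[OF ac(3), of z] fun_cong[OF bd(3), of z] by simp
    finally show ?thesis by simp
  qed
  note z = sylvester_inj_low[OF Q F[OF ac(1) bd(1)] F[OF ac(2) bd(2)] _ this]
  have r4: "Suc r \<le> 4" using r(3) by simp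
  have "z $ 2 * a z = z $ 1 * b z" "z $ 2 * c z = z $ 1 * d z" for z
    using fun_cong[OF z(1)[OF r4], of z] fun_cong[OF z(2)[OF r4], of z] by simp_all
  note e = coprime_coords[OF ac(1) bd(1) this(1)] coprime_coords[OF ac(2) bd(2) this(2)]
  show ?thesis
  proof (cases "r = 0")
    case True
    then have "a = (\<lambda>_. 0)" "c = (\<lambda>_. 0)" using e by auto
    then have "u = (\<lambda>_. 0)" using ac(3) by (intro cancel_coord1[OF u(1)]) (auto dest: fun_cong)
    then show ?thesis using True False u(2) unfolding graded_jac_def r_def by simp
  next
    case False
    then obtain e1 e2 where e12: "e1 \<in> forms (r - 1)" "e2 \<in> forms (r - 1)"
      "a = (\<lambda>z. z $ 1 * e1 z)" "c = (\<lambda>z. z $ 1 * e2 z)" using e by auto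
    have k: "k - 5 = r - 1" "\<not> k < 5" using False by (auto simp: r_def)
    let ?v = "\<lambda>z. e1 z * pd 1 Q z + e2 z * pd 2 Q z"
    have vF: "?v \<in> forms k"
      by (rule forms_add[OF forms_multI[OF e12(1) forms_pd6[OF Q(1)]] forms_multI[OF e12(2) forms_pd6[OF Q(1)]]])
        (use k False in \<open>auto simp: r_def\<close>)
    have "(\<lambda>z. u z - ?v z) = (\<lambda>_. 0)"
    proof (rule cancel_coord1[OF forms_diff[OF u(1) vF]])
      fix z :: "complex^2"
      have "z $ 1 * (u z - ?v z) = z $ 1 * u z - (a z * pd 1 Q z + c z * pd 2 Q z)"
        unfolding e12(3,4) by (simp add: algebra_simps)
      then show "z $ 1 * (u z - ?v z) = 0" using fun_cong[OF ac(3), of z] by simp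
    qed
    then have "u z = ?v z" for z by (simp add: fun_eq_iff)
    then have "u = ?v" by auto
    then show ?thesis unfolding graded_jac_def k(1) using k(2) e12(1,2) by auto
  qed
qed

lemma jet_coord_mult:
  assumes u: "jet 9 f u"
  shows "jet 9 (\<lambda>z. z $ i * f z) (\<lambda>k. if 1 \<le> k then (\<lambda>z. u (k - 1) z * z $ i) else (\<lambda>_. 0))"
proof -
  have "jet (9 + 1) (\<lambda>z. f z * z $ i) (\<lambda>k. if 1 \<le> k then (\<lambda>z. u (k - 1) z * z $ i) else (\<lambda>_. 0))"
    by (rule jet_form_mult[OF u forms_coord])
  then have "jet 9 (\<lambda>z. f z * z $ i) (\<lambda>k. if 1 \<le> k then (\<lambda>z. u (k - 1) z * z $ i) else (\<lambda>_. 0))"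
    by (rule jet_mono) simp
  then show ?thesis by (simp only: mult.commute)
qed

text \<open>By \<open>graded_socle\<close> all Taylor components of \<open>f\<close> in degrees below 8 lie in the ideal, and so does
  everything of order at least 9.\<close>

lemma socle_is_top_degree:
  assumes Q: "Q \<in> forms 6" "sylvester Q \<noteq> 0" and f: "hol f"
    and j: "\<And>i. in_jac Q (\<lambda>z. z $ i * f z)"
  shows "\<exists>v\<in>forms 8. in_jac Q (\<lambda>z. f z - v z)"
proof -
  obtain u where u: "jet 9 f u" "(\<lambda>z. f z - (\<Sum>i<9. u i z)) \<in> order_ideal 9"
    using jet_exists[OF f] by blast
  have F: "u k \<in> forms k" for k using u(1) unfolding jet_def by blast
  have "graded_jac Q k (u k)" if k: "k < 8" for k
  proof (rule graded_socle[OF Q F k])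
    have "graded_jac Q (Suc k) (\<lambda>z. z $ i * u k z)" for i
      using in_jac_components[OF Q(1) j jet_coord_mult[OF u(1)], of "Suc k"] k by (simp add: mult.commute)
    then show "graded_jac Q (Suc k) (\<lambda>z. z $ 1 * u k z)" "graded_jac Q (Suc k) (\<lambda>z. z $ 2 * u k z)" by auto
  qed
  then have "in_jac Q (\<lambda>z. \<Sum>k<8. u k z)" by (intro in_jac_sum) (auto intro: graded_jac_in_jac)
  from in_jac_add[OF order_ideal_in_jac[OF Q u(2)] this]
  have "in_jac Q (\<lambda>z. f z - u 8 z)"
    by (rule in_jac_cong) (simp add: eval_nat_numeral)
  then show ?thesis using F by blast
qed

lemma top_degree_in_socle:
  assumes Q: "Q \<in> forms 6" "sylvester Q \<noteq> 0" and v: "v \<in> forms 8" and f: "hol f" "f 0 = 0"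
  shows "in_jac Q (\<lambda>z. v z * f z)"
proof -
  obtain h1 h2 where h: "hol h1" "hol h2" "\<forall>\<^sub>F z in nhds 0. f z = f 0 + z $ 1 * h1 z + z $ 2 * h2 z"
    using hadamard[OF f(1)] .
  have F: "(\<lambda>z. v z * z $ i) \<in> forms 9" for i using forms_mult[OF v forms_coord] by simp
  have "(\<lambda>z. v z * f z) \<in> order_ideal 9"
  proof (rule order_ideal.sum)
    show "(\<lambda>z. (v z * z $ 1) * h1 z) \<in> order_ideal 9" by (rule order_ideal.gen[OF F[of 1] h(1)]) simp
    show "(\<lambda>z. (v z * z $ 2) * h2 z) \<in> order_ideal 9" by (rule order_ideal.gen[OF F[of 2] h(2)]) simp
    show "\<forall>\<^sub>F z in nhds 0. v z * f z = (v z * z $ 1) * h1 z + (v z * z $ 2) * h2 z"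
      using h(3) by eventually_elim (simp add: f(2) algebra_simps)
  qed
  then show ?thesis by (rule order_ideal_in_jac[OF Q])
qed

subsection \<open>The relations and the Jacobian ideal\<close>

lemma relation_form_in_jac:
  assumes Q: "Q \<in> forms 6" and i: "i < 8"
  shows "in_jac Q (relation_form Q i)"
proof (cases "i < 3")
  case True
  have m: "bmono 2 i \<in> forms 2" using True by simp
  show ?thesis
  proof (rule in_jacI)
    show "hol (\<lambda>z. (1 / 6) * bmono 2 i z * z $ 1)" "hol (\<lambda>z. (1 / 6) * bmono 2 i z * z $ 2)"
      by (intro hol_mult hol_const hol_form[OF m] hol_coord)+
    have "relation_form Q i z = (1 / 6) * bmono 2 i z * z $ 1 * pd 1 Q z + (1 / 6) * bmono 2 i z * z $ 2 * pd 2 Q z" for z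
    proof -
      have e: "Q z = (1 / 6) * (z $ 1 * pd 1 Q z + z $ 2 * pd 2 Q z)" using euler_relation[OF Q, of z] by simp
      have "relation_form Q i z = bmono 2 i z * Q z" using True by (simp add: relation_form_def)
      also have "\<dots> = bmono 2 i z * ((1 / 6) * (z $ 1 * pd 1 Q z + z $ 2 * pd 2 Q z))" by (simp only: e)
      finally show ?thesis by (simp add: algebra_simps)
    qed
    then show "\<forall>\<^sub>F z in nhds 0. relation_form Q i z = (1 / 6) * bmono 2 i z * z $ 1 * pd 1 Q z
        + (1 / 6) * bmono 2 i z * z $ 2 * pd 2 Q z" by simp
  qed
next
  case False
  have m: "bmono 4 (i - 3) \<in> forms 4" using i by simp
  show ?thesis
  proof (rule in_jacI)
    show "hol (\<lambda>z. (-1) * pd 2 (bmono 4 (i - 3)) z)" by (intro hol_mult hol_const hol_form[OF forms_pd[OF m]])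
    show "hol (pd 1 (bmono 4 (i - 3)))" by (rule hol_form[OF forms_pd[OF m]])
  qed (use False in \<open>simp add: relation_form_def bracket_def\<close>)
qed

text \<open>By Euler's relation, \<open>4 s Q\<^sub>x = 6 s\<^sub>x Q - {y s, Q}\<close> and \<open>4 s Q\<^sub>y = 6 s\<^sub>y Q + {x s, Q}\<close> for every cubic form \<open>s\<close>.\<close>

lemma related_jacobian:
  assumes Q: "Q \<in> forms 6" and B: "related Q B" and s: "s \<in> forms 3"
  shows "apolar 8 (\<lambda>z. s z * pd i Q z) B = 0"
proof -
  have E: "z $ 1 * pd 1 Q z + z $ 2 * pd 2 Q z = 6 * Q z" for z using euler_relation[OF Q, of z] by simp
  have bracket: "apolar 8 (bracket (bmono 4 j) Q) B = 0" if "j \<le> 4" for j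
    by (rule related_bracket[OF B]) (use that in simp)
  have mul: "apolar 8 (\<lambda>z. bmono 2 j z * Q z) B = 0" if "j \<le> 2" for j
    by (rule related_mult[OF B]) (use that in simp)
  have 1: "apolar 8 (\<lambda>z. bmono 3 j z * pd 1 Q z) B = 0" if j: "j \<le> 3" for j
  proof -
    have m: "of_nat j * (bmono 2 (j - 1) z * (z $ 1 * x)) = of_nat j * (bmono 3 j z * x)"
      "of_nat j * (bmono 2 (j - 1) z * (z $ 2 * x)) = of_nat j * (bmono 3 (j - 1) z * x)" for z x
      using j by (cases j; simp add: bmono_def Suc_diff_le numeral_2_eq_2 numeral_3_eq_3; fail)+
    have "4 * (bmono 3 j z * pd 1 Q z) = 6 * of_nat j * (bmono 2 (j - 1) z * Q z) + (-1) * bracket (bmono 4 j) Q z" for z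
    proof -
      have "6 * of_nat j * (bmono 2 (j - 1) z * Q z) = of_nat j * (bmono 2 (j - 1) z * (6 * Q z))" by (simp only: mult_ac)
      also have "\<dots> = of_nat j * (bmono 2 (j - 1) z * (z $ 1 * pd 1 Q z)) + of_nat j * (bmono 2 (j - 1) z * (z $ 2 * pd 2 Q z))"
        unfolding E[of z, symmetric] by (simp only: distrib_left)
      finally have "6 * of_nat j * (bmono 2 (j - 1) z * Q z)
        = of_nat j * (bmono 2 (j - 1) z * (z $ 1 * pd 1 Q z)) + of_nat j * (bmono 2 (j - 1) z * (z $ 2 * pd 2 Q z))" .
      moreover have "bracket (bmono 4 j) Q z = of_nat j * (bmono 3 (j - 1) z * pd 2 Q z) - (4 - of_nat j) * (bmono 3 j z * pd 1 Q z)"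
        using j by (simp add: bracket_def pd_bmono of_nat_diff)
      ultimately show ?thesis unfolding m by (simp add: algebra_simps)
    qed
    then have "4 * apolar 8 (\<lambda>z. bmono 3 j z * pd 1 Q z) B
      = 6 * of_nat j * apolar 8 (\<lambda>z. bmono 2 (j - 1) z * Q z) B + (-1) * apolar 8 (bracket (bmono 4 j) Q) B"
      by (simp only: apolar_scale_left[symmetric] apolar_add_left[symmetric])
    then show ?thesis using bracket[of j] mul[of "j - 1"] j by simp
  qed
  have 2: "apolar 8 (\<lambda>z. bmono 3 j z * pd 2 Q z) B = 0" if j: "j \<le> 3" for j
  proof -
    have m: "of_nat (3 - j) * (bmono 2 j z * (z $ 1 * x)) = of_nat (3 - j) * (bmono 3 (Suc j) z * x)"
      "of_nat (3 - j) * (bmono 2 j z * (z $ 2 * x)) = of_nat (3 - j) * (bmono 3 j z * x)" for z x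
    proof -
      show "of_nat (3 - j) * (bmono 2 j z * (z $ 1 * x)) = of_nat (3 - j) * (bmono 3 (Suc j) z * x)"
      proof -
        have "3 - Suc j = 2 - j" by simp
        then show ?thesis by (simp add: bmono_def)
      qed
      show "of_nat (3 - j) * (bmono 2 j z * (z $ 2 * x)) = of_nat (3 - j) * (bmono 3 j z * x)"
        using j by (cases "j = 3") (auto simp: bmono_def Suc_diff_le numeral_3_eq_3 numeral_2_eq_2)
    qed
    have "4 * (bmono 3 j z * pd 2 Q z) = 6 * of_nat (3 - j) * (bmono 2 j z * Q z) + 1 * bracket (bmono 4 (Suc j)) Q z" for z
    proof -
      have "6 * of_nat (3 - j) * (bmono 2 j z * Q z) = of_nat (3 - j) * (bmono 2 j z * (6 * Q z))" by (simp only: mult_ac)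
      also have "\<dots> = of_nat (3 - j) * (bmono 2 j z * (z $ 1 * pd 1 Q z)) + of_nat (3 - j) * (bmono 2 j z * (z $ 2 * pd 2 Q z))"
        unfolding E[of z, symmetric] by (simp only: distrib_left)
      finally have "6 * of_nat (3 - j) * (bmono 2 j z * Q z)
        = of_nat (3 - j) * (bmono 2 j z * (z $ 1 * pd 1 Q z)) + of_nat (3 - j) * (bmono 2 j z * (z $ 2 * pd 2 Q z))" .
      moreover have "bracket (bmono 4 (Suc j)) Q z = of_nat (Suc j) * (bmono 3 j z * pd 2 Q z) - of_nat (3 - j) * (bmono 3 (Suc j) z * pd 1 Q z)"
        using j by (simp add: bracket_def pd_bmono)
      ultimately have "6 * of_nat (3 - j) * (bmono 2 j z * Q z) + 1 * bracket (bmono 4 (Suc j)) Q z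
        = (of_nat (3 - j) + of_nat (Suc j)) * (bmono 3 j z * pd 2 Q z)"
        unfolding m distrib_right by simp
      moreover have "of_nat (3 - j) + of_nat (Suc j) = (4 :: complex)" using j by (simp add: of_nat_diff)
      ultimately show ?thesis by simp
    qed
    then have "4 * apolar 8 (\<lambda>z. bmono 3 j z * pd 2 Q z) B
      = 6 * of_nat (3 - j) * apolar 8 (\<lambda>z. bmono 2 j z * Q z) B + 1 * apolar 8 (bracket (bmono 4 (Suc j)) Q) B"
      by (simp only: apolar_scale_left[symmetric] apolar_add_left[symmetric])
    then show ?thesis using bracket[of "Suc j"] mul[of j] j by (cases "j = 3") auto
  qed
  have "(\<lambda>z. s z * pd i Q z) = (\<lambda>z. \<Sum>j\<le>3. cf 3 s j * (bmono 3 j z * pd i Q z))"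
    by (rule ext, subst form_expand[OF s]) (simp add: sum_distrib_right mult.assoc)
  then show ?thesis
    using exhaust_2[of i] 1 2 by (auto simp: apolar_sum_left apolar_scale_left)
qed

section \<open>The moduli algebra\<close>

abbreviation R2 :: "cfun set ring" where "R2 \<equiv> germ_ring"

lemma germ_eq_iff: "germ f = germ g \<longleftrightarrow> (\<forall>\<^sub>F z in nhds 0. (f :: cfun) z = g z)"
proof
  assume "germ f = germ g"
  moreover have "f \<in> germ f" by (simp add: germ_def)
  ultimately show "\<forall>\<^sub>F z in nhds 0. f z = g z" by (simp add: germ_def)
next
  assume e: "\<forall>\<^sub>F z in nhds 0. f z = g z"
  show "germ f = germ g" unfolding germ_def
  proof (intro Collect_cong iffI)
    fix h assume "\<forall>\<^sub>F z in nhds 0. h z = f z"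
    then show "\<forall>\<^sub>F z in nhds 0. h z = g z" using e by eventually_elim simp
  next
    fix h assume "\<forall>\<^sub>F z in nhds 0. h z = g z"
    then show "\<forall>\<^sub>F z in nhds 0. h z = f z" using e by eventually_elim simp
  qed
qed

lemma germ_union:
  assumes "\<And>f' g'. f' \<in> germ f \<Longrightarrow> g' \<in> germ g \<Longrightarrow> germ (h f' g') = germ (h f g)"
  shows "(\<Union>f'\<in>germ f. \<Union>g'\<in>germ g. germ (h f' g')) = germ (h f (g :: cfun) :: cfun)"
proof -
  have "f \<in> germ f" "g \<in> germ g" by (simp_all add: germ_def)
  then show ?thesis using assms by blast
qed

lemma germ_mult: "germ f \<otimes>\<^bsub>R2\<^esub> germ g = germ (\<lambda>z. f z * g z)"
proof -
  have "(\<Union>f'\<in>germ f. \<Union>g'\<in>germ g. germ (\<lambda>z. f' z * g' z)) = germ (\<lambda>z. f z * g z)"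
  proof (rule germ_union[where h = "\<lambda>f g z. f z * g z"])
    fix f' g' assume "f' \<in> germ f" "g' \<in> germ g"
    then have "\<forall>\<^sub>F z in nhds 0. f' z = f z" "\<forall>\<^sub>F z in nhds 0. g' z = g z" by (auto simp: germ_def)
    then show "germ (\<lambda>z. f' z * g' z) = germ (\<lambda>z. f z * g z)"
      unfolding germ_eq_iff by eventually_elim simp
  qed
  then show ?thesis by (simp add: germ_ring_def)
qed

lemma germ_add: "germ f \<oplus>\<^bsub>R2\<^esub> germ g = germ (\<lambda>z. f z + g z)"
proof -
  have "(\<Union>f'\<in>germ f. \<Union>g'\<in>germ g. germ (\<lambda>z. f' z + g' z)) = germ (\<lambda>z. f z + g z)"
  proof (rule germ_union[where h = "\<lambda>f g z. f z + g z"])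
    fix f' g' assume "f' \<in> germ f" "g' \<in> germ g"
    then have "\<forall>\<^sub>F z in nhds 0. f' z = f z" "\<forall>\<^sub>F z in nhds 0. g' z = g z" by (auto simp: germ_def)
    then show "germ (\<lambda>z. f' z + g' z) = germ (\<lambda>z. f z + g z)"
      unfolding germ_eq_iff by eventually_elim simp
  qed
  then show ?thesis by (simp add: germ_ring_def)
qed

lemma germ_carrier: "carrier R2 = {germ f | f. hol f}"
  by (auto simp: germ_ring_def)

lemma germ_one: "\<one>\<^bsub>R2\<^esub> = germ (\<lambda>_. 1)" and germ_zero: "\<zero>\<^bsub>R2\<^esub> = germ (\<lambda>_. 0)"
  by (simp_all add: germ_ring_def)

lemma cring_germ_ring: "cring R2"
proof (rule cringI)
  show "abelian_group R2"
  proof (rule abelian_groupI)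
    fix x assume "x \<in> carrier R2"
    then obtain f where f: "x = germ f" "hol f" unfolding germ_carrier by blast
    have "hol (\<lambda>z. (-1) * f z)" by (intro hol_mult hol_const f)
    moreover have "germ (\<lambda>z. (-1) * f z) \<oplus>\<^bsub>R2\<^esub> x = \<zero>\<^bsub>R2\<^esub>" by (simp add: f germ_add germ_zero)
    ultimately show "\<exists>y\<in>carrier R2. y \<oplus>\<^bsub>R2\<^esub> x = \<zero>\<^bsub>R2\<^esub>" unfolding germ_carrier by blast
  qed (auto simp: germ_carrier germ_add germ_zero add_ac intro: hol_add hol_const)
  show "comm_monoid R2"
    by (rule comm_monoidI) (auto simp: germ_carrier germ_mult germ_one mult_ac intro: hol_mult hol_const)
qed (auto simp: germ_carrier germ_add germ_mult algebra_simps)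

lemma germ_minus:
  assumes "hol f" "hol g" shows "germ f \<ominus>\<^bsub>R2\<^esub> germ g = germ (\<lambda>z. f z - g z)"
proof -
  interpret cring R2 by (rule cring_germ_ring)
  have "hol (\<lambda>z. (-1) * g z)" by (intro hol_mult hol_const assms)
  then have "germ (\<lambda>z. (-1) * g z) \<in> carrier R2" unfolding germ_carrier by blast
  then have "\<ominus>\<^bsub>R2\<^esub> germ g = germ (\<lambda>z. (-1) * g z)"
    by (intro minus_equality) (use assms in \<open>auto simp: germ_add germ_zero germ_carrier\<close>)
  then show ?thesis by (simp add: a_minus_def germ_add)
qed

lemma jacobian_ideal_eq:
  assumes Q: "Q \<in> forms 6"
  shows "jacobian_ideal Q = {germ f | f. in_jac Q f}" and "ideal {germ f | f. in_jac Q f} R2"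
proof -
  interpret cring R2 by (rule cring_germ_ring)
  let ?J = "{germ f | f. in_jac Q f}"
  have sub: "?J \<subseteq> carrier R2" unfolding germ_carrier using in_jac_hol[OF Q] by blast
  show id: "ideal ?J R2"
  proof (rule idealI[OF ring_axioms])
    show "subgroup ?J (add_monoid R2)"
    proof
      show "?J \<subseteq> carrier (add_monoid R2)" using sub by simp
      show "\<one>\<^bsub>add_monoid R2\<^esub> \<in> ?J" using in_jac_0 by (auto simp: germ_zero)
      fix x assume "x \<in> ?J"
      then obtain f where f: "x = germ f" "in_jac Q f" by blast
      have F: "hol f" by (rule in_jac_hol[OF Q f(2)])
      have "\<ominus>\<^bsub>R2\<^esub> x = \<zero>\<^bsub>R2\<^esub> \<ominus>\<^bsub>R2\<^esub> x"
        using F unfolding f(1) by (simp add: a_minus_def germ_carrier) (metis (mono_tags, lifting) F a_inv_closed germ_carrier l_zero mem_Collect_eq)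
      also have "\<dots> = germ (\<lambda>z. 0 - f z)" unfolding f(1) germ_zero by (rule germ_minus[OF hol_const F])
      finally have "\<ominus>\<^bsub>R2\<^esub> x \<in> ?J" using in_jac_diff[OF in_jac_0 f(2)] by blast
      then show "inv\<^bsub>add_monoid R2\<^esub> x \<in> ?J" by (simp add: a_inv_def)
    next
      fix x y assume "x \<in> ?J" "y \<in> ?J"
      then show "x \<otimes>\<^bsub>add_monoid R2\<^esub> y \<in> ?J" using in_jac_add by (auto simp: germ_add)
    qed
  next
    fix a x assume "a \<in> ?J" "x \<in> carrier R2"
    then obtain f g where fg: "a = germ f" "in_jac Q f" "x = germ g" "hol g" unfolding germ_carrier by blast
    show "x \<otimes>\<^bsub>R2\<^esub> a \<in> ?J" using in_jac_mult[OF fg(2,4)] by (auto simp: fg germ_mult)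
    show "a \<otimes>\<^bsub>R2\<^esub> x \<in> ?J" using in_jac_mult[OF fg(2,4)] by (auto simp: fg germ_mult mult.commute)
  qed
  have gens: "range (\<lambda>i. germ (pd i Q)) \<subseteq> ?J"
  proof
    fix x assume "x \<in> range (\<lambda>i. germ (pd i Q))"
    then obtain i where x: "x = germ (pd i Q)" by blast
    have "in_jac Q (pd 1 Q)" by (rule in_jacI[of "\<lambda>_. 1" "\<lambda>_. 0"]) simp_all
    moreover have "in_jac Q (pd 2 Q)" by (rule in_jacI[of "\<lambda>_. 0" "\<lambda>_. 1"]) simp_all
    ultimately show "x \<in> ?J" using exhaust_2[of i] x by auto
  qed
  have gc: "range (\<lambda>i. germ (pd i Q)) \<subseteq> carrier R2" using gens sub by blast
  interpret I: ideal "jacobian_ideal Q" R2 unfolding jacobian_ideal_def by (rule genideal_ideal[OF gc])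
  show "jacobian_ideal Q = ?J"
  proof
    show "jacobian_ideal Q \<subseteq> ?J" unfolding jacobian_ideal_def by (rule genideal_minimal[OF id gens])
    show "?J \<subseteq> jacobian_ideal Q"
    proof
      fix x assume "x \<in> ?J"
      then obtain f where x: "x = germ f" "in_jac Q f" by blast
      then obtain a c where ac: "hol a" "hol c" "\<forall>\<^sub>F z in nhds 0. f z = a z * pd 1 Q z + c z * pd 2 Q z"
        unfolding in_jac_def by blast
      have p: "germ (pd i Q) \<in> jacobian_ideal Q" for i
        using genideal_self[OF gc] unfolding jacobian_ideal_def by blast
      have "x = germ a \<otimes>\<^bsub>R2\<^esub> germ (pd 1 Q) \<oplus>\<^bsub>R2\<^esub> germ c \<otimes>\<^bsub>R2\<^esub> germ (pd 2 Q)"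
        unfolding x(1) germ_mult germ_add germ_eq_iff by (rule ac(3))
      also have "\<dots> \<in> jacobian_ideal Q"
        by (intro I.a_closed I.I_l_closed p) (use ac in \<open>auto simp: germ_carrier\<close>)
      finally show "x \<in> jacobian_ideal Q" .
    qed
  qed
qed

context
  fixes Q :: cfun
  assumes Q: "Q \<in> forms 6"
begin

abbreviation "MA \<equiv> moduli_algebra Q"
abbreviation "cls \<equiv> class_in_algebra Q"

lemma ideal_jac: "ideal (jacobian_ideal Q) R2"
  using jacobian_ideal_eq[OF Q] by simp

lemma cring_MA: "cring MA"
  unfolding moduli_algebra_def by (rule ideal.quotient_is_cring[OF ideal_jac cring_germ_ring])

lemma class_hom: "ring_hom_ring R2 MA (\<lambda>a. jacobian_ideal Q +>\<^bsub>R2\<^esub> a)"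
  unfolding moduli_algebra_def by (rule ideal.rcos_ring_hom_ring[OF ideal_jac])

lemma MA_carrier: "carrier MA = {cls f | f. hol f}"
  unfolding moduli_algebra_def FactRing_def class_in_algebra_def
  by (auto simp: A_RCOSETS_def' germ_carrier)

lemma cls_carrier: "hol f \<Longrightarrow> cls f \<in> carrier MA"
  unfolding MA_carrier by blast

lemma cls_mult: "hol f \<Longrightarrow> hol g \<Longrightarrow> cls f \<otimes>\<^bsub>MA\<^esub> cls g = cls (\<lambda>z. f z * g z)"
  unfolding class_in_algebra_def
  by (subst ring_hom_mult[OF ring_hom_ring.homh[OF class_hom], symmetric]) (auto simp: germ_carrier germ_mult)

lemma cls_add: "hol f \<Longrightarrow> hol g \<Longrightarrow> cls f \<oplus>\<^bsub>MA\<^esub> cls g = cls (\<lambda>z. f z + g z)"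
  unfolding class_in_algebra_def
  by (subst ring_hom_add[OF ring_hom_ring.homh[OF class_hom], symmetric]) (auto simp: germ_carrier germ_add)

lemma cls_one: "\<one>\<^bsub>MA\<^esub> = cls (\<lambda>_. 1)"
  unfolding class_in_algebra_def
  using ring_hom_one[OF ring_hom_ring.homh[OF class_hom]] by (simp add: germ_one)

lemma cls_eq_iff: "hol f \<Longrightarrow> hol g \<Longrightarrow> cls f = cls g \<longleftrightarrow> in_jac Q (\<lambda>z. f z - g z)"
proof -
  assume fg: "hol f" "hol g"
  interpret cring R2 by (rule cring_germ_ring)
  have "cls f = cls g \<longleftrightarrow> germ f \<ominus>\<^bsub>R2\<^esub> germ g \<in> jacobian_ideal Q"
    unfolding class_in_algebra_def
    by (rule quotient_eq_iff_same_a_r_cos[OF ideal_jac, symmetric]) (use fg in \<open>auto simp: germ_carrier\<close>)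
  also have "\<dots> \<longleftrightarrow> (\<exists>h. germ (\<lambda>z. f z - g z) = germ h \<and> in_jac Q h)"
    unfolding germ_minus[OF fg] jacobian_ideal_eq(1)[OF Q] by blast
  also have "\<dots> \<longleftrightarrow> in_jac Q (\<lambda>z. f z - g z)"
    unfolding germ_eq_iff using in_jac_cong by (auto intro!: exI[of _ "\<lambda>z. f z - g z"])
  finally show ?thesis .
qed

lemma cls_zero: "\<zero>\<^bsub>MA\<^esub> = cls (\<lambda>_. 0)"
proof -
  interpret cring R2 by (rule cring_germ_ring)
  interpret h: ring_hom_ring R2 MA "\<lambda>a. jacobian_ideal Q +>\<^bsub>R2\<^esub> a" by (rule class_hom)
  show ?thesis unfolding class_in_algebra_def using h.hom_zero by (simp add: germ_zero)
qed

lemma cls_eq_zero_iff: "hol f \<Longrightarrow> cls f = \<zero>\<^bsub>MA\<^esub> \<longleftrightarrow> in_jac Q f"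
  unfolding cls_zero using cls_eq_iff[OF _ hol_const[of 0], of f] by simp

lemma scale_cls: "hol f \<Longrightarrow> scale_algebra Q c (cls f) = cls (\<lambda>z. c * f z)"
  unfolding scale_algebra_def by (rule cls_mult[OF hol_const])

lemma cls_power: "hol f \<Longrightarrow> cls f [^]\<^bsub>MA\<^esub> (n :: nat) = cls (\<lambda>z. f z ^ n)"
proof (induction n)
  case 0
  interpret cring MA by (rule cring_MA)
  show ?case by (simp add: cls_one)
next
  case (Suc n)
  interpret cring MA by (rule cring_MA)
  have "cls f [^]\<^bsub>MA\<^esub> Suc n = cls (\<lambda>z. f z ^ n) \<otimes>\<^bsub>MA\<^esub> cls f" using Suc by simp
  also have "\<dots> = cls (\<lambda>z. f z ^ n * f z)" by (rule cls_mult[OF hol_power]) (use Suc.prems in auto)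
  finally show ?case by (simp add: mult.commute)
qed

lemma generic_linear_power:
  "(\<Oplus>\<^bsub>MA\<^esub>i\<in>UNIV. scale_algebra Q (w $ i) (cls (\<lambda>z. z $ i))) [^]\<^bsub>MA\<^esub> (n :: nat)
    = cls (\<lambda>z. dotp w z ^ n)"
proof -
  interpret cring MA by (rule cring_MA)
  have s: "scale_algebra Q (w $ i) (cls (\<lambda>z. z $ i)) = cls (\<lambda>z. w $ i * z $ i)" for i
    by (rule scale_cls[OF hol_coord])
  have h: "hol (\<lambda>z. w $ i * z $ i)" for i by (intro hol_mult hol_const hol_coord)
  have "(\<Oplus>\<^bsub>MA\<^esub>i\<in>UNIV. scale_algebra Q (w $ i) (cls (\<lambda>z. z $ i)))
    = cls (\<lambda>z. w $ 1 * z $ 1) \<oplus>\<^bsub>MA\<^esub> cls (\<lambda>z. w $ 2 * z $ 2)"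
    unfolding s UNIV_2 using cls_carrier[OF h] by (subst finsum_insert) auto
  also have "\<dots> = cls (\<lambda>z. dotp w z)" unfolding dotp_def by (rule cls_add[OF h h])
  finally show ?thesis using cls_power[of "\<lambda>z. dotp w z" n] h by (simp add: dotp_def hol_add)
qed

definition "max_ideal = {cls f | f. hol f \<and> f 0 = 0}"

lemma cls_in_max_ideal_iff: "hol f \<Longrightarrow> cls f \<in> max_ideal \<longleftrightarrow> f 0 = 0"
proof
  assume f: "hol f" and "cls f \<in> max_ideal"
  then obtain g where g: "cls f = cls g" "hol g" "g 0 = 0" unfolding max_ideal_def by blast
  then have "in_jac Q (\<lambda>z. f z - g z)" using cls_eq_iff[OF f] by blast
  from in_jac_at_0[OF Q this] show "f 0 = 0" using g(3) by simp
qed (auto simp: max_ideal_def)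

lemma ideal_max_ideal: "ideal max_ideal MA"
proof (rule idealI)
  interpret cring MA by (rule cring_MA)
  show "ring MA" by (rule ring_axioms)
  have sub: "max_ideal \<subseteq> carrier MA" unfolding max_ideal_def MA_carrier by blast
  show "subgroup max_ideal (add_monoid MA)"
  proof
    show "max_ideal \<subseteq> carrier (add_monoid MA)" using sub by simp
    show "\<one>\<^bsub>add_monoid MA\<^esub> \<in> max_ideal" using cls_in_max_ideal_iff[OF hol_const[of 0]] by (simp add: cls_zero)
    fix x assume "x \<in> max_ideal"
    then obtain f where f: "x = cls f" "hol f" "f 0 = 0" unfolding max_ideal_def by blast
    have h: "hol (\<lambda>z. (-1) * f z)" by (intro hol_mult hol_const f)
    have "\<ominus>\<^bsub>MA\<^esub> x = cls (\<lambda>z. (-1) * f z)"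
      by (rule minus_equality) (use f h in \<open>simp_all add: cls_add cls_carrier cls_zero\<close>)
    then have "\<ominus>\<^bsub>MA\<^esub> x \<in> max_ideal" using cls_in_max_ideal_iff[OF h] f(3) by simp
    then show "inv\<^bsub>add_monoid MA\<^esub> x \<in> max_ideal" by (simp add: a_inv_def)
  next
    fix x y assume "x \<in> max_ideal" "y \<in> max_ideal"
    then obtain f g where fg: "x = cls f" "hol f" "f 0 = 0" "y = cls g" "hol g" "g 0 = 0"
      unfolding max_ideal_def by blast
    then show "x \<otimes>\<^bsub>add_monoid MA\<^esub> y \<in> max_ideal"
      by (simp add: cls_add cls_in_max_ideal_iff hol_add)
  qed
  fix a x assume "a \<in> max_ideal" "x \<in> carrier MA"
  then obtain f g where fg: "a = cls f" "hol f" "f 0 = 0" "x = cls g" "hol g"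
    unfolding max_ideal_def MA_carrier by blast
  then show "x \<otimes>\<^bsub>MA\<^esub> a \<in> max_ideal" "a \<otimes>\<^bsub>MA\<^esub> x \<in> max_ideal"
    by (simp_all add: cls_mult cls_in_max_ideal_iff hol_mult)
qed

text \<open>The algebra is local: a germ that does not vanish at the origin is invertible.\<close>

lemma ideal_with_unit:
  assumes I: "ideal I MA" and f: "hol f" "f 0 \<noteq> 0" "cls f \<in> I" shows "I = carrier MA"
proof -
  interpret I: ideal I MA by (rule I)
  have h: "hol (\<lambda>z. inverse (f z))" by (rule hol_inverse[OF f(1,2)])
  have "cls (\<lambda>z. inverse (f z)) \<otimes>\<^bsub>MA\<^esub> cls f \<in> I" by (rule I.I_l_closed[OF f(3) cls_carrier[OF h]])
  moreover have "cls (\<lambda>z. inverse (f z)) \<otimes>\<^bsub>MA\<^esub> cls f = cls (\<lambda>z. inverse (f z) * f z)"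
    by (rule cls_mult[OF h f(1)])
  moreover have "cls (\<lambda>z. inverse (f z) * f z) = cls (\<lambda>_. 1)"
  proof -
    have "\<forall>\<^sub>F z in nhds 0. f z \<noteq> 0"
      using isCont_tendsto_nhds[OF hol_isCont[OF f(1)]] f(2) by (rule tendsto_imp_eventually_ne)
    then have "germ (\<lambda>z. inverse (f z) * f z) = germ (\<lambda>_. 1)"
      unfolding germ_eq_iff by eventually_elim simp
    then show ?thesis unfolding class_in_algebra_def by simp
  qed
  ultimately have "\<one>\<^bsub>MA\<^esub> \<in> I" by (simp add: cls_one)
  then show ?thesis by (rule I.one_imp_carrier)
qed

lemma max_ideal_proper: "max_ideal \<noteq> carrier MA"
  using cls_in_max_ideal_iff[OF hol_const[of 1]] cls_carrier[OF hol_const[of 1]] by auto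

lemma maximalideal_iff: "maximalideal M MA \<longleftrightarrow> M = max_ideal"
proof
  assume M: "maximalideal M MA"
  interpret M: maximalideal M MA by (rule M)
  have "M \<subseteq> max_ideal"
  proof
    fix x assume x: "x \<in> M"
    then obtain f where f: "x = cls f" "hol f" using M.a_subset unfolding MA_carrier by blast
    have "f 0 = 0"
      using ideal_with_unit[OF M.is_ideal f(2)] x f(1) M.I_notcarr by metis
    then show "x \<in> max_ideal" using f cls_in_max_ideal_iff by simp
  qed
  moreover have "max_ideal \<subseteq> carrier MA" unfolding max_ideal_def MA_carrier by blast
  ultimately have "max_ideal = M \<or> max_ideal = carrier MA" by (rule M.I_maximal[OF ideal_max_ideal])
  then show "M = max_ideal" using max_ideal_proper by blast
next
  assume M: "M = max_ideal"
  show "maximalideal M MA" unfolding M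
  proof (rule maximalidealI[OF ideal_max_ideal])
    show "carrier MA \<noteq> max_ideal" using max_ideal_proper by blast
    fix I assume I: "ideal I MA" "max_ideal \<subseteq> I" "I \<subseteq> carrier MA"
    show "I = max_ideal \<or> I = carrier MA"
    proof (rule disjCI)
      assume "I \<noteq> carrier MA"
      have "I \<subseteq> max_ideal"
      proof
        fix x assume x: "x \<in> I"
        then obtain f where f: "x = cls f" "hol f" using I(3) unfolding MA_carrier by blast
        have "f 0 = 0" using ideal_with_unit[OF I(1) f(2)] x f(1) \<open>I \<noteq> carrier MA\<close> by metis
        then show "x \<in> max_ideal" using f cls_in_max_ideal_iff by simp
      qed
      then show "I = max_ideal" using I(2) by blast
    qed
  qed
qed

end

section \<open>Associated forms\<close>

text \<open>Up to the factor \<open>8!\<close>, the functional of \<open>B\<close> is \<open>\<omega>\<close> on classes of octics. The relations of \<open>Q\<close> have class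
  zero, and \<open>\<omega>\<close> does not vanish on all octics because these represent the annihilator of the maximal
  ideal.\<close>

lemma associated_form_related:
  assumes Q: "Q \<in> forms 6" "sylvester Q \<noteq> 0" and B: "B \<in> associated_forms 6 Q"
  shows "B \<in> forms 8" "related Q B" "B \<noteq> (\<lambda>_. 0)"
proof -
  let ?cls = "class_in_algebra Q" and ?MA = "moduli_algebra Q"
  obtain M \<omega> a where M: "maximalideal M ?MA" and \<omega>: "linear_form_on Q M \<omega>"
    and a: "a \<in> annihilator_in Q M" "\<omega> a \<noteq> 0"
    and Bdef: "B = (\<lambda>w. \<omega> ((\<Oplus>\<^bsub>?MA\<^esub>i\<in>UNIV. scale_algebra Q (w $ i) (?cls (\<lambda>z. z $ i)))
      [^]\<^bsub>?MA\<^esub> (CARD(2) * (6 - 2))) / fact (CARD(2) * (6 - 2)))"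
    using B unfolding associated_forms_def by blast
  have Meq: "M = max_ideal Q" using M maximalideal_iff[OF Q(1)] by blast
  have inM: "?cls f \<in> M" if "hol f" "f 0 = 0" for f
    using that cls_in_max_ideal_iff[OF Q(1)] unfolding Meq by blast
  have form0: "hol u \<and> u 0 = 0" if "u \<in> forms 8" for u using that hol_form form_at_0 by auto
  have Bw: "B w = \<omega> (?cls (\<lambda>z. dotp w z ^ 8)) / fact 8" for w
    unfolding Bdef generic_linear_power[OF Q(1)] by simp
  have lin: "\<omega> (?cls (\<lambda>z. c * f z + d * g z)) = c * \<omega> (?cls f) + d * \<omega> (?cls g)"
    if "hol f" "f 0 = 0" "hol g" "g 0 = 0" for f g c d
  proof -
    have h: "hol (\<lambda>z. c * f z)" "hol (\<lambda>z. d * g z)" using that by (auto intro: hol_mult hol_const)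
    have "\<omega> (?cls (\<lambda>z. c * f z + d * g z)) = \<omega> (?cls (\<lambda>z. c * f z) \<oplus>\<^bsub>?MA\<^esub> ?cls (\<lambda>z. d * g z))"
      by (simp add: cls_add[OF Q(1) h])
    also have "\<dots> = \<omega> (?cls (\<lambda>z. c * f z)) + \<omega> (?cls (\<lambda>z. d * g z))"
      using \<omega> inM[OF h(1)] inM[OF h(2)] that unfolding linear_form_on_def by simp
    also have "\<omega> (?cls (\<lambda>z. c * f z)) = c * \<omega> (?cls f)"
      using \<omega> inM[OF that(1,2)] scale_cls[OF Q(1) that(1), of c] unfolding linear_form_on_def by metis
    also have "\<omega> (?cls (\<lambda>z. d * g z)) = d * \<omega> (?cls g)"
      using \<omega> inM[OF that(3,4)] scale_cls[OF Q(1) that(3), of d] unfolding linear_form_on_def by metis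
    finally show ?thesis .
  qed
  have linF: "\<omega> (?cls (\<lambda>z. c * f z + d * g z)) = c * \<omega> (?cls f) + d * \<omega> (?cls g)"
    if "f \<in> forms 8" "g \<in> forms 8" for f g c d
    using lin form0[OF that(1)] form0[OF that(2)] by blast
  show BF: "B \<in> forms 8"
  proof -
    have W: "\<omega> (?cls (\<lambda>z. dotp w z ^ 8)) = (\<Sum>k\<le>8. cf 8 (\<lambda>z. dotp w z ^ 8) k * \<omega> (?cls (bmono 8 k)))" for w
      by (rule linear_on_forms[where L = "\<lambda>u. \<omega> (?cls u)", OF linF]) auto
    have "B w = (\<Sum>k\<le>8. (of_nat (8 choose k) * \<omega> (?cls (bmono 8 k)) / fact 8) * bmono 8 k w)" for w
      unfolding Bw W sum_divide_distrib by (rule sum.cong) (auto simp: cf_dotp_power)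
    then have "B = (\<lambda>w. \<Sum>k\<le>8. (of_nat (8 choose k) * \<omega> (?cls (bmono 8 k)) / fact 8) * bmono 8 k w)" by (rule ext)
    moreover have "\<dots> \<in> forms 8" by (rule forms_sum_mono)
    ultimately show ?thesis by (simp only:)
  qed
  have key: "\<omega> (?cls u) = fact 8 * apolar 8 u B" if u: "u \<in> forms 8" for u
  proof (rule linear_on_forms_eqI[where L = "\<lambda>u. \<omega> (?cls u)" and M = "\<lambda>u. fact 8 * apolar 8 u B", OF linF _ _ u])
    show "fact 8 * apolar 8 (\<lambda>z. a * f z + b * g z) B = a * (fact 8 * apolar 8 f B) + b * (fact 8 * apolar 8 g B)" for f g a b
      by (simp add: apolar_add_left apolar_scale_left algebra_simps)
    show "\<omega> (?cls (\<lambda>z. dotp w z ^ 8)) = fact 8 * apolar 8 (\<lambda>z. dotp w z ^ 8) B" for w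
      unfolding apolar_dotp_power[OF BF] Bw by simp
  qed
  have \<omega>0: "\<omega> (?cls (\<lambda>_. 0)) = 0" using lin[of "\<lambda>_. 0" "\<lambda>_. 0" 0 0] by simp
  show "related Q B" unfolding related_def
  proof (intro allI impI)
    fix i :: nat assume i: "i < 8"
    have F: "relation_form Q i \<in> forms 8" by (rule forms_relation_form[OF Q(1) i])
    have "?cls (relation_form Q i) = ?cls (\<lambda>_. 0)"
      using cls_eq_zero_iff[OF Q(1) hol_form[OF F]] relation_form_in_jac[OF Q(1) i] cls_zero[OF Q(1)] by simp
    then have "fact 8 * apolar 8 (relation_form Q i) B = 0" using key[OF F] \<omega>0 by simp
    then show "apolar 8 (relation_form Q i) B = 0" by simp
  qed
  show "B \<noteq> (\<lambda>_. 0)"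
  proof
    assume B0: "B = (\<lambda>_. 0)"
    have "a \<in> carrier ?MA" using a(1) unfolding annihilator_in_def by blast
    then obtain f where f: "a = ?cls f" "hol f" unfolding MA_carrier[OF Q(1)] by blast
    have "in_jac Q (\<lambda>z. z $ i * f z)" for i
    proof -
      have "?cls (\<lambda>z. z $ i) \<in> M" by (rule inM) auto
      then have "?cls f \<otimes>\<^bsub>?MA\<^esub> ?cls (\<lambda>z. z $ i) = \<zero>\<^bsub>?MA\<^esub>"
        using a(1) f(1) unfolding annihilator_in_def by blast
      then have "?cls (\<lambda>z. f z * z $ i) = \<zero>\<^bsub>?MA\<^esub>" by (simp add: cls_mult[OF Q(1) f(2) hol_coord])
      then have "in_jac Q (\<lambda>z. f z * z $ i)"
        using cls_eq_zero_iff[OF Q(1)] hol_mult[OF f(2) hol_coord] by blast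
      then show ?thesis by (simp add: mult.commute)
    qed
    then obtain v where v: "v \<in> forms 8" "in_jac Q (\<lambda>z. f z - v z)"
      using socle_is_top_degree[OF Q f(2)] by blast
    have "?cls f = ?cls v" using cls_eq_iff[OF Q(1) f(2) hol_form[OF v(1)]] v(2) by blast
    then have "\<omega> a = fact 8 * apolar 8 v B" using key[OF v(1)] f(1) by simp
    then show False using a(2) B0 by (simp add: apolar_def)
  qed
qed

text \<open>The functional of the dual form, applied to the Taylor component of degree 8, vanishes on the Jacobian
  ideal and so defines a linear form on the moduli algebra.\<close>

lemma associated_form_exists:
  assumes Q: "Q \<in> forms 6" "sylvester Q \<noteq> 0" and D: "dual_form Q w \<noteq> 0"
  shows "associated_forms 6 Q \<noteq> {}"
proof -
  let ?cls = "class_in_algebra Q" and ?MA = "moduli_algebra Q" and ?D = "dual_form Q"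
  \<comment> \<open>The Taylor component of degree 8 depends on \<open>f\<close> only, not on the choice of the jet.\<close>
  define top where "top f = (SOME v. \<exists>u. jet 9 f u \<and> v = u 8)" for f
  have top: "top f = u 8" if u: "jet 9 f u" for f u
  proof -
    have "\<exists>v u. jet 9 f u \<and> v = u 8" by (intro exI[of _ "u 8"] exI[of _ u] conjI u refl)
    then have "\<exists>u. jet 9 f u \<and> top f = u 8" unfolding top_def by (rule someI_ex)
    then obtain v where v: "jet 9 f v" "top f = v 8" by (elim exE conjE)
    show ?thesis unfolding v(2) by (rule jet_unique[OF v(1) u]) simp
  qed
  define top_val where "top_val f = apolar 8 (top f) ?D" for f
  have jac0: "top_val f = 0" if f: "in_jac Q f" for f
  proof -
    obtain u where u: "jet 9 f u" using jet_exists[OF in_jac_hol[OF Q(1) f]] by blast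
    have "graded_jac Q 8 (u 8)" by (rule in_jac_components[OF Q(1) f u]) simp
    then obtain a c where ac: "a \<in> forms 3" "c \<in> forms 3" "u 8 = (\<lambda>z. a z * pd 1 Q z + c z * pd 2 Q z)"
      unfolding graded_jac_def by auto
    show ?thesis unfolding top_val_def top[OF u] ac(3) apolar_add_left
      using related_jacobian[OF Q(1) related_dual_form ac(1)] related_jacobian[OF Q(1) related_dual_form ac(2)]
      by simp
  qed
  have lin: "top_val (\<lambda>z. c * f z + d * g z) = c * top_val f + d * top_val g" if fg: "hol f" "hol g" for f g c d
  proof -
    obtain u v where uv: "jet 9 f u" "jet 9 g v" using jet_exists[OF fg(1)] jet_exists[OF fg(2)] by blast
    have "jet 9 (\<lambda>z. c * f z + d * g z) (\<lambda>i z. c * u i z + d * v i z)"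
      by (intro jet_add jet_scale uv)
    from top[OF this] top[OF uv(1)] top[OF uv(2)] show ?thesis
      by (simp add: top_val_def apolar_add_left apolar_scale_left)
  qed
  define \<omega> where "\<omega> a = top_val (SOME f. hol f \<and> a = ?cls f)" for a
  have \<omega>: "\<omega> (?cls f) = top_val f" if f: "hol f" for f
  proof -
    define g where "g = (SOME g. hol g \<and> ?cls f = ?cls g)"
    have "\<exists>g. hol g \<and> ?cls f = ?cls g" by (intro exI[of _ f] conjI f refl)
    then have g: "hol g \<and> ?cls f = ?cls g" unfolding g_def by (rule someI_ex)
    then have "in_jac Q (\<lambda>z. f z - g z)" using cls_eq_iff[OF Q(1) f] by blast
    then have "top_val (\<lambda>z. f z - g z) = 0" by (rule jac0)
    moreover have "top_val (\<lambda>z. 1 * f z + (-1) * g z) = 1 * top_val f + (-1) * top_val g"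
      by (rule lin) (use f g in auto)
    ultimately have "top_val f = top_val g" by simp
    then show ?thesis unfolding \<omega>_def g_def by simp
  qed
  have linear: "linear_form_on Q (max_ideal Q) \<omega>"
    unfolding linear_form_on_def
  proof (intro conjI ballI allI)
    fix a b assume "a \<in> max_ideal Q" "b \<in> max_ideal Q"
    then obtain f g where fg: "a = ?cls f" "hol f" "b = ?cls g" "hol g"
      unfolding max_ideal_def[OF Q(1)] by blast
    show "\<omega> (a \<oplus>\<^bsub>?MA\<^esub> b) = \<omega> a + \<omega> b"
      using lin[OF fg(2,4), of 1 1] \<omega>[OF hol_add[OF fg(2,4)]]
      by (simp add: fg cls_add[OF Q(1)] \<omega>)
  next
    fix c a assume "a \<in> max_ideal Q"
    then obtain f where f: "a = ?cls f" "hol f" unfolding max_ideal_def[OF Q(1)] by blast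
    show "\<omega> (scale_algebra Q c a) = c * \<omega> a"
      using lin[OF f(2) f(2), of c 0] \<omega>[OF hol_mult[OF hol_const f(2)], of c]
      by (simp add: f scale_cls[OF Q(1)] \<omega>)
  qed
  obtain v where v: "v \<in> forms 8" "apolar 8 v ?D \<noteq> 0"
    using apolar_dotp_power[OF forms_dual_form, of w Q] D forms_dotp_power[of w 8] by metis
  have "?cls v \<in> annihilator_in Q (max_ideal Q)"
    unfolding annihilator_in_def
  proof (intro CollectI conjI ballI)
    show "?cls v \<in> carrier ?MA" by (rule cls_carrier[OF Q(1) hol_form[OF v(1)]])
    fix b assume "b \<in> max_ideal Q"
    then obtain f where f: "b = ?cls f" "hol f" "f 0 = 0" unfolding max_ideal_def[OF Q(1)] by blast
    have h: "hol (\<lambda>z. v z * f z)" by (intro hol_mult hol_form[OF v(1)] f)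
    show "?cls v \<otimes>\<^bsub>?MA\<^esub> b = \<zero>\<^bsub>?MA\<^esub>"
      unfolding f(1) cls_mult[OF Q(1) hol_form[OF v(1)] f(2)] cls_eq_zero_iff[OF Q(1) h]
      by (rule top_degree_in_socle[OF Q v(1) f(2,3)])
  qed
  moreover have "\<omega> (?cls v) \<noteq> 0"
    using \<omega>[OF hol_form[OF v(1)]] top[OF jet_form[OF v(1), of 9]] v(2) by (simp add: top_val_def)
  moreover have "maximalideal (max_ideal Q) ?MA" using maximalideal_iff[OF Q(1)] by blast
  ultimately have "(\<lambda>w. \<omega> ((\<Oplus>\<^bsub>?MA\<^esub>i\<in>UNIV. scale_algebra Q (w $ i) (?cls (\<lambda>z. z $ i)))
      [^]\<^bsub>?MA\<^esub> (CARD(2) * (6 - 2))) / fact (CARD(2) * (6 - 2))) \<in> associated_forms 6 Q"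
    using linear unfolding associated_forms_def mem_Collect_eq
    by (intro exI[of _ "max_ideal Q"] exI[of _ \<omega>] conjI bexI[of _ "?cls v"] refl)
  then show ?thesis by (metis emptyE)
qed

section \<open>Transfer of invariants\<close>

lemma matrix_inv_unique2:
  assumes "A ** A' = mat 1" "A' ** A = mat 1" shows "matrix_inv A' = (A :: complex^2^2)"
proof -
  have inv: "invertible A'" using assms unfolding invertible_def by blast
  have "matrix_inv A' = matrix_inv A' ** (A' ** A)" by (simp add: assms(2))
  also have "\<dots> = (matrix_inv A' ** A') ** A" by (simp add: matrix_mul_assoc)
  also have "matrix_inv A' ** A' = mat 1"
    using someI_ex[OF inv[unfolded invertible_def]] unfolding matrix_inv_def by blast
  finally show ?thesis by simp
qed

text \<open>The action of \<open>C\<close> is the substitution of its inverse, which is called \<open>A\<close> here.\<close>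

lemma relative_invariant_iff:
  "relative_invariant d k I \<longleftrightarrow> I \<in> polynomials_on (forms d) \<and>
    (\<forall>Q\<in>forms d. \<forall>A A'. A ** A' = mat 1 \<longrightarrow> A' ** A = mat 1 \<longrightarrow>
      I (\<lambda>z. Q ((A :: complex^2^2) *v z)) = det A ^ k * I Q)"
proof -
  have 1: "I (\<lambda>z. Q (A *v z)) = det A ^ k * I Q"
    if I: "\<And>C. invertible C \<Longrightarrow> I Q = det C ^ k * I (form_action C Q)"
      and A: "A ** A' = mat 1" "A' ** A = mat 1" for Q A A'
  proof -
    have "invertible A'" using A unfolding invertible_def by blast
    from I[OF this] have "I Q = det A' ^ k * I (\<lambda>z. Q (A *v z))"
      unfolding form_action_def matrix_inv_unique2[OF A] .
    then have "det A ^ k * I Q = (det A * det A') ^ k * I (\<lambda>z. Q (A *v z))"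
      by (simp add: power_mult_distrib)
    then show ?thesis by (simp add: det_inverse[OF A(1)])
  qed
  have 2: "I Q = det C ^ k * I (form_action C Q)"
    if I: "\<And>A A'. A ** A' = mat 1 \<Longrightarrow> A' ** A = mat 1 \<Longrightarrow> I (\<lambda>z. Q (A *v z)) = det A ^ k * I Q"
      and C: "invertible C" for Q C
  proof -
    have m: "C ** matrix_inv C = mat 1" "matrix_inv C ** C = mat 1"
      using someI_ex[OF C[unfolded invertible_def]] unfolding matrix_inv_def by blast+
    have "det C ^ k * I (form_action C Q) = (det C * det (matrix_inv C)) ^ k * I Q"
      unfolding form_action_def I[OF m(2,1)] by (simp add: power_mult_distrib)
    then show ?thesis by (simp add: det_inverse[OF m(1)])
  qed
  show ?thesis
  proof
    assume r: "relative_invariant d k I"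
    then have "I Q = det C ^ k * I (form_action C Q)" if "Q \<in> forms d" "invertible C" for Q C
      using that unfolding relative_invariant_def by blast
    then show "I \<in> polynomials_on (forms d) \<and> (\<forall>Q\<in>forms d. \<forall>A A'. A ** A' = mat 1 \<longrightarrow> A' ** A = mat 1 \<longrightarrow>
      I (\<lambda>z. Q (A *v z)) = det A ^ k * I Q)"
      using r 1 unfolding relative_invariant_def by blast
  next
    assume r: "I \<in> polynomials_on (forms d) \<and> (\<forall>Q\<in>forms d. \<forall>A A'. A ** A' = mat 1 \<longrightarrow> A' ** A = mat 1 \<longrightarrow>
      I (\<lambda>z. Q (A *v z)) = det A ^ k * I Q)"
    then show "relative_invariant d k I" unfolding relative_invariant_def
      by (intro conjI ballI allI impI 2) auto
  qed
qed

lemma relative_invariantD: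
  assumes "relative_invariant d k I" "Q \<in> forms d" "A ** A' = mat 1" "A' ** A = mat 1"
  shows "I (\<lambda>z. Q ((A :: complex^2^2) *v z)) = det A ^ k * I Q"
  using assms unfolding relative_invariant_iff by blast

lemma mat_1_mkm: "mat 1 = mkm 1 0 0 1"
  by (simp add: mat2_eq_iff Finite_Cartesian_Product.mat_def)

text \<open>Scalar matrices multiply forms of degree \<open>d\<close> by \<open>d\<close>-th powers.\<close>

lemma relative_invariant_scale:
  assumes I: "relative_invariant d k (I :: cfun \<Rightarrow> complex)" and B: "B \<in> forms d" and s: "s \<noteq> 0"
  shows "I (\<lambda>z. s ^ d * B z) = (s ^ 2) ^ k * I B"
proof -
  have v: "mkm s 0 0 s *v z = s *s z" for z by (simp add: vec2_eq_iff matrix_vector_2)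
  have "I (\<lambda>z. B (mkm s 0 0 s *v z)) = det (mkm s 0 0 s) ^ k * I B"
    by (rule relative_invariantD[OF I B, of _ "mkm (1 / s) 0 0 (1 / s)"])
      (use s in \<open>simp_all add: mkm_mult mat_1_mkm\<close>)
  then show ?thesis by (simp add: v form_scale_arg[OF B] power2_eq_square)
qed

lemma complex_root_exists: "n > 0 \<Longrightarrow> \<exists>s::complex. s ^ n = c"
proof -
  assume n: "n > 0"
  show ?thesis
  proof (cases "c = 0")
    case True
    then show ?thesis using n by (intro exI[of _ 0]) simp
  next
    case False
    have "exp (Ln c / of_nat n) ^ n = exp (of_nat n * (Ln c / of_nat n))" by (rule exp_of_nat_mult[symmetric])
    also have "\<dots> = c" using n False by simp
    finally show ?thesis by blast
  qed
qed

lemma relative_invariants_ratio: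
  assumes I: "relative_invariant d k (I :: cfun \<Rightarrow> complex)" "relative_invariant d k I'" and d: "d > 0" and B: "B \<in> forms d" and c: "c \<noteq> 0"
  obtains e where "e \<noteq> 0" "I (\<lambda>z. c * B z) = e * I B" "I' (\<lambda>z. c * B z) = e * I' B"
proof -
  obtain s where s: "s ^ d = c" using complex_root_exists[OF d] by blast
  then have "s \<noteq> 0" using c d by auto
  then show thesis
    using that[of "(s ^ 2) ^ k"] relative_invariant_scale[OF I(1) B, of s] relative_invariant_scale[OF I(2) B, of s]
    by (simp add: s)
qed

lemma transpose_inverse:
  assumes "A ** A' = mat 1" shows "transpose A' ** transpose (A :: complex^2^2) = mat 1"
  using assms by (metis matrix_transpose_mul transpose_mat)

text \<open>The factor \<open>det A ^ 28\<close> in the covariance of the dual form is the eighth power of \<open>r ^ 7\<close> for a square root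
  \<open>r\<close> of \<open>det A\<close>. It contributes \<open>7 k\<close> to the exponent, and the contragredient substitution contributes
  \<open>- k\<close>.\<close>

lemma relative_invariant_dual_form:
  assumes I: "relative_invariant 8 k I"
  shows "relative_invariant 6 (6 * k) (\<lambda>Q. I (dual_form Q))"
  unfolding relative_invariant_iff
proof (intro conjI ballI allI impI)
  have "I \<in> polynomials_on (forms 8)" using I unfolding relative_invariant_def by blast
  then show "(\<lambda>Q. I (dual_form Q)) \<in> polynomials_on (forms 6)"
    by (rule polynomial_comp[OF _ function_algebra_polynomials_on forms_dual_form polynomials_on_dual_form])
next
  fix Q :: cfun and A A' :: "complex^2^2"
  assume Q: "Q \<in> forms 6" and A: "A ** A' = mat 1" "A' ** A = mat 1"
  let ?T = "transpose A'"
  have d: "det A * det A' = 1" by (rule det_inverse[OF A(1)])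
  obtain r where r: "r ^ 2 = det A" using complex_root_exists[of 2] by auto
  have r0: "r \<noteq> 0" using r d by auto
  have "(r ^ 7) ^ 8 = (r ^ 2) ^ 28" by (simp flip: power_mult)
  then have "(\<lambda>w. dual_form (\<lambda>z. Q (A *v z)) w) = (\<lambda>w. (r ^ 7) ^ 8 * dual_form Q (?T *v w))"
    by (simp only: dual_form_comp[OF Q A(2,1)] r)
  then have "I (dual_form (\<lambda>z. Q (A *v z))) = I (\<lambda>w. (r ^ 7) ^ 8 * dual_form Q (?T *v w))" by simp
  also have "\<dots> = ((r ^ 7) ^ 2) ^ k * I (\<lambda>w. dual_form Q (?T *v w))"
    by (rule relative_invariant_scale[OF I forms_comp[OF forms_dual_form]]) (use r0 in simp)
  also have "I (\<lambda>w. dual_form Q (?T *v w)) = det ?T ^ k * I (dual_form Q)"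
    by (rule relative_invariantD[OF I forms_dual_form transpose_inverse[OF A(1)] transpose_inverse[OF A(2)]])
  also have "det ?T = det A'" by (rule Determinants.det_transpose)
  also have "((r ^ 7) ^ 2) ^ k * (det A' ^ k * I (dual_form Q)) = det A ^ (6 * k) * I (dual_form Q)"
  proof -
    have "(r ^ 7) ^ 2 = det A ^ 7" by (simp flip: r power_mult)
    moreover have "det A ^ 7 * det A' = det A ^ 6 * (det A * det A')" by (simp add: eval_nat_numeral)
    ultimately have "(r ^ 7) ^ 2 * det A' = det A ^ 6" using d by simp
    then have "((r ^ 7) ^ 2) ^ k * det A' ^ k = det A ^ (6 * k)"
      by (simp only: power_mult_distrib[symmetric] power_mult)
    then show ?thesis by (simp only: mult.assoc[symmetric])
  qed
  finally show "I (dual_form (\<lambda>z. Q (A *v z))) = det A ^ (6 * k) * I (dual_form Q)" .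
qed

subsection \<open>From invariants of sextics to invariants of octics\<close>

text \<open>The pairing of two forms of degree \<open>6 d\<close> in the auxiliary point \<open>t\<close>.\<close>

definition polarized :: "nat \<Rightarrow> (cfun \<Rightarrow> complex) \<Rightarrow> (cfun \<Rightarrow> complex) \<Rightarrow> cfun \<Rightarrow> complex" where
  "polarized d p q B = skew (6 * d) (\<lambda>t. p (reconstruct B t)) (\<lambda>t. q (reconstruct B t))"

text \<open>The scalar matrices given by sixth roots of unity act trivially on sextics.\<close>

lemma weight_divisible:
  assumes p: "relative_invariant 6 k (p :: cfun \<Rightarrow> complex)" and Q: "Q \<in> forms 6" "p Q \<noteq> 0"
  obtains d where "k = 3 * d"
proof -
  let ?c = "cis (2 * pi / 6)"
  have "?c ^ 6 = 1" by (simp add: Complex.DeMoivre)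
  moreover have "(?c ^ 2) ^ k = cis (2 * pi * real k / 3)"
    by (simp add: Complex.DeMoivre power_mult[symmetric] field_simps)
  moreover have "p (\<lambda>z. ?c ^ 6 * Q z) = (?c ^ 2) ^ k * p Q"
    by (rule relative_invariant_scale[OF p Q(1)]) simp
  ultimately have "cis (2 * pi * real k / 3) = 1" using Q(2) by simp
  then have "cos (2 * pi * real k / 3) = 1" by (simp add: complex_eq_iff)
  then obtain n :: int where "2 * pi * real k / 3 = of_int n * 2 * pi" using cos_one_2pi_int by metis
  then have "2 * pi * real k = 2 * pi * (3 * of_int n)" by simp
  then have "real k = 3 * of_int n" by simp
  then have "int k = 3 * n" by linarith
  then have "k = 3 * nat n" by linarith
  then show thesis by (rule that)
qed

text \<open>For \<open>s \<noteq> 0\<close> a sixth root of \<open>s\<close> gives a scalar matrix; the case \<open>s = 0\<close> follows because both sides are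
  polynomials in \<open>s\<close>.\<close>

lemma relative_invariant_homogeneous:
  assumes p: "relative_invariant 6 (3 * d) (p :: cfun \<Rightarrow> complex)" and Q: "Q \<in> forms 6"
  shows "p (\<lambda>z. s * Q z) = s ^ d * p Q"
proof -
  have nz: "p (\<lambda>z. s * Q z) = s ^ d * p Q" if s: "s \<noteq> 0" for s
  proof -
    obtain c where c: "c ^ 6 = s" using complex_root_exists[of 6] by auto
    have "(c ^ 2) ^ (3 * d) = s ^ d" unfolding c[symmetric] by (simp flip: power_mult)
    then show ?thesis using relative_invariant_scale[OF p Q, of c] s c by auto
  qed
  show ?thesis
  proof (rule ccontr)
    assume ne: "p (\<lambda>z. s * Q z) \<noteq> s ^ d * p Q"
    note A = function_algebra_polyfuns
    have P: "p \<in> polynomials_on (forms 6)" using p unfolding relative_invariant_def by blast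
    have "(\<lambda>s. p (\<lambda>z. s * Q z)) \<in> polyfuns"
      by (rule polynomial_comp[OF P A]) (auto intro: forms_scale Q function_algebraD[OF A] polyfuns_id)
    then have "(\<lambda>s. p (\<lambda>z. s * Q z) - s ^ d * p Q) \<in> polyfuns"
      by (intro function_algebra_diff[OF A] function_algebraD[OF A] function_algebra_power[OF A] polyfuns_id)
    from polyfuns_common_nonzero[OF this polyfuns_id, of s 1] ne nz show False by auto
  qed
qed

lemma reconstruct_scale_comp: "reconstruct B (c *s t) = (\<lambda>v. c ^ 6 * reconstruct B t v)"
  by (rule ext) (rule reconstruct_scale_point)

lemma forms_polarization:
  assumes p: "relative_invariant 6 (3 * d) (p :: cfun \<Rightarrow> complex)"
  shows "(\<lambda>t. p (reconstruct B t)) \<in> forms (6 * d)"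
proof (rule homogeneous_polys2)
  have P: "p \<in> polynomials_on (forms 6)" using p unfolding relative_invariant_def by blast
  show "(\<lambda>t. p (reconstruct B t)) \<in> polys2"
    by (rule polynomial_comp[OF P function_algebra_polys2 forms_reconstruct reconstruct_polys2])
  show "p (reconstruct B (c *s t)) = c ^ (6 * d) * p (reconstruct B t)" for c t
    unfolding reconstruct_scale_comp relative_invariant_homogeneous[OF p forms_reconstruct] by (simp add: power_mult)
qed

text \<open>Each argument of the pairing contributes \<open>24 d - 3 d\<close> to the exponent, and the pairing itself \<open>6 d\<close>.\<close>

lemma relative_invariant_polarized:
  assumes p: "relative_invariant 6 (3 * d) (p :: cfun \<Rightarrow> complex)" and q: "relative_invariant 6 (3 * d) q"
  shows "relative_invariant 8 (48 * d) (polarized d p q)"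
  unfolding relative_invariant_iff
proof (intro conjI ballI allI impI)
  note A = function_algebra_polynomials_on[of "forms 8 :: cfun set"]
  have "(\<lambda>B. p (reconstruct B t)) \<in> polynomials_on (forms 8)" if "p \<in> polynomials_on (forms 6)" for p :: "cfun \<Rightarrow> complex" and t
    by (rule polynomial_comp[OF that A forms_reconstruct]) (intro function_algebra_reconstruct[OF A] polynomials_on_eval)
  then show "polarized d p q \<in> polynomials_on (forms 8)"
    unfolding polarized_def[abs_def]
    using p q unfolding relative_invariant_def by (intro function_algebra_skew[OF A]) auto
next
  fix B :: cfun and A A' :: "complex^2^2"
  assume B: "B \<in> forms 8" and A: "A ** A' = mat 1" "A' ** A = mat 1"
  let ?T = "transpose A'"
  have d1: "det A * det A' = 1" by (rule det_inverse[OF A(1)])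
  have g: "p (reconstruct (\<lambda>w. B (A *v w)) t) = det A ^ (21 * d) * p (reconstruct B (A *v t))"
    if p: "relative_invariant 6 (3 * d) p" for p :: "cfun \<Rightarrow> complex" and t
  proof -
    have "reconstruct (\<lambda>w. B (A *v w)) t = (\<lambda>v. det A ^ 24 * reconstruct B (A *v t) (?T *v v))"
      by (rule ext) (rule reconstruct_comp[OF B A(2,1)])
    then have "p (reconstruct (\<lambda>w. B (A *v w)) t) = (det A ^ 24) ^ d * p (\<lambda>v. reconstruct B (A *v t) (?T *v v))"
      by (simp only: relative_invariant_homogeneous[OF p forms_comp[OF forms_reconstruct]])
    also have "p (\<lambda>v. reconstruct B (A *v t) (?T *v v)) = det ?T ^ (3 * d) * p (reconstruct B (A *v t))"
      by (rule relative_invariantD[OF p forms_reconstruct transpose_inverse[OF A(1)] transpose_inverse[OF A(2)]])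
    also have "(det A ^ 24) ^ d * (det ?T ^ (3 * d) * p (reconstruct B (A *v t))) = det A ^ (21 * d) * p (reconstruct B (A *v t))"
    proof -
      have "det A ^ 24 * det A' ^ 3 = det A ^ 21 * (det A * det A') ^ 3"
        by (simp add: power_mult_distrib flip: power_add mult.assoc)
      then have "det A ^ 24 * det A' ^ 3 = det A ^ 21" using d1 by simp
      then have "(det A ^ 24) ^ d * det A' ^ (3 * d) = det A ^ (21 * d)"
        by (simp only: power_mult power_mult_distrib[symmetric])
      then show ?thesis by (simp only: Determinants.det_transpose mult.assoc[symmetric])
    qed
    finally show ?thesis .
  qed
  have "polarized d p q (\<lambda>w. B (A *v w))
    = det A ^ (21 * d) * det A ^ (21 * d) * skew (6 * d) (\<lambda>t. p (reconstruct B (A *v t))) (\<lambda>t. q (reconstruct B (A *v t)))"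
    unfolding polarized_def g[OF p] g[OF q] by (rule skew_scale)
  also have "skew (6 * d) (\<lambda>t. p (reconstruct B (A *v t))) (\<lambda>t. q (reconstruct B (A *v t))) = det A ^ (6 * d) * polarized d p q B"
    unfolding polarized_def by (rule skew_comp[OF forms_polarization[OF p] forms_polarization[OF q]])
  also have "det A ^ (21 * d) * det A ^ (21 * d) * (det A ^ (6 * d) * polarized d p q B) = det A ^ (48 * d) * polarized d p q B"
    by (simp flip: power_add mult.assoc)
  finally show "polarized d p q (\<lambda>w. B (A *v w)) = det A ^ (48 * d) * polarized d p q B" .
qed

abbreviation base_point :: "complex^2" where "base_point \<equiv> mk2 2 1"

text \<open>Up to a power of the value of \<open>Q\<close> at the base point, this is the pairing of \<open>M ^ d\<close> with itself, where
  \<open>reconstruct B t = M(t) Q\<close>. The base point is an arbitrary point at which the octahedral sextic does not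
  vanish; evaluation there makes the expression a polynomial.\<close>

definition multiplier_norm :: "nat \<Rightarrow> cfun \<Rightarrow> complex" where
  "multiplier_norm d B = skew (6 * d) (\<lambda>t. reconstruct B t base_point ^ d) (\<lambda>t. reconstruct B t base_point ^ d)"

lemma polarized_related:
  assumes p: "relative_invariant 6 (3 * d) (p :: cfun \<Rightarrow> complex)" and q: "relative_invariant 6 (3 * d) q"
    and Q: "Q \<in> forms 6" "related Q B" "Q base_point \<noteq> 0"
  shows "polarized d p q B = p Q * q Q * (multiplier_norm d B / (Q base_point ^ d * Q base_point ^ d))"
proof -
  let ?b = "Q base_point"
  have r: "p (reconstruct B t) = (p Q / ?b ^ d) * reconstruct B t base_point ^ d" if p: "relative_invariant 6 (3 * d) p" for p :: "cfun \<Rightarrow> complex" and t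
  proof -
    have "reconstruct B t = (\<lambda>v. (reconstruct B t base_point / ?b) * Q v)"
      using reconstruct_factor[OF Q, of t] Q(3) by (auto simp: field_simps)
    then have "p (reconstruct B t) = p (\<lambda>v. (reconstruct B t base_point / ?b) * Q v)" by (rule arg_cong)
    also have "\<dots> = (reconstruct B t base_point / ?b) ^ d * p Q" by (rule relative_invariant_homogeneous[OF p Q(1)])
    finally show ?thesis by (simp add: power_divide)
  qed
  show ?thesis unfolding polarized_def r[OF p] r[OF q] skew_scale multiplier_norm_def by simp
qed

lemma polynomials_on_multiplier_norm: "(\<lambda>Q. multiplier_norm d (dual_form Q)) \<in> polynomials_on (forms 6)"
proof -
  note A = function_algebra_polynomials_on[of "forms 6 :: cfun set"]
  have "(\<lambda>Q. reconstruct (dual_form Q) t base_point ^ d) \<in> polynomials_on (forms 6)" for t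
    by (intro function_algebra_power[OF A] function_algebra_reconstruct[OF A] polynomials_on_dual_form)
  then show ?thesis unfolding multiplier_norm_def by (intro function_algebra_skew[OF A])
qed

lemma multiplier_norm_octa: "multiplier_norm d (dual_form octa) \<noteq> 0"
proof -
  obtain c where c: "c \<noteq> 0" "\<And>t. reconstruct (dual_form octa) t base_point = c * octa t" using reconstruct_octa by blast
  have "multiplier_norm d (dual_form octa) = c ^ d * c ^ d * skew (6 * d) (\<lambda>t. octa t ^ d) (\<lambda>t. octa t ^ d)"
    unfolding multiplier_norm_def c(2) power_mult_distrib by (rule skew_scale)
  then show ?thesis using c(1) skew_octa by simp
qed

lemma associated_form_eq:
  assumes Q: "Q \<in> forms 6" "sylvester Q \<noteq> 0" "dual_form Q w \<noteq> 0" and B: "B \<in> associated_forms 6 Q"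
  obtains c where "c \<noteq> 0" "B = (\<lambda>z. c * dual_form Q z)"
  by (rule related_unique[OF associated_form_related[OF Q(1,2) B] Q(3)]) (rule that)

theorem theorem5p1:
  "associated_form_invariants 6 = restricted_absolute_invariants 6"
proof
  let ?X = "squarefree_forms 6" and ?P = "polynomials_on (forms 6 :: cfun set)"
  note A = function_algebra_polynomials_on[of "forms 6 :: cfun set"]
  have XF: "Q \<in> forms 6" if "Q \<in> ?X" for Q using that squarefree_forms_subset by blast
  have degree: "2 * (6 - 2) = (8 :: nat)" by simp
  \<comment> \<open>Where \<open>g0\<close> does not vanish, the associated forms are the nonzero multiples of the dual form.\<close>
  define g0 where "g0 Q = sylvester Q * dual_form Q (mk2 1 0)" for Q
  have g0: "g0 \<in> ?P" "g0 octa \<noteq> 0"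
    unfolding g0_def[abs_def] using sylvester_octa dual_form_octa
    by (auto intro!: function_algebraD[OF A] polynomials_on_sylvester polynomials_on_dual_form)
  show "associated_form_invariants 6 \<subseteq> restricted_absolute_invariants 6"
  proof
    fix x :: "((cfun \<Rightarrow> complex) \<times> (cfun \<Rightarrow> complex)) set"
    assume "x \<in> associated_form_invariants 6"
    then obtain p q I I' where x: "x = rational_function (forms 6) ?X p q"
      and pq: "p \<in> ?P" "q \<in> ?P" "\<exists>Q\<in>?X. q Q \<noteq> 0" and abs: "absolute_invariant 8 I I'"
      and gen: "generically (forms 6) ?X
        (\<lambda>Q. q Q \<noteq> 0 \<and> (\<forall>B\<in>associated_forms 6 Q. I' B \<noteq> 0 \<and> p Q / q Q = I B / I' B))"
      unfolding associated_form_invariants_def mem_Collect_eq degree by (elim exE conjE)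
    obtain k where I: "relative_invariant 8 k I" "relative_invariant 8 k I'"
      using abs unfolding absolute_invariant_def by blast
    obtain g where g: "g \<in> ?P" "\<exists>Q\<in>?X. g Q \<noteq> 0"
      and gQ: "\<And>Q. Q \<in> ?X \<Longrightarrow> g Q \<noteq> 0 \<Longrightarrow>
        q Q \<noteq> 0 \<and> (\<forall>B\<in>associated_forms 6 Q. I' B \<noteq> 0 \<and> p Q / q Q = I B / I' B)"
      using gen unfolding generically_def by blast
    define J where "J Q = I (dual_form Q)" for Q
    define J' where "J' Q = I' (dual_form Q)" for Q
    have J: "relative_invariant 6 (6 * k) J" "relative_invariant 6 (6 * k) J'"
      unfolding J_def[abs_def] J'_def[abs_def] by (rule relative_invariant_dual_form, rule I)+
    have JP: "J \<in> ?P" "J' \<in> ?P" using J unfolding relative_invariant_def by auto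
    \<comment> \<open>Equality of the two fractions at a generic \<open>Q\<close>, by comparison with some associated form.\<close>
    have good: "J' Q \<noteq> 0 \<and> p Q * J' Q = J Q * q Q" if Q: "Q \<in> ?X" "g Q * g0 Q \<noteq> 0" for Q
    proof -
      have Q': "sylvester Q \<noteq> 0" "dual_form Q (mk2 1 0) \<noteq> 0" "g Q \<noteq> 0" using Q(2) by (auto simp: g0_def)
      obtain B where B: "B \<in> associated_forms 6 Q"
        using associated_form_exists[OF XF[OF Q(1)] Q'(1,2)] by blast
      obtain c where c: "c \<noteq> 0" "B = (\<lambda>z. c * dual_form Q z)"
        using associated_form_eq[OF XF[OF Q(1)] Q'(1,2) B] .
      obtain e where e: "e \<noteq> 0" "I B = e * J Q" "I' B = e * J' Q"
        using relative_invariants_ratio[OF I _ forms_dual_form c(1), of Q] unfolding J_def J'_def c(2) by auto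
      have "q Q \<noteq> 0" "I' B \<noteq> 0" "p Q / q Q = I B / I' B" using gQ[OF Q(1) Q'(3)] B by auto
      then show ?thesis using e by (auto simp: field_simps)
    qed
    obtain Q1 where Q1: "Q1 \<in> ?X" "g Q1 \<noteq> 0" using g(2) by blast
    obtain S where S: "S \<in> ?X" "g S \<noteq> 0" "g0 S \<noteq> 0"
      using squarefree_forms_common_nonzero[OF g(1) g0(1) _ XF[OF Q1(1)] forms_octa Q1(2) g0(2)] by auto
    have gg0: "(\<lambda>Q. g Q * g0 Q) \<in> ?P" by (intro function_algebraD[OF A] g g0)
    have J'S: "J' S \<noteq> 0" using good[OF S(1)] S by simp
    have "p Q * J' Q = J Q * q Q" if Q: "Q \<in> ?X" for Q
    proof (rule ccontr)
      assume "p Q * J' Q \<noteq> J Q * q Q"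
      moreover have "(\<lambda>Q. p Q * J' Q - J Q * q Q) \<in> ?P"
        by (intro function_algebra_diff[OF A] function_algebraD[OF A] pq JP)
      ultimately obtain T where "T \<in> ?X" "g T * g0 T \<noteq> 0" "p T * J' T - J T * q T \<noteq> 0"
        using squarefree_forms_common_nonzero[OF gg0, of "\<lambda>Q. p Q * J' Q - J Q * q Q" S Q] S XF Q by auto
      then show False using good by auto
    qed
    then have "x = rational_function (forms 6) ?X J J'"
      unfolding x by (intro rational_function_eqI pq JP) (use S J'S in auto)
    moreover have "absolute_invariant 6 J J'"
      unfolding absolute_invariant_def using J J'S XF[OF S(1)] by blast
    ultimately show "x \<in> restricted_absolute_invariants 6"
      unfolding restricted_absolute_invariants_def by blast
  qed
  show "restricted_absolute_invariants 6 \<subseteq> associated_form_invariants 6"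
  proof
    fix x :: "((cfun \<Rightarrow> complex) \<times> (cfun \<Rightarrow> complex)) set"
    assume "x \<in> restricted_absolute_invariants 6"
    then obtain p q where x: "x = rational_function (forms 6) ?X p q" and abs: "absolute_invariant 6 p q"
      unfolding restricted_absolute_invariants_def by blast
    obtain k Q0 where k: "relative_invariant 6 k p" "relative_invariant 6 k q" and Q0: "Q0 \<in> forms 6" "q Q0 \<noteq> 0"
      using abs unfolding absolute_invariant_def by blast
    obtain d where "k = 3 * d" using weight_divisible[OF k(2) Q0] .
    then have pq: "relative_invariant 6 (3 * d) p" "relative_invariant 6 (3 * d) q" using k by auto
    then have P: "p \<in> ?P" "q \<in> ?P" unfolding relative_invariant_def by auto
    let ?I = "polarized d p q" and ?I' = "polarized d q q"
    \<comment> \<open>The additional factors ensure that the multiplier can be divided out.\<close>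
    define g1 where "g1 Q = g0 Q * Q base_point * multiplier_norm d (dual_form Q)" for Q
    have g1: "g1 \<in> ?P" "g1 octa \<noteq> 0"
    proof -
      show "g1 \<in> ?P" unfolding g1_def[abs_def]
        by (intro function_algebraD[OF A] g0 polynomials_on_eval polynomials_on_multiplier_norm)
      show "g1 octa \<noteq> 0" using g0(2) multiplier_norm_octa by (simp add: g1_def octa_def bmono_def)
    qed
    obtain S where S: "S \<in> ?X" "g1 S \<noteq> 0" "q S \<noteq> 0"
      using squarefree_forms_common_nonzero[OF g1(1) P(2) _ forms_octa Q0(1) g1(2) Q0(2)] by auto
    have I: "relative_invariant 8 (48 * d) ?I" "relative_invariant 8 (48 * d) ?I'"
      by (rule relative_invariant_polarized; rule pq)+
    have val: "?I' (dual_form Q) \<noteq> 0 \<and> p Q / q Q = ?I (dual_form Q) / ?I' (dual_form Q)"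
      if Q: "Q \<in> ?X" "g1 Q \<noteq> 0" "q Q \<noteq> 0" for Q
    proof -
      have b: "Q base_point \<noteq> 0" "multiplier_norm d (dual_form Q) \<noteq> 0" using Q(2) by (auto simp: g1_def)
      show ?thesis
        unfolding polarized_related[OF pq XF[OF Q(1)] related_dual_form b(1)]
          polarized_related[OF pq(2,2) XF[OF Q(1)] related_dual_form b(1)]
        using b Q(3) by simp
    qed
    have "generically (forms 6) ?X
      (\<lambda>Q. q Q \<noteq> 0 \<and> (\<forall>B\<in>associated_forms 6 Q. ?I' B \<noteq> 0 \<and> p Q / q Q = ?I B / ?I' B))"
      unfolding generically_def
    proof (intro bexI[of _ "\<lambda>Q. g1 Q * q Q"] conjI ballI impI)
      show "\<exists>Q\<in>?X. g1 Q * q Q \<noteq> 0" using S by auto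
      show "(\<lambda>Q. g1 Q * q Q) \<in> ?P" by (intro function_algebraD[OF A] g1 P)
      fix Q assume Q: "Q \<in> ?X" "g1 Q * q Q \<noteq> 0"
      then have Q': "g1 Q \<noteq> 0" "q Q \<noteq> 0" "sylvester Q \<noteq> 0" "dual_form Q (mk2 1 0) \<noteq> 0"
        by (auto simp: g1_def g0_def)
      show "q Q \<noteq> 0" by (rule Q'(2))
      fix B assume B: "B \<in> associated_forms 6 Q"
      obtain c where c: "c \<noteq> 0" "B = (\<lambda>z. c * dual_form Q z)"
        using associated_form_eq[OF XF[OF Q(1)] Q'(3,4) B] .
      obtain e where e: "e \<noteq> 0" "?I B = e * ?I (dual_form Q)" "?I' B = e * ?I' (dual_form Q)"
        using relative_invariants_ratio[OF I _ forms_dual_form c(1), of Q] unfolding c(2) by auto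
      show "?I' B \<noteq> 0" "p Q / q Q = ?I B / ?I' B"
        using val[OF Q(1) Q'(1,2)] e by auto
    qed
    moreover have "absolute_invariant 8 ?I ?I'"
      unfolding absolute_invariant_def using I val[OF S(1,2,3)] forms_dual_form by blast
    moreover have "\<exists>Q\<in>?X. q Q \<noteq> 0" using S by blast
    ultimately show "x \<in> associated_form_invariants 6"
      unfolding associated_form_invariants_def mem_Collect_eq x using P
      by (intro exI[of _ p] exI[of _ q] conjI exI[of _ ?I] exI[of _ ?I']) simp_all
  qed
qed

end
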